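(* Let $(M,g)$ be a compact connected Riemannian manifold without boundary with nonnegative sectional curvature. Then every harmonic symmetric bilinear form $\varphi\in C^\infty(S^2M)$ is invariant under parallel translations, i.e. $\nabla\varphi=0$. Moreover, if the sectional curvature is positive at some point of $M$ (i.e. $\sec>0$ for all $2$-planes at that point), then every harmonic $\varphi\in C^\infty(S^2M)$ is trivial, i.e. a constant multiple of $g$.
   Context: $\nabla$ is the Levi-Civita connection and $C^\infty(S^2M)$ is the space of smooth symmetric bilinear forms on $M$. For $\varphi\in C^\infty(S^2M)$, viewed as a one-form with values in $T^*M$, put $d^\nabla\varphi(X,Y,Z)=(\nabla_X\varphi)(Y,Z)-(\nabla_Y\varphi)(X,Z)$ and $(\delta^\nabla\varphi)(Y)=-\sum_i(\nabla_{E_i}\varphi)(E_i,Y)$ for a local orthonormal frame $\{E_i\}$. The form $\varphi$ is harmonic if $d^\nabla\varphi=0$ and $\delta^\nabla\varphi=0$. It is trivial if it is a constant multiple of the metric $g$. *)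

theory Defs
  imports "HOL-Analysis.Analysis"
begin

section \<open>Smooth functions on open subsets of Euclidean spaces\<close>

fun Ck_on :: "nat \<Rightarrow> ('a::real_normed_vector \<Rightarrow> 'b::real_normed_vector) \<Rightarrow> 'a set \<Rightarrow> bool" where
  "Ck_on 0 f S \<longleftrightarrow> continuous_on S f"
| "Ck_on (Suc k) f S \<longleftrightarrow>
     (\<forall>x\<in>S. f differentiable (at x)) \<and> (\<forall>v. Ck_on k (\<lambda>x. frechet_derivative f (at x) v) S)"

text \<open>Only used for open \<open>S\<close>.\<close>

definition smooth_on :: "'a::real_normed_vector set \<Rightarrow> ('a \<Rightarrow> 'b::real_normed_vector) \<Rightarrow> bool" where
  "smooth_on S f \<longleftrightarrow> (\<forall>k. Ck_on k f S)"

section \<open>Smooth manifolds\<close>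

text \<open>A chart is a pair \<open>(U, x)\<close>; the values of \<open>x\<close> outside \<open>U\<close> are irrelevant.
  The dimension of the manifold is \<open>CARD('n)\<close>.\<close>

type_synonym ('a, 'n) chart = "'a set \<times> ('a \<Rightarrow> real ^ 'n)"

abbreviation cdom :: "('a, 'n) chart \<Rightarrow> 'a set" where "cdom c \<equiv> fst c"
abbreviation cmap :: "('a, 'n) chart \<Rightarrow> 'a \<Rightarrow> real ^ 'n" where "cmap c \<equiv> snd c"
abbreviation cimg :: "('a, 'n) chart \<Rightarrow> (real ^ 'n) set" where "cimg c \<equiv> cmap c ` cdom c"

definition cinv :: "('a, 'n) chart \<Rightarrow> real ^ 'n \<Rightarrow> 'a" where
  "cinv c = inv_into (cdom c) (cmap c)"

definition is_chart :: "'a topology \<Rightarrow> ('a, 'n::finite) chart \<Rightarrow> bool" where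
  "is_chart M c \<longleftrightarrow> openin M (cdom c) \<and> open (cimg c) \<and>
     homeomorphic_map (subtopology M (cdom c)) (top_of_set (cimg c)) (cmap c)"

text \<open>Charts map onto open subsets of the whole Euclidean space, so there is no boundary.
  The smooth structure is the one determined by the (not necessarily maximal) atlas \<open>A\<close>.\<close>

definition smooth_manifold :: "'a topology \<Rightarrow> ('a, 'n::finite) chart set \<Rightarrow> bool" where
  "smooth_manifold M A \<longleftrightarrow> Hausdorff_space M \<and> second_countable M \<and>
     (\<forall>c\<in>A. is_chart M c) \<and> (\<Union>c\<in>A. cdom c) = topspace M \<and>
     (\<forall>c\<in>A. \<forall>c'\<in>A. smooth_on (cmap c ` (cdom c \<inter> cdom c')) (cmap c' \<circ> cinv c))"

definition smooth_fun :: "('a, 'n::finite) chart set \<Rightarrow> ('a \<Rightarrow> real) \<Rightarrow> bool" where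
  "smooth_fun A f \<longleftrightarrow> (\<forall>c\<in>A. smooth_on (cimg c) (f \<circ> cinv c))"

section \<open>Tangent vectors and vector fields\<close>

text \<open>A tangent vector at \<open>p\<close> is the family of its coordinate vectors in the charts around \<open>p\<close>,
  which are related by the differentials of the transition maps.  At all other charts the family is
  set to \<open>0\<close>, so that equality of tangent vectors is equality of functions, and the
  vector space operations are the pointwise ones.\<close>

type_synonym ('a, 'n) tvec = "('a, 'n) chart \<Rightarrow> real ^ 'n"

type_synonym ('a, 'n) vfield = "'a \<Rightarrow> ('a, 'n) tvec"

definition tangent_space :: "('a, 'n::finite) chart set \<Rightarrow> 'a \<Rightarrow> ('a, 'n) tvec set" where
  "tangent_space A p = {v.
     (\<forall>c. c \<notin> A \<or> p \<notin> cdom c \<longrightarrow> v c = 0) \<and>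
     (\<forall>c\<in>A. \<forall>c'\<in>A. p \<in> cdom c \<and> p \<in> cdom c' \<longrightarrow>
        v c' = frechet_derivative (cmap c' \<circ> cinv c) (at (cmap c p)) (v c))}"

definition coord_vec :: "('a, 'n::finite) chart set \<Rightarrow> ('a, 'n) chart \<Rightarrow> 'n \<Rightarrow> ('a, 'n) vfield" where
  "coord_vec A c i p = (\<lambda>c'. if c' \<in> A \<and> p \<in> cdom c'
     then frechet_derivative (cmap c' \<circ> cinv c) (at (cmap c p)) (axis i 1) else 0)"

definition vector_field :: "'a topology \<Rightarrow> ('a, 'n::finite) chart set \<Rightarrow> ('a, 'n) vfield \<Rightarrow> bool" where
  "vector_field M A X \<longleftrightarrow> (\<forall>p\<in>topspace M. X p \<in> tangent_space A p) \<and>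
     (\<forall>c\<in>A. smooth_on (cimg c) (\<lambda>y. X (cinv c y) c))"

text \<open>The derivative of \<open>f\<close> in the direction of a tangent vector \<open>v\<close> at \<open>p\<close>;
  by the chain rule it does not depend on the chart.\<close>

definition dir_deriv :: "('a, 'n::finite) chart set \<Rightarrow> 'a \<Rightarrow> ('a, 'n) tvec \<Rightarrow> ('a \<Rightarrow> real) \<Rightarrow> real" where
  "dir_deriv A p v f =
     (let c = (SOME c. c \<in> A \<and> p \<in> cdom c)
      in frechet_derivative (f \<circ> cinv c) (at (cmap c p)) (v c))"

definition lie_bracket ::
  "('a, 'n::finite) chart set \<Rightarrow> ('a, 'n) vfield \<Rightarrow> ('a, 'n) vfield \<Rightarrow> ('a, 'n) vfield" where
  "lie_bracket A X Y p = (\<lambda>c. if c \<in> A \<and> p \<in> cdom c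
     then frechet_derivative (\<lambda>y. Y (cinv c y) c) (at (cmap c p)) (X p c)
        - frechet_derivative (\<lambda>y. X (cinv c y) c) (at (cmap c p)) (Y p c)
     else 0)"

section \<open>Symmetric bilinear forms and Riemannian metrics\<close>

type_synonym ('a, 'n) bform = "'a \<Rightarrow> ('a, 'n) tvec \<Rightarrow> ('a, 'n) tvec \<Rightarrow> real"

text \<open>Linearity in the second argument follows from symmetry.  Smoothness means smoothness of all
  components in the charts.\<close>

definition smooth_sym_form ::
  "'a topology \<Rightarrow> ('a, 'n::finite) chart set \<Rightarrow> ('a, 'n) bform \<Rightarrow> bool" where
  "smooth_sym_form M A \<phi> \<longleftrightarrow>
     (\<forall>p\<in>topspace M. \<forall>u\<in>tangent_space A p. \<forall>v\<in>tangent_space A p.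
        \<phi> p u v = \<phi> p v u \<and>
        (\<forall>w\<in>tangent_space A p. \<forall>a. \<phi> p (\<lambda>c. a *\<^sub>R u c + v c) w = a * \<phi> p u w + \<phi> p v w)) \<and>
     (\<forall>c\<in>A. \<forall>i j. smooth_on (cimg c)
        ((\<lambda>q. \<phi> q (coord_vec A c i q) (coord_vec A c j q)) \<circ> cinv c))"

definition riemannian_metric ::
  "'a topology \<Rightarrow> ('a, 'n::finite) chart set \<Rightarrow> ('a, 'n) bform \<Rightarrow> bool" where
  "riemannian_metric M A g \<longleftrightarrow> smooth_sym_form M A g \<and>
     (\<forall>p\<in>topspace M. \<forall>u\<in>tangent_space A p. u \<noteq> (\<lambda>_. 0) \<longrightarrow> g p u u > 0)"

section \<open>The Levi-Civita connection\<close>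

text \<open>\<open>D X Y\<close> is the covariant derivative of \<open>Y\<close> in the direction of \<open>X\<close>.
  On smooth vector fields, \<open>D\<close> is uniquely determined on \<open>topspace M\<close> by the following
  properties; its values on other arguments are irrelevant.\<close>

type_synonym ('a, 'n) connection = "('a, 'n) vfield \<Rightarrow> ('a, 'n) vfield \<Rightarrow> ('a, 'n) vfield"

definition affine_connection ::
  "'a topology \<Rightarrow> ('a, 'n::finite) chart set \<Rightarrow> ('a, 'n) connection \<Rightarrow> bool" where
  "affine_connection M A D \<longleftrightarrow>
     (\<forall>X Y. vector_field M A X \<and> vector_field M A Y \<longrightarrow> vector_field M A (D X Y)) \<and>
     (\<forall>f X Y Z. smooth_fun A f \<and> vector_field M A X \<and> vector_field M A Y \<and> vector_field M A Z \<longrightarrow>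
        (\<forall>p\<in>topspace M. \<forall>c.
           D (\<lambda>q c. f q *\<^sub>R X q c + Y q c) Z p c = f p *\<^sub>R D X Z p c + D Y Z p c \<and>
           D Z (\<lambda>q c. f q *\<^sub>R X q c + Y q c) p c =
             dir_deriv A p (Z p) f *\<^sub>R X p c + f p *\<^sub>R D Z X p c + D Z Y p c))"

definition levi_civita_connection ::
  "'a topology \<Rightarrow> ('a, 'n::finite) chart set \<Rightarrow> ('a, 'n) bform \<Rightarrow> ('a, 'n) connection \<Rightarrow> bool" where
  "levi_civita_connection M A g D \<longleftrightarrow> affine_connection M A D \<and>
     (\<forall>X Y. vector_field M A X \<and> vector_field M A Y \<longrightarrow>
        (\<forall>p\<in>topspace M. \<forall>c. D X Y p c - D Y X p c = lie_bracket A X Y p c)) \<and>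
     (\<forall>X Y Z. vector_field M A X \<and> vector_field M A Y \<and> vector_field M A Z \<longrightarrow>
        (\<forall>p\<in>topspace M. dir_deriv A p (X p) (\<lambda>q. g q (Y q) (Z q)) =
           g p (D X Y p) (Z p) + g p (Y p) (D X Z p)))"

section \<open>Sectional curvature\<close>

definition curvature ::
  "('a, 'n::finite) chart set \<Rightarrow> ('a, 'n) connection \<Rightarrow>
     ('a, 'n) vfield \<Rightarrow> ('a, 'n) vfield \<Rightarrow> ('a, 'n) vfield \<Rightarrow> ('a, 'n) vfield" where
  "curvature A D X Y Z p =
     (\<lambda>c. D X (D Y Z) p c - D Y (D X Z) p c - D (lie_bracket A X Y) Z p c)"

definition lin_indep2 :: "('a, 'n::finite) tvec \<Rightarrow> ('a, 'n) tvec \<Rightarrow> bool" where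
  "lin_indep2 u v \<longleftrightarrow> (\<forall>a b. (\<forall>c. a *\<^sub>R u c + b *\<^sub>R v c = 0) \<longrightarrow> a = 0 \<and> b = 0)"

text \<open>The sectional curvature of the plane spanned by \<open>X p\<close> and \<open>Y p\<close>.
  The numerator is tensorial, and every tangent vector extends to a global vector field,
  so letting \<open>X\<close> and \<open>Y\<close> range over all vector fields that are linearly
  independent at \<open>p\<close> covers exactly the planes at \<open>p\<close>.\<close>

definition sec_curv ::
  "('a, 'n::finite) chart set \<Rightarrow> ('a, 'n) bform \<Rightarrow> ('a, 'n) connection \<Rightarrow>
     ('a, 'n) vfield \<Rightarrow> ('a, 'n) vfield \<Rightarrow> 'a \<Rightarrow> real" where
  "sec_curv A g D X Y p = g p (curvature A D X Y Y p) (X p) /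
     (g p (X p) (X p) * g p (Y p) (Y p) - (g p (X p) (Y p))\<^sup>2)"

definition sec_nonneg_at ::
  "'a topology \<Rightarrow> ('a, 'n::finite) chart set \<Rightarrow> ('a, 'n) bform \<Rightarrow> ('a, 'n) connection \<Rightarrow> 'a \<Rightarrow> bool" where
  "sec_nonneg_at M A g D p \<longleftrightarrow>
     (\<forall>X Y. vector_field M A X \<and> vector_field M A Y \<and> lin_indep2 (X p) (Y p) \<longrightarrow>
        sec_curv A g D X Y p \<ge> 0)"

definition sec_pos_at ::
  "'a topology \<Rightarrow> ('a, 'n::finite) chart set \<Rightarrow> ('a, 'n) bform \<Rightarrow> ('a, 'n) connection \<Rightarrow> 'a \<Rightarrow> bool" where
  "sec_pos_at M A g D p \<longleftrightarrow>
     (\<forall>X Y. vector_field M A X \<and> vector_field M A Y \<and> lin_indep2 (X p) (Y p) \<longrightarrow>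
        sec_curv A g D X Y p > 0)"

section \<open>Harmonic, parallel and trivial forms\<close>

text \<open>\<open>nabla A D \<phi> X Y Z\<close> is the function \<open>(\<nabla>\<^sub>X \<phi>)(Y, Z)\<close>.\<close>

definition nabla ::
  "('a, 'n::finite) chart set \<Rightarrow> ('a, 'n) connection \<Rightarrow> ('a, 'n) bform \<Rightarrow>
     ('a, 'n) vfield \<Rightarrow> ('a, 'n) vfield \<Rightarrow> ('a, 'n) vfield \<Rightarrow> 'a \<Rightarrow> real" where
  "nabla A D \<phi> X Y Z p = dir_deriv A p (X p) (\<lambda>q. \<phi> q (Y q) (Z q))
     - \<phi> p (D X Y p) (Z p) - \<phi> p (Y p) (D X Z p)"

definition d_nabla ::
  "('a, 'n::finite) chart set \<Rightarrow> ('a, 'n) connection \<Rightarrow> ('a, 'n) bform \<Rightarrow>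
     ('a, 'n) vfield \<Rightarrow> ('a, 'n) vfield \<Rightarrow> ('a, 'n) vfield \<Rightarrow> 'a \<Rightarrow> real" where
  "d_nabla A D \<phi> X Y Z p = nabla A D \<phi> X Y Z p - nabla A D \<phi> Y X Z p"

text \<open>Local orthonormal frames are given by global vector fields that are orthonormal on an open
  set \<open>U\<close>; using a cutoff function, every local frame agrees near any given point
  with one of this kind.\<close>

definition orthonormal_frame_on ::
  "'a topology \<Rightarrow> ('a, 'n::finite) chart set \<Rightarrow> ('a, 'n) bform \<Rightarrow> 'a set \<Rightarrow> ('n \<Rightarrow> ('a, 'n) vfield) \<Rightarrow> bool" where
  "orthonormal_frame_on M A g U E \<longleftrightarrow> openin M U \<and> (\<forall>i. vector_field M A (E i)) \<and>
     (\<forall>p\<in>U. \<forall>i j. g p (E i p) (E j p) = (if i = j then 1 else 0))"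

definition delta_nabla ::
  "('a, 'n::finite) chart set \<Rightarrow> ('a, 'n) connection \<Rightarrow> ('a, 'n) bform \<Rightarrow>
     ('n \<Rightarrow> ('a, 'n) vfield) \<Rightarrow> ('a, 'n) vfield \<Rightarrow> 'a \<Rightarrow> real" where
  "delta_nabla A D \<phi> E Y p = - (\<Sum>i\<in>UNIV. nabla A D \<phi> (E i) (E i) Y p)"

definition harmonic_form ::
  "'a topology \<Rightarrow> ('a, 'n::finite) chart set \<Rightarrow> ('a, 'n) bform \<Rightarrow> ('a, 'n) connection \<Rightarrow> ('a, 'n) bform \<Rightarrow> bool" where
  "harmonic_form M A g D \<phi> \<longleftrightarrow>
     (\<forall>X Y Z. vector_field M A X \<and> vector_field M A Y \<and> vector_field M A Z \<longrightarrow>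
        (\<forall>p\<in>topspace M. d_nabla A D \<phi> X Y Z p = 0)) \<and>
     (\<forall>U E Y. orthonormal_frame_on M A g U E \<and> vector_field M A Y \<longrightarrow>
        (\<forall>p\<in>U. delta_nabla A D \<phi> E Y p = 0))"

definition parallel_form ::
  "'a topology \<Rightarrow> ('a, 'n::finite) chart set \<Rightarrow> ('a, 'n) connection \<Rightarrow> ('a, 'n) bform \<Rightarrow> bool" where
  "parallel_form M A D \<phi> \<longleftrightarrow>
     (\<forall>X Y Z. vector_field M A X \<and> vector_field M A Y \<and> vector_field M A Z \<longrightarrow>
        (\<forall>p\<in>topspace M. nabla A D \<phi> X Y Z p = 0))"

definition trivial_form ::
  "'a topology \<Rightarrow> ('a, 'n::finite) chart set \<Rightarrow> ('a, 'n) bform \<Rightarrow> ('a, 'n) bform \<Rightarrow> bool" where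
  "trivial_form M A g \<phi> \<longleftrightarrow>
     (\<exists>k. \<forall>p\<in>topspace M. \<forall>u\<in>tangent_space A p. \<forall>v\<in>tangent_space A p. \<phi> p u v = k * g p u v)"

end

theory Submission
  imports Defs
begin

text \<open>
  The proof is Bochner's. Let \<open>\<phi>\<close> be harmonic. Then \<open>\<nabla>\<phi>\<close> is symmetric in all three arguments and
  all its traces vanish. In the sum over an orthonormal frame of \<open>\<nabla>\<^sup>2\<phi>(E_k, E_k, E_j, E_j)\<close> the
  symmetry lets the second and third arguments be exchanged; the Ricci identity then exchanges the
  first two at the price of curvature, and what is left is the derivative of a vanishing trace. In a
  frame that diagonalises \<open>\<phi>\<close> at a point, with eigenvalues \<open>\<lambda>_j\<close> and sectional curvatures \<open>K_kj\<close>,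
  this gives

  \<open>\<Delta>|\<phi>|\<^sup>2 = 2 |\<nabla>\<phi>|\<^sup>2 + \<Sum>\<^sub>k\<^sub>j K_kj (\<lambda>_j - \<lambda>_k)\<^sup>2\<close>

  (\<open>bochner_formula\<close>). So nonnegative curvature makes \<open>|\<phi>|\<^sup>2\<close> subharmonic. Instead of integrating
  over \<open>M\<close>, the argument uses Hopf's strong maximum principle: on a compact connected manifold the set
  where a subharmonic function attains its maximum is closed, nonempty and open
  (\<open>strong_maximum_principle_local\<close>, \<open>subharmonic_constant\<close>). Hence \<open>|\<phi>|\<^sup>2\<close> is constant, both terms on
  the right vanish everywhere, and \<open>\<nabla>\<phi> = 0\<close> (\<open>equality_case\<close>).

  At a point where all sectional curvatures are positive the vanishing of the second term forces the
  eigenvalues to coincide, so \<open>\<phi> = l g\<close> there for a number \<open>l\<close>. The form \<open>\<phi> - l g\<close> is harmonic too,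
  because \<open>\<nabla>g = 0\<close>; its norm is therefore constant, and it is zero at that point. So \<open>\<phi> = l g\<close> on
  all of \<open>M\<close>.

  The connection acts on globally defined vector fields only. Bump functions supply global fields
  with prescribed values at a point and, by Gram--Schmidt, global fields that are
  orthonormal near a given point (\<open>frame_exists\<close>); locality of the connection in its first
  argument makes \<open>\<nabla>\<phi>\<close> computable from its values on such frames (\<open>nabla_frame_expand\<close>). The norm of a
  form is differentiated through such a frame: the derivatives of the frame form an antisymmetric
  matrix and cancel (\<open>infinitesimal_rotation_cancel\<close>).
\<close>

section \<open>Calculus of smooth functions\<close>

abbreviation FD :: "('a::real_normed_vector \<Rightarrow> 'b::real_normed_vector) \<Rightarrow> 'a \<Rightarrow> 'a \<Rightarrow> 'b" where
  "FD f x \<equiv> frechet_derivative f (at x)"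

lemma frechet_derivative_cong_open:
  assumes "open S" "x \<in> S" "\<And>z. z \<in> S \<Longrightarrow> f z = g z"
  shows "FD f x = FD g x"
    and "f differentiable (at x) \<longleftrightarrow> g differentiable (at x)"
proof -
  have "(f has_derivative d) (at x) \<longleftrightarrow> (g has_derivative d) (at x)" for d
    using has_derivative_transform_within_open[of f d x UNIV S g]
      has_derivative_transform_within_open[of g d x UNIV S f] assms by metis
  then show "FD f x = FD g x"
    "f differentiable (at x) \<longleftrightarrow> g differentiable (at x)"
    unfolding frechet_derivative_def differentiable_def by auto
qed

lemma Ck_on_cong:
  assumes "open S" "\<And>x. x \<in> S \<Longrightarrow> f x = g x" "Ck_on k f S"
  shows "Ck_on k g S"
  using assms(2,3)
proof (induction k arbitrary: f g)
  case 0
  then show ?case by (metis Ck_on.simps(1) continuous_on_cong)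
next
  case (Suc k)
  have eq: "FD f x v = FD g x v"
    and d: "f differentiable (at x) \<longleftrightarrow> g differentiable (at x)" if "x \<in> S" for x v
    using frechet_derivative_cong_open[OF assms(1) that Suc.prems(1)] by auto
  show ?case
    using Suc.prems(2) Suc.IH[OF eq] d by auto
qed

lemma Ck_on_subset: "Ck_on k f T \<Longrightarrow> S \<subseteq> T \<Longrightarrow> Ck_on k f S"
  by (induction k arbitrary: f) (auto intro: continuous_on_subset)

lemma Ck_on_local:
  assumes "\<And>x. x \<in> S \<Longrightarrow> \<exists>T. open T \<and> x \<in> T \<and> Ck_on k f T"
  shows "Ck_on k f S"
  using assms
proof (induction k arbitrary: f)
  case 0
  have "isCont f x" if "x \<in> S" for x
    using 0[OF that] by (auto simp: continuous_on_eq_continuous_at)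
  then show ?case by (simp add: continuous_at_imp_continuous_on)
next
  case (Suc k)
  have "f differentiable (at x)" if "x \<in> S" for x
    using Suc.prems[OF that] by auto
  moreover have "Ck_on k (\<lambda>x. FD f x v) S" for v
    by (rule Suc.IH) (use Suc.prems in fastforce)
  ultimately show ?case by simp
qed

lemma Ck_on_Suc_imp: "Ck_on (Suc k) f S \<Longrightarrow> Ck_on k f S"
proof (induction k arbitrary: f)
  case 0
  then show ?case
    by (auto intro!: continuous_at_imp_continuous_on differentiable_imp_continuous_within)
qed auto

lemma Ck_on_const [simp]: "Ck_on k (\<lambda>x. c) S"
proof (induction k arbitrary: c)
  case (Suc k)
  have "FD (\<lambda>x. c) x = (\<lambda>_. 0)" for x :: 'a
    by simp
  then show ?case using Suc by simp
qed simp

lemma Ck_on_bounded_linear: "bounded_linear f \<Longrightarrow> Ck_on k f S"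
proof (cases k)
  case (Suc l)
  assume f: "bounded_linear f"
  have "(f has_derivative f) (at x)" for x
    using f by (rule bounded_linear_imp_has_derivative)
  then have "FD f x = f" for x
    by (metis frechet_derivative_at)
  then show ?thesis
    unfolding Suc using f by (auto simp: bounded_linear_imp_differentiable)
qed (auto simp: linear_continuous_on)

lemma Ck_on_add:
  assumes "open S" "Ck_on k f S" "Ck_on k h S"
  shows "Ck_on k (\<lambda>x. f x + h x) S"
  using assms(2,3)
proof (induction k arbitrary: f h)
  case 0
  then show ?case by (auto intro: continuous_intros)
next
  case (Suc k)
  have eq: "FD f x v + FD h x v
      = FD (\<lambda>x. f x + h x) x v" if "x \<in> S" for x v
  proof -
    have "((\<lambda>x. f x + h x) has_derivative
      (\<lambda>v. FD f x v + FD h x v)) (at x)"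
      using Suc.prems that by (auto intro!: has_derivative_add simp: frechet_derivative_works)
    from frechet_derivative_at[OF this] show ?thesis by metis
  qed
  show ?case
    using Suc.prems
    by (auto intro!: Ck_on_cong[OF assms(1) eq] Suc.IH simp: differentiable_add)
qed

lemma Ck_on_bilinear:
  assumes "bounded_bilinear B" "open S" "Ck_on k f S" "Ck_on k h S"
  shows "Ck_on k (\<lambda>x. B (f x) (h x)) S"
  using assms(3,4)
proof (induction k arbitrary: f h)
  case 0
  then show ?case by (simp add: bounded_bilinear.continuous_on[OF assms(1)])
next
  case (Suc k)
  have dB: "((\<lambda>x. B (f x) (h x)) has_derivative
      (\<lambda>v. B (f x) (FD h x v) + B (FD f x v) (h x))) (at x)"
    if "x \<in> S" for x
    using Suc.prems that
    by (intro bounded_bilinear.FDERIV[OF assms(1)]) (auto simp: frechet_derivative_works)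
  have eq: "B (f x) (FD h x v) + B (FD f x v) (h x)
      = FD (\<lambda>x. B (f x) (h x)) x v" if "x \<in> S" for x v
    using frechet_derivative_at[OF dB[OF that]] by metis
  have "Ck_on k (\<lambda>x. B (f x) (FD h x v) + B (FD f x v) (h x)) S" for v
    using Suc.prems Ck_on_Suc_imp[of k f S] Ck_on_Suc_imp[of k h S]
    by (intro Ck_on_add[OF assms(2)] Suc.IH) auto
  then show ?case
    using dB by (auto intro!: Ck_on_cong[OF assms(2) eq] simp: differentiable_def)
qed

lemma Ck_on_sum:
  assumes "open S" "\<And>i. i \<in> I \<Longrightarrow> Ck_on k (f i) S"
  shows "Ck_on k (\<lambda>x. \<Sum>i\<in>I. f i x) S"
  using assms(2) by (induction I rule: infinite_finite_induct) (auto intro: Ck_on_add[OF assms(1)])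

lemma frechet_derivative_expand_Basis:
  fixes f :: "'a::euclidean_space \<Rightarrow> 'b::real_normed_vector"
  assumes "f differentiable (at x)"
  shows "FD f x v = (\<Sum>b\<in>Basis. (v \<bullet> b) *\<^sub>R FD f x b)"
proof -
  have l: "linear (FD f x)"
    using assms by (rule linear_frechet_derivative)
  have "FD f x v = FD f x (\<Sum>b\<in>Basis. (v \<bullet> b) *\<^sub>R b)"
    by (simp add: euclidean_representation)
  also have "\<dots> = (\<Sum>b\<in>Basis. (v \<bullet> b) *\<^sub>R FD f x b)"
    using l by (simp add: linear_sum linear_scale)
  finally show ?thesis .
qed

text \<open>The chain rule writes the derivative of the composition as a sum, over a basis, of
  products of first derivatives, to which the lower order of differentiability applies.\<close>

lemma Ck_on_compose:
  fixes f :: "'b::euclidean_space \<Rightarrow> 'c::real_normed_vector" and h :: "'a::real_normed_vector \<Rightarrow> 'b"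
  assumes "open S" "open T" "\<And>x. x \<in> S \<Longrightarrow> h x \<in> T" "Ck_on k f T" "Ck_on k h S"
  shows "Ck_on k (\<lambda>x. f (h x)) S"
  using assms(4,5)
proof (induction k arbitrary: f)
  case 0
  then show ?case using assms(3)
    using continuous_on_compose2[of T f S h] by auto
next
  case (Suc k)
  have dh: "((\<lambda>x. f (h x)) has_derivative
      (\<lambda>v. FD f (h x) (FD h x v))) (at x)"
    if "x \<in> S" for x
  proof (rule has_derivative_compose[of h _ x UNIV f])
    show "(h has_derivative FD h x) (at x)"
      using Suc.prems that by (simp add: frechet_derivative_works)
    show "(f has_derivative FD f (h x)) (at (h x))"
      using Suc.prems that assms(3) by (simp add: frechet_derivative_works)
  qed
  have eq: "(\<Sum>b\<in>Basis. (FD h x v \<bullet> b) *\<^sub>R FD f (h x) b)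
      = FD (\<lambda>x. f (h x)) x v" if "x \<in> S" for x v
    using frechet_derivative_at[OF dh[OF that]] Suc.prems(1) assms(3)[OF that]
      frechet_derivative_expand_Basis[of f "h x"] by (metis Ck_on.simps(2))
  have "Ck_on k (\<lambda>x. \<Sum>b\<in>Basis. (FD h x v \<bullet> b) *\<^sub>R FD f (h x) b) S" for v
  proof (intro Ck_on_sum[OF assms(1)] Ck_on_bilinear[OF bounded_bilinear_scaleR assms(1)]
      Ck_on_bilinear[OF bounded_bilinear_inner assms(1)] Ck_on_const)
    show "Ck_on k (\<lambda>x. FD h x v) S"
      using Suc.prems by simp
    show "Ck_on k (\<lambda>x. FD f (h x) b) S" for b
      by (rule Suc.IH) (use Suc.prems Ck_on_Suc_imp[of k h S] in auto)
  qed
  then show ?case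
    using dh by (auto intro!: Ck_on_cong[OF assms(1) eq] simp: differentiable_def)
qed

lemma smooth_on_const [simp]: "smooth_on S (\<lambda>x. c)"
  by (simp add: smooth_on_def)

lemma smooth_on_bounded_linear: "bounded_linear f \<Longrightarrow> smooth_on S f"
  by (simp add: smooth_on_def Ck_on_bounded_linear)

lemma smooth_on_cong:
  assumes "open S" "smooth_on S f" "\<And>x. x \<in> S \<Longrightarrow> f x = g x"
  shows "smooth_on S g"
  using assms Ck_on_cong unfolding smooth_on_def by blast

lemma smooth_on_subset: "smooth_on T f \<Longrightarrow> S \<subseteq> T \<Longrightarrow> smooth_on S f"
  unfolding smooth_on_def by (blast intro: Ck_on_subset)

lemma smooth_on_local:
  assumes "\<And>x. x \<in> S \<Longrightarrow> \<exists>T. open T \<and> x \<in> T \<and> smooth_on T f"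
  shows "smooth_on S f"
  unfolding smooth_on_def
proof (intro allI Ck_on_local)
  fix k x assume "x \<in> S"
  then show "\<exists>T. open T \<and> x \<in> T \<and> Ck_on k f T"
    using assms unfolding smooth_on_def by blast
qed

lemma smooth_on_add: "open S \<Longrightarrow> smooth_on S f \<Longrightarrow> smooth_on S h \<Longrightarrow> smooth_on S (\<lambda>x. f x + h x)"
  by (simp add: smooth_on_def Ck_on_add)

lemma smooth_on_bilinear:
  "bounded_bilinear B \<Longrightarrow> open S \<Longrightarrow> smooth_on S f \<Longrightarrow> smooth_on S h \<Longrightarrow> smooth_on S (\<lambda>x. B (f x) (h x))"
  by (simp add: smooth_on_def Ck_on_bilinear)

lemmas smooth_on_scaleR = smooth_on_bilinear[OF bounded_bilinear_scaleR]

lemma smooth_on_mult: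
  fixes f h :: "'a::real_normed_vector \<Rightarrow> real"
  shows "open S \<Longrightarrow> smooth_on S f \<Longrightarrow> smooth_on S h \<Longrightarrow> smooth_on S (\<lambda>x. f x * h x)"
  by (rule smooth_on_bilinear[OF bounded_bilinear_mult])

lemma smooth_on_sum:
  "open S \<Longrightarrow> (\<And>i. i \<in> I \<Longrightarrow> smooth_on S (f i)) \<Longrightarrow> smooth_on S (\<lambda>x. \<Sum>i\<in>I. f i x)"
  by (simp add: smooth_on_def Ck_on_sum)

lemma smooth_on_compose:
  fixes f :: "'b::euclidean_space \<Rightarrow> 'c::real_normed_vector" and h :: "'a::real_normed_vector \<Rightarrow> 'b"
  assumes "open S" "open T" "\<And>x. x \<in> S \<Longrightarrow> h x \<in> T" "smooth_on T f" "smooth_on S h"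
  shows "smooth_on S (\<lambda>x. f (h x))"
  using assms by (auto simp: smooth_on_def intro: Ck_on_compose)

lemma smooth_on_imp_differentiable: "smooth_on S f \<Longrightarrow> x \<in> S \<Longrightarrow> f differentiable (at x)"
  using Ck_on.simps(2)[of 0 f S] unfolding smooth_on_def by (metis)

lemma smooth_on_imp_has_derivative:
  "smooth_on S f \<Longrightarrow> x \<in> S \<Longrightarrow> (f has_derivative FD f x) (at x)"
  using smooth_on_imp_differentiable frechet_derivative_works by blast

lemma smooth_on_imp_continuous_on: "smooth_on S f \<Longrightarrow> continuous_on S f"
  unfolding smooth_on_def by (metis Ck_on.simps(1))

lemma smooth_on_frechet_derivative: "smooth_on S f \<Longrightarrow> smooth_on S (\<lambda>x. FD f x v)"
  unfolding smooth_on_def by (metis Ck_on.simps(2))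

lemma smooth_on_frechet_derivative_field:
  fixes f :: "'a::euclidean_space \<Rightarrow> 'b::real_normed_vector"
  assumes "open S" "smooth_on S f" "smooth_on S X"
  shows "smooth_on S (\<lambda>x. FD f x (X x))"
proof (rule smooth_on_cong[OF assms(1)])
  show "smooth_on S (\<lambda>x. \<Sum>b\<in>Basis. (X x \<bullet> b) *\<^sub>R FD f x b)"
    by (intro smooth_on_sum smooth_on_scaleR smooth_on_bilinear[OF bounded_bilinear_inner]
        smooth_on_frechet_derivative assms smooth_on_const)
  show "\<And>x. x \<in> S \<Longrightarrow> (\<Sum>b\<in>Basis. (X x \<bullet> b) *\<^sub>R FD f x b) =
      FD f x (X x)"
    using assms(2) by (metis frechet_derivative_expand_Basis smooth_on_imp_differentiable)
qed

lemma smooth_on_diff_const: "open S \<Longrightarrow> smooth_on S (\<lambda>x. x - z)"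
  using smooth_on_add[of S "\<lambda>x. x" "\<lambda>_. - z"] smooth_on_bounded_linear[OF bounded_linear_ident] by auto

lemma smooth_on_vec_nth: "open S \<Longrightarrow> smooth_on S f \<Longrightarrow> smooth_on S (\<lambda>x. f x $ i)"
  for f :: "'a::real_normed_vector \<Rightarrow> real^'n::finite"
  by (rule smooth_on_compose[of S UNIV f "\<lambda>v. v $ i"])
    (auto intro: smooth_on_bounded_linear bounded_linear_vec_nth)

text \<open>When \<open>f'\<close> is built from \<open>f\<close> by sums and products, its order of differentiability is at least
  that of \<open>f\<close>, and smoothness follows by repeating this step.\<close>

lemma Ck_on_Suc_real_derivI:
  fixes f :: "real \<Rightarrow> real"
  assumes "open S" "\<And>x. x \<in> S \<Longrightarrow> (f has_real_derivative f' x) (at x)" "Ck_on k f' S"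
  shows "Ck_on (Suc k) f S"
proof -
  have d: "(f has_derivative (\<lambda>v. f' x * v)) (at x)" if "x \<in> S" for x
    using assms(2)[OF that] by (simp add: has_field_derivative_def)
  have eq: "f' x * v = FD f x v" if "x \<in> S" for x v
    using frechet_derivative_at[OF d[OF that]] by metis
  have "Ck_on k (\<lambda>x. f' x * v) S" for v
    by (intro Ck_on_bilinear[OF bounded_bilinear_mult] assms Ck_on_const)
  from Ck_on_cong[OF assms(1) eq this] show ?thesis
    using d by (auto simp only: Ck_on.simps differentiable_def)
qed

lemma smooth_on_inverse_sqrt: "smooth_on {0<..} (\<lambda>t::real. 1 / sqrt t)"
proof -
  have "Ck_on k (\<lambda>t::real. 1 / sqrt t) {0<..}" for k
  proof (induction k)
    case 0
    show ?case by (auto intro!: continuous_intros)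
  next
    case (Suc k)
    show ?case
    proof (rule Ck_on_Suc_real_derivI)
      show "((\<lambda>t. 1 / sqrt t) has_real_derivative
          - (1/2) * ((1 / sqrt x) * ((1 / sqrt x) * (1 / sqrt x)))) (at x)" if "x \<in> {0<..}" for x
        using that by (auto intro!: derivative_eq_intros simp: field_simps)
      show "Ck_on k (\<lambda>x::real. - (1/2) * ((1 / sqrt x) * ((1 / sqrt x) * (1 / sqrt x)))) {0<..}"
        by (intro Ck_on_bilinear[OF bounded_bilinear_mult] Ck_on_const Suc open_greaterThan)
    qed simp
  qed
  then show ?thesis by (simp add: smooth_on_def)
qed

lemma smooth_on_inverse: "smooth_on {0<..} (\<lambda>t::real. 1 / t)"
proof (rule smooth_on_cong)
  show "smooth_on {0<..} (\<lambda>t::real. (1 / sqrt t) * (1 / sqrt t))"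
    by (intro smooth_on_mult smooth_on_inverse_sqrt open_greaterThan)
qed (auto simp: field_simps)

lemma smooth_on_exp: "smooth_on S (exp :: real \<Rightarrow> real)"
proof -
  have "Ck_on k (exp :: real \<Rightarrow> real) UNIV" for k
  proof (induction k)
    case 0
    show ?case by (auto intro!: continuous_intros)
  next
    case (Suc k)
    then show ?case by (intro Ck_on_Suc_real_derivI[of _ _ exp]) auto
  qed
  then show ?thesis by (auto simp: smooth_on_def intro: Ck_on_subset)
qed

subsection \<open>Bump functions\<close>

text \<open>The powers of \<open>t\<close> in the denominator make the family closed under differentiation up to linear
  combinations, so that smoothness of \<open>exp (-1/t)\<close> at \<open>0\<close> becomes an induction.\<close>

definition flat_exp :: "nat \<Rightarrow> real \<Rightarrow> real" where
  "flat_exp n t = (if t > 0 then exp (- (1 / t)) / t ^ n else 0)"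

lemma tendsto_flat_exp_0: "(flat_exp n \<longlongrightarrow> 0) (at 0)"
proof -
  have "((\<lambda>x::real. x ^ n / exp x) \<longlongrightarrow> 0) at_top"
    by (rule tendsto_power_div_exp_0)
  then have "((\<lambda>t. (inverse t) ^ n / exp (inverse t)) \<longlongrightarrow> 0) (at_right (0::real))"
    using filterlim_inverse_at_top_right filterlim_compose by blast
  then have "(flat_exp n \<longlongrightarrow> 0) (at_right 0)"
    by (rule Lim_transform_eventually)
      (auto simp: eventually_at_filter flat_exp_def exp_minus field_simps)
  moreover have "(flat_exp n \<longlongrightarrow> 0) (at_left 0)"
    by (rule Lim_transform_eventually[of "\<lambda>_. 0"])
      (auto simp: eventually_at_filter flat_exp_def)
  ultimately show ?thesis by (simp add: filterlim_at_split)
qed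

lemma has_real_derivative_flat_exp:
  "(flat_exp n has_real_derivative (flat_exp (n+2) x + (- real n) * flat_exp (n+1) x)) (at x)"
proof -
  consider "x > 0" | "x < 0" | "x = 0" by linarith
  then show ?thesis
  proof cases
    case 1
    have "((\<lambda>t. exp (- (1 / t)) / t ^ n) has_real_derivative
       (flat_exp (n+2) x + (- real n) * flat_exp (n+1) x)) (at x)"
    proof (cases n)
      case 0
      then show ?thesis using 1
        by (auto intro!: derivative_eq_intros simp: flat_exp_def power2_eq_square divide_simps)
    next
      case (Suc m)
      have m: "real m * x ^ (m - Suc 0) * x = real m * x ^ m"
        by (cases m) auto
      show ?thesis unfolding Suc using 1 m
        by (auto intro!: derivative_eq_intros simp: flat_exp_def power2_eq_square divide_simps)
          (auto simp: algebra_simps)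
    qed
    then show ?thesis
      by (rule has_field_derivative_transform_within_open[of _ _ _ "{0<..}"])
        (use 1 in \<open>auto simp: flat_exp_def\<close>)
  next
    case 2
    have "((\<lambda>t. 0::real) has_real_derivative
       (flat_exp (n+2) x + (- real n) * flat_exp (n+1) x)) (at x)"
      using 2 by (auto simp: flat_exp_def)
    then show ?thesis
      by (rule has_field_derivative_transform_within_open[of _ _ _ "{..<0}"])
        (use 2 in \<open>auto simp: flat_exp_def\<close>)
  next
    case 3
    have "((\<lambda>h. (flat_exp n (0 + h) - flat_exp n 0) / h) \<longlongrightarrow> 0) (at 0)"
      by (rule Lim_transform_eventually[OF tendsto_flat_exp_0[of "n+1"]])
        (auto simp: eventually_at_filter flat_exp_def)
    then show ?thesis
      unfolding 3 by (simp add: DERIV_def flat_exp_def)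
  qed
qed

lemma smooth_on_flat_exp: "smooth_on S (flat_exp n)"
proof -
  have "Ck_on k (flat_exp n) UNIV" for k n
  proof (induction k arbitrary: n)
    case 0
    show ?case
      using DERIV_isCont[OF has_real_derivative_flat_exp]
      by (simp add: continuous_at_imp_continuous_on)
  next
    case (Suc k)
    show ?case
      by (rule Ck_on_Suc_real_derivI[OF _ has_real_derivative_flat_exp])
        (intro Ck_on_add Ck_on_bilinear[OF bounded_bilinear_mult] Ck_on_const Suc open_UNIV)+
  qed
  then show ?thesis by (auto simp: smooth_on_def intro: Ck_on_subset)
qed

text \<open>The two summands of the denominator never vanish together, since one is positive
  inside radius \<open>2 r\<close> and the other outside radius \<open>r\<close>.\<close>

lemma smooth_cutoff_exists:
  fixes y0 :: "'a::euclidean_space"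
  assumes "r > 0"
  obtains f :: "'a \<Rightarrow> real" where "smooth_on UNIV f"
    "\<And>y. dist y y0 \<le> r \<Longrightarrow> f y = 1" "\<And>y. dist y y0 \<ge> 2 * r \<Longrightarrow> f y = 0"
proof
  let ?n = "\<lambda>y. (y - y0) \<bullet> (y - y0)"
  let ?a = "\<lambda>y. flat_exp 0 (4 * r\<^sup>2 - ?n y)" and ?b = "\<lambda>y. flat_exp 0 (?n y - r\<^sup>2)"
  let ?f = "\<lambda>y. ?a y * (1 / (?a y + ?b y))"
  have n: "?n y = (dist y y0)\<^sup>2" for y
    by (simp add: dist_norm power2_norm_eq_inner)
  have nonneg: "flat_exp 0 t \<ge> 0" and pos: "t > 0 \<Longrightarrow> flat_exp 0 t > 0" for t
    by (auto simp: flat_exp_def)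
  have "r\<^sup>2 > 0" using assms by simp
  have ab: "?a y + ?b y > 0" for y
  proof (cases "?n y - r\<^sup>2 > 0")
    case True
    then show ?thesis by (intro add_nonneg_pos nonneg pos)
  next
    case False
    then have "4 * r\<^sup>2 - ?n y > 0" using \<open>r\<^sup>2 > 0\<close> by linarith
    then show ?thesis by (intro add_pos_nonneg nonneg pos)
  qed
  have sn: "smooth_on UNIV ?n"
    by (intro smooth_on_bilinear[OF bounded_bilinear_inner] smooth_on_diff_const) simp_all
  have sa: "smooth_on UNIV ?a"
  proof (rule smooth_on_compose[where T=UNIV and f="flat_exp 0"])
    show "smooth_on UNIV (\<lambda>x. 4 * r\<^sup>2 - ?n x)"
      using smooth_on_add[of UNIV "\<lambda>_. 4 * r\<^sup>2" "\<lambda>x. (-1) * ?n x"]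
        smooth_on_mult[of UNIV "\<lambda>_. -1" ?n] sn by auto
  qed (auto intro: smooth_on_flat_exp)
  have sb: "smooth_on UNIV ?b"
  proof (rule smooth_on_compose[where T=UNIV and f="flat_exp 0"])
    show "smooth_on UNIV (\<lambda>x. ?n x - r\<^sup>2)"
      using smooth_on_add[of UNIV ?n "\<lambda>_. - r\<^sup>2"] sn by auto
  qed (auto intro: smooth_on_flat_exp)
  show "smooth_on UNIV ?f"
    by (intro smooth_on_mult sa smooth_on_compose[of UNIV "{0<..}" "\<lambda>y. ?a y + ?b y" "\<lambda>t. 1 / t"]
        smooth_on_inverse smooth_on_add sb) (auto simp: ab)
  show "?f y = 1" if "dist y y0 \<le> r" for y
  proof -
    have "?n y \<le> r\<^sup>2" using that unfolding n by (simp add: power_mono)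
    then have "?b y = 0" by (simp add: flat_exp_def)
    then show ?thesis using ab[of y] by simp
  qed
  show "?f y = 0" if "dist y y0 \<ge> 2 * r" for y
  proof -
    have "?n y \<ge> (2 * r)\<^sup>2" unfolding n using that assms by (intro power_mono) auto
    then have "?a y = 0" by (simp add: flat_exp_def power2_eq_square)
    then show ?thesis by simp
  qed
qed

subsection \<open>Symmetry of second derivatives\<close>

lemma has_real_derivative_along_line:
  fixes F :: "'a::real_normed_vector \<Rightarrow> real"
  assumes "F differentiable (at (y + t *\<^sub>R u))"
  shows "((\<lambda>t. F (y + t *\<^sub>R u)) has_real_derivative FD F (y + t *\<^sub>R u) u) (at t)"
proof -
  have "((\<lambda>t. F (y + t *\<^sub>R u)) has_derivative
      (\<lambda>s. FD F (y + t *\<^sub>R u) (s *\<^sub>R u))) (at t)"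
    by (rule has_derivative_compose[of "\<lambda>t. y + t *\<^sub>R u" "\<lambda>s. s *\<^sub>R u" t UNIV F])
      (use assms in \<open>auto intro!: derivative_eq_intros simp: frechet_derivative_works\<close>)
  moreover have "linear (FD F (y + t *\<^sub>R u))"
    using assms by (rule linear_frechet_derivative)
  ultimately show ?thesis
    by (simp add: has_field_derivative_def linear_scale mult.commute[of _ "frechet_derivative _ _ _"])
qed

text \<open>The mean value theorem is used twice, first for the increment in the direction
  \<open>v\<close> as a function along \<open>u\<close>, then along \<open>v\<close>.\<close>

lemma second_difference_mvt:
  fixes F :: "'a::euclidean_space \<Rightarrow> real"
  assumes "smooth_on S F" "h > 0" and sub: "\<And>s t. 0 \<le> s \<Longrightarrow> s \<le> h \<Longrightarrow> 0 \<le> t \<Longrightarrow> t \<le> h \<Longrightarrow> y + s *\<^sub>R u + t *\<^sub>R v \<in> S"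
  obtains s t where "0 < s" "s < h" "0 < t" "t < h"
    "F (y + h *\<^sub>R u + h *\<^sub>R v) - F (y + h *\<^sub>R u) - F (y + h *\<^sub>R v) + F y
     = h * h * FD (\<lambda>z. FD F z u) (y + s *\<^sub>R u + t *\<^sub>R v) v"
proof -
  let ?Fu = "\<lambda>z. FD F z u"
  let ?\<phi> = "\<lambda>s. F ((y + h *\<^sub>R v) + s *\<^sub>R u) - F (y + s *\<^sub>R u)"
  have "(?\<phi> has_real_derivative ?Fu ((y + h *\<^sub>R v) + s *\<^sub>R u) - ?Fu (y + s *\<^sub>R u)) (at s)"
    if "0 \<le> s" "s \<le> h" for s
    using sub[of s h] sub[of s 0] that assms(2)
    by (intro DERIV_diff has_real_derivative_along_line smooth_on_imp_differentiable[OF assms(1)])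
      (auto simp: algebra_simps)
  from MVT2[OF assms(2), of ?\<phi>, OF this] obtain s where s: "0 < s" "s < h"
    "?\<phi> h - ?\<phi> 0 = h * (?Fu ((y + h *\<^sub>R v) + s *\<^sub>R u) - ?Fu (y + s *\<^sub>R u))" by auto
  let ?\<psi> = "\<lambda>t. ?Fu ((y + s *\<^sub>R u) + t *\<^sub>R v)"
  have "(?\<psi> has_real_derivative FD ?Fu ((y + s *\<^sub>R u) + t *\<^sub>R v) v) (at t)"
    if "0 \<le> t" "t \<le> h" for t
    using sub[of s t] s that
    by (intro has_real_derivative_along_line smooth_on_imp_differentiable[of S]
        smooth_on_frechet_derivative assms(1)) auto
  from MVT2[OF assms(2), of ?\<psi>, OF this] obtain t where t: "0 < t" "t < h"
    "?\<psi> h - ?\<psi> 0 = h * FD ?Fu ((y + s *\<^sub>R u) + t *\<^sub>R v) v" by auto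
  show ?thesis
    by (rule that[OF s(1,2) t(1,2)]) (use s(3) t(3) in \<open>simp add: algebra_simps\<close>)
qed

text \<open>The second difference over a small parallelogram is symmetric in the two directions.
  It is a value of either mixed derivative near \<open>y\<close>, so the two agree at
  \<open>y\<close> by continuity.\<close>

lemma frechet_derivative_symmetric:
  fixes F :: "'a::euclidean_space \<Rightarrow> real"
  assumes "open S" "smooth_on S F" "y \<in> S"
  shows "FD (\<lambda>z. FD F z u) y v
       = FD (\<lambda>z. FD F z v) y u"
proof (rule ccontr)
  let ?D = "\<lambda>u v z. FD (\<lambda>z. FD F z u) z v"
  let ?e = "\<bar>?D u v y - ?D v u y\<bar> / 2"
  assume "\<not> ?thesis"
  then have e: "?e > 0" by simp
  have cont: "isCont (?D u v) y" for u v
    using smooth_on_imp_continuous_on[OF smooth_on_frechet_derivative[OF smooth_on_frechet_derivative[OF assms(2)]]]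
      assms(1,3) by (simp add: continuous_on_eq_continuous_at)
  obtain d1 where d1: "d1 > 0" "\<And>z. dist z y < d1 \<Longrightarrow> \<bar>?D u v z - ?D u v y\<bar> < ?e"
    using cont[of u v] e unfolding continuous_at_eps_delta dist_real_def by metis
  obtain d2 where d2: "d2 > 0" "\<And>z. dist z y < d2 \<Longrightarrow> \<bar>?D v u z - ?D v u y\<bar> < ?e"
    using cont[of v u] e unfolding continuous_at_eps_delta dist_real_def by metis
  obtain d3 where d3: "d3 > 0" "ball y d3 \<subseteq> S"
    using assms(1,3) open_contains_ball by blast
  define d where "d = min d1 (min d2 d3)"
  have "d > 0" using d1 d2 d3 by (simp add: d_def)
  define h where "h = d / (2 * (norm u + norm v + 1))"
  have nn: "norm u + norm v + 1 > 0" by (simp add: add_nonneg_pos)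
  then have h: "h > 0" using \<open>d > 0\<close> by (simp add: h_def)
  have hd: "dist (y + s *\<^sub>R a + t *\<^sub>R b) y < d"
    if "0 \<le> s" "s \<le> h" "0 \<le> t" "t \<le> h" "norm a + norm b = norm u + norm v" for s t a b
  proof -
    have "dist (y + s *\<^sub>R a + t *\<^sub>R b) y \<le> s * norm a + t * norm b"
      using norm_triangle_ineq[of "s *\<^sub>R a" "t *\<^sub>R b"] that by (simp add: dist_norm)
    also have "\<dots> \<le> h * norm a + h * norm b"
      using that by (intro add_mono mult_right_mono) auto
    also have "\<dots> = h * (norm u + norm v)"
      using that(5) by (simp add: distrib_left[symmetric])
    also have "\<dots> \<le> h * (norm u + norm v + 1)"
      using h by (intro mult_left_mono) auto
    also have "\<dots> = d / 2" using nn unfolding h_def by (metis nonzero_mult_divide_mult_cancel_right2 less_irrefl mult.commute times_divide_eq_left)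
    also have "\<dots> < d" using \<open>d > 0\<close> by simp
    finally show ?thesis .
  qed
  have sub: "y + s *\<^sub>R a + t *\<^sub>R b \<in> S"
    if "0 \<le> s" "s \<le> h" "0 \<le> t" "t \<le> h" "norm a + norm b = norm u + norm v" for s t a b
    using hd[OF that] d3 by (auto simp: d_def dist_commute)
  obtain s t where st: "0 < s" "s < h" "0 < t" "t < h"
    "F (y + h *\<^sub>R u + h *\<^sub>R v) - F (y + h *\<^sub>R u) - F (y + h *\<^sub>R v) + F y
     = h * h * ?D u v (y + s *\<^sub>R u + t *\<^sub>R v)"
    by (rule second_difference_mvt[OF assms(2) h, of y u v]) (use sub in auto)
  obtain s' t' where st': "0 < s'" "s' < h" "0 < t'" "t' < h"
    "F (y + h *\<^sub>R v + h *\<^sub>R u) - F (y + h *\<^sub>R v) - F (y + h *\<^sub>R u) + F y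
     = h * h * ?D v u (y + s' *\<^sub>R v + t' *\<^sub>R u)"
    by (rule second_difference_mvt[OF assms(2) h, of y v u]) (use sub in \<open>auto simp: add.commute\<close>)
  have "h * h * ?D u v (y + s *\<^sub>R u + t *\<^sub>R v) = h * h * ?D v u (y + s' *\<^sub>R v + t' *\<^sub>R u)"
    unfolding st(5)[symmetric] st'(5)[symmetric] by (simp add: algebra_simps)
  then have "?D u v (y + s *\<^sub>R u + t *\<^sub>R v) = ?D v u (y + s' *\<^sub>R v + t' *\<^sub>R u)"
    using h by simp
  moreover have "\<bar>?D u v (y + s *\<^sub>R u + t *\<^sub>R v) - ?D u v y\<bar> < ?e"
    using hd[of s t u v] st by (intro d1) (simp add: d_def)
  moreover have "\<bar>?D v u (y + s' *\<^sub>R v + t' *\<^sub>R u) - ?D v u y\<bar> < ?e"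
    using hd[of s' t' v u] st' by (intro d2) (simp add: d_def)
  moreover have "False" if "a = a'" "\<bar>a - x\<bar> < \<bar>x - x'\<bar> / 2" "\<bar>a' - x'\<bar> < \<bar>x - x'\<bar> / 2" for a a' x x' :: real
  proof -
    have "\<bar>x - x'\<bar> \<le> \<bar>a - x\<bar> + \<bar>a - x'\<bar>" by linarith
    moreover have "\<bar>a - x'\<bar> < \<bar>x - x'\<bar> / 2" using that by simp
    ultimately show False using that(2) by argo
  qed
  ultimately show False by blast
qed

section \<open>Orthonormal bases of bilinear forms\<close>

lemma bilinear_sum_scaleR_left:
  "bilinear B \<Longrightarrow> B (\<Sum>i\<in>I. a i *\<^sub>R x i) y = (\<Sum>i\<in>I. a i * B (x i) y)" for B :: "_ \<Rightarrow> _ \<Rightarrow> real"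
  using linear_sum[of "\<lambda>x. B x y" "\<lambda>i. a i *\<^sub>R x i" I] linear_scale[of "\<lambda>x. B x y"]
  unfolding bilinear_def by auto

lemma bilinear_sum_scaleR_right:
  "bilinear B \<Longrightarrow> B y (\<Sum>i\<in>I. a i *\<^sub>R x i) = (\<Sum>i\<in>I. a i * B y (x i))" for B :: "_ \<Rightarrow> _ \<Rightarrow> real"
  using linear_sum[of "B y" "\<lambda>i. a i *\<^sub>R x i" I] linear_scale[of "B y"]
  unfolding bilinear_def by auto

lemma basis_expansion_axis: "w = (\<Sum>k\<in>UNIV. w $ k *\<^sub>R axis k 1)" for w :: "real^'n::finite"
  using basis_expansion[of w] by (simp add: scalar_mult_eq_scaleR)

text \<open>Orthonormality says that one product of two square matrices is the identity; the
  product in the other order is then the identity too, and this is the expansion.\<close>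

lemma bilinear_orthonormal_expansion:
  fixes B :: "real^'n::finite \<Rightarrow> real^'n \<Rightarrow> real" and e :: "'n \<Rightarrow> real^'n"
  assumes B: "bilinear B" and on: "\<And>i j. B (e i) (e j) = (if i = j then 1 else 0)"
  shows "v = (\<Sum>i\<in>UNIV. B v (e i) *\<^sub>R e i)"
proof -
  define E :: "real^'n^'n" where "E = (\<chi> i k. e i $ k)"
  define C :: "real^'n^'n" where "C = (\<chi> k j. B (axis k 1) (e j))"

  have "(\<Sum>k\<in>UNIV. e i $ k * B (axis k 1) (e j)) = (if i = j then 1 else 0)" for i j
    using bilinear_sum_scaleR_left[OF B, of "\<lambda>k. e i $ k" "\<lambda>k. axis k 1" UNIV "e j"] on[of i j]
    by (simp only: basis_expansion_axis[symmetric])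
  then have "E ** C = mat 1"
    by (simp add: vec_eq_iff matrix_matrix_mult_def E_def C_def mat_def)
  then have "C ** E = mat 1" by (simp add: matrix_left_right_inverse)
  then have CE: "(\<Sum>j\<in>UNIV. B (axis k 1) (e j) * e j $ l) = (if k = l then 1 else 0)" for k l
    by (simp add: vec_eq_iff matrix_matrix_mult_def E_def C_def mat_def)
  have ax: "axis k 1 = (\<Sum>j\<in>UNIV. B (axis k 1) (e j) *\<^sub>R e j)" for k
    using CE[of k] by (auto simp add: vec_eq_iff axis_def)
  have "v = (\<Sum>k\<in>UNIV. v $ k *\<^sub>R (\<Sum>j\<in>UNIV. B (axis k 1) (e j) *\<^sub>R e j))"
    by (simp only: ax[symmetric] basis_expansion_axis[symmetric])
  also have "\<dots> = (\<Sum>k\<in>UNIV. \<Sum>j\<in>UNIV. (v $ k * B (axis k 1) (e j)) *\<^sub>R e j)"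
    by (simp add: scaleR_sum_right)
  also have "\<dots> = (\<Sum>j\<in>UNIV. (\<Sum>k\<in>UNIV. v $ k * B (axis k 1) (e j)) *\<^sub>R e j)"
    by (subst sum.swap) (simp add: scaleR_sum_left)
  also have "\<dots> = (\<Sum>j\<in>UNIV. B v (e j) *\<^sub>R e j)"
    using bilinear_sum_scaleR_left[OF B, of "\<lambda>k. v $ k" "\<lambda>k. axis k 1" UNIV]
    by (simp only: basis_expansion_axis[symmetric])
  finally show ?thesis .
qed

lemma orthonormal_columns:
  fixes b :: "'n::finite \<Rightarrow> real^'n"
  assumes "\<And>i j. b i \<bullet> b j = (if i = j then 1 else 0)"
  shows "(\<Sum>i\<in>UNIV. b i $ k * b i $ l) = (if k = l then 1 else 0)"
proof -
  have "axis k 1 = (\<Sum>i\<in>UNIV. (axis k 1 \<bullet> b i) *\<^sub>R b i)"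
    by (rule bilinear_orthonormal_expansion)
      (use assms in \<open>auto simp: bilinear_conv_bounded_bilinear bounded_bilinear_inner\<close>)
  from arg_cong[OF this, of "\<lambda>v. v $ l"]
  have "axis k 1 $ l = (\<Sum>i\<in>UNIV. b i $ k * b i $ l)"
    by (simp add: cart_eq_inner_axis[symmetric] inner_commute[of "axis k 1"])
  then show ?thesis by (auto simp: axis_def)
qed

text \<open>First variation: the form of the condition at a maximum of a quadratic form on the
  sphere.\<close>

lemma linear_term_zero_of_quadratic_bound:
  fixes \<beta> C :: real
  assumes "\<And>t. 2 * t * \<beta> \<le> t\<^sup>2 * C"
  shows "\<beta> = 0"
proof (rule ccontr)
  assume b: "\<beta> \<noteq> 0"
  define t where "t = \<beta> / (\<bar>C\<bar> + 1)"
  have \<beta>: "\<beta> = t * (\<bar>C\<bar> + 1)" by (simp add: t_def add_nonneg_eq_0_iff)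
  have "t \<noteq> 0" using b \<beta> by auto
  then have t2: "t\<^sup>2 > 0" by simp
  have "t\<^sup>2 * (2 * (\<bar>C\<bar> + 1)) \<le> t\<^sup>2 * C"
    using assms[of t] by (subst (asm) \<beta>) (simp add: power2_eq_square algebra_simps)
  then have "2 * (\<bar>C\<bar> + 1) \<le> C"
    using t2 by simp
  then show False by argo
qed

text \<open>Spectral theorem for symmetric bilinear forms: eigenvectors are found one at a time, each
  maximising the quadratic form on the unit sphere of the complement of the previous ones.\<close>

lemma symmetric_bilinear_eigenbasis:
  fixes B :: "real^'n::finite \<Rightarrow> real^'n \<Rightarrow> real"
  assumes B: "bilinear B" and sym: "\<And>u v. B u v = B v u"
  obtains b :: "'n \<Rightarrow> real^'n" where
    "\<And>i j. b i \<bullet> b j = (if i = j then 1 else 0)" "\<And>i j. i \<noteq> j \<Longrightarrow> B (b i) (b j) = 0"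
proof -
  have "\<exists>b :: 'n \<Rightarrow> real^'n. (\<forall>i\<in>I. \<forall>j\<in>I. b i \<bullet> b j = (if i = j then 1 else 0)) \<and>
      (\<forall>i\<in>I. \<forall>w. w \<bullet> b i = 0 \<longrightarrow> B (b i) w = 0)" for I :: "'n set"
    using finite[of I]
  proof (induction I rule: finite_induct)
    case empty
    then show ?case by simp
  next
    case (insert a I)
    then obtain b :: "'n \<Rightarrow> real^'n" where on: "\<And>i j. i \<in> I \<Longrightarrow> j \<in> I \<Longrightarrow> b i \<bullet> b j = (if i = j then 1 else 0)"
      and ev: "\<And>i w. i \<in> I \<Longrightarrow> w \<bullet> b i = 0 \<Longrightarrow> B (b i) w = 0" by blast
    define K where "K = sphere 0 1 \<inter> {v. \<forall>i\<in>I. v \<bullet> b i = 0}"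
    have "closed {v. \<forall>i\<in>I. v \<bullet> b i = 0}"
    proof -
      have "{v. \<forall>i\<in>I. v \<bullet> b i = 0} = (\<Inter>i\<in>I. {v. v \<bullet> b i = 0})" by auto
      then show ?thesis by (auto intro!: closed_INT closed_Collect_eq continuous_intros)
    qed
    then have "compact K" unfolding K_def by (intro compact_Int_closed) auto
    have "dim (b ` I) \<le> card (b ` I)" using insert by (intro dim_le_card') auto
    also have "\<dots> \<le> card I" using insert by (intro card_image_le)
    also have "\<dots> < CARD('n)"
      using insert by (intro psubset_card_mono) auto
    finally have "dim (b ` I) < DIM(real^'n)" by simp
    then obtain x where x: "x \<noteq> 0" "\<And>y. y \<in> span (b ` I) \<Longrightarrow> orthogonal x y"
      using orthogonal_to_subspace_exists[of "b ` I"] by metis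
    then have "(1 / norm x) *\<^sub>R x \<in> K"
      by (auto simp: K_def orthogonal_def span_base)
    then have "K \<noteq> {}" by auto
    moreover have "continuous_on K (\<lambda>v. B v v)"
      using B by (intro bounded_bilinear.continuous_on[of B]) (auto simp: bilinear_conv_bounded_bilinear)
    ultimately obtain v where v: "v \<in> K" "\<And>w. w \<in> K \<Longrightarrow> B w w \<le> B v v"
      using continuous_attains_sup[OF \<open>compact K\<close>] by blast
    have vv: "v \<bullet> v = 1" using v(1) by (simp add: K_def norm_eq_1)
    have vb: "v \<bullet> b i = 0" if "i \<in> I" for i using v(1) that by (simp add: K_def)
    have lin: "B (x + y) z = B x z + B y z" "B z (x + y) = B z x + B z y"
      "B (t *\<^sub>R x) z = t * B x z" "B z (t *\<^sub>R x) = t * B z x" for x y z t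
      using B by (simp_all add: bilinear_ladd bilinear_radd bilinear_lmul bilinear_rmul)
    have key: "B v w = 0" if w: "w \<bullet> v = 0" "\<And>i. i \<in> I \<Longrightarrow> w \<bullet> b i = 0" for w
    proof (rule linear_term_zero_of_quadratic_bound)
      fix t
      let ?u = "v + t *\<^sub>R w"
      have uu: "?u \<bullet> ?u = 1 + t\<^sup>2 * (w \<bullet> w)"
        using w(1) by (simp add: inner_add_left inner_add_right vv inner_commute[of v w] power2_eq_square)
      then have "?u \<bullet> ?u \<noteq> 0" by (smt (verit) inner_ge_zero mult_nonneg_nonneg zero_le_power2)
      then have nu: "norm ?u > 0" by auto
      have "(1 / norm ?u) *\<^sub>R ?u \<in> K"
        using nu w(2) vb by (auto simp: K_def inner_add_left)
      from v(2)[OF this] have "B ?u ?u / (norm ?u)\<^sup>2 \<le> B v v"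
        unfolding lin(3,4) by (simp add: power2_eq_square)
      then have "B ?u ?u \<le> B v v * (norm ?u)\<^sup>2"
        using nu by (simp add: divide_le_eq)
      then have "B ?u ?u \<le> B v v * (1 + t\<^sup>2 * (w \<bullet> w))"
        by (simp add: power2_norm_eq_inner uu)
      then show "2 * t * B v w \<le> t\<^sup>2 * (B v v * (w \<bullet> w) - B w w)"
        using sym[of w v] by (simp only: lin) (simp add: algebra_simps power2_eq_square)
    qed
    have ev': "B v w = 0" if w: "w \<bullet> v = 0" for w
    proof -
      let ?w = "w - (\<Sum>i\<in>I. (w \<bullet> b i) *\<^sub>R b i)"
      have bv: "b i \<bullet> v = 0" if "i \<in> I" for i using vb[OF that] by (simp add: inner_commute)
      have "B v ?w = 0"
      proof (rule key)
        show "?w \<bullet> v = 0" by (simp add: inner_diff_left w inner_sum_left bv)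
        show "?w \<bullet> b j = 0" if "j \<in> I" for j
          using that insert by (simp add: inner_diff_left inner_sum_left on if_distrib[of "\<lambda>x. _ * x"] cong: if_cong)
      qed
      moreover have "B v (\<Sum>i\<in>I. (w \<bullet> b i) *\<^sub>R b i) = 0"
        using ev[OF _ vb] sym[of v] by (simp add: bilinear_sum_scaleR_right[OF B])
      ultimately show ?thesis
        using B by (simp add: bilinear_rsub)
    qed
    show ?case
      by (rule exI[of _ "b(a := v)"])
        (use insert(2) vv vb on ev ev' in \<open>auto simp: inner_commute\<close>)
  qed
  from this[of UNIV] obtain b :: "'n \<Rightarrow> real^'n" where b: "\<And>i j. b i \<bullet> b j = (if i = j then 1 else 0)"
    "\<And>i w. w \<bullet> b i = 0 \<Longrightarrow> B (b i) w = 0" by auto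
  show ?thesis
    by (rule that[OF b(1)]) (use b in auto)
qed

section \<open>The strong maximum principle\<close>

text \<open>The product rule for the pairing of the derivative of \<open>w\<close> with the field
  \<open>X\<close>.\<close>

lemma frechet_derivative_field_twice:
  fixes w :: "'a::euclidean_space \<Rightarrow> real"
  assumes "open S" "smooth_on S w" "smooth_on S X" "y \<in> S"
  shows "FD (\<lambda>z. FD w z (X z)) y v =
    FD (\<lambda>z. FD w z (X y)) y v
    + FD w y (FD X y v)"
proof -
  have ex: "FD w z a = (\<Sum>b\<in>Basis. (a \<bullet> b) * FD w z b)"
    if "z \<in> S" for z a
    using frechet_derivative_expand_Basis[OF smooth_on_imp_differentiable[OF assms(2) that], of a] by simp
  have dw: "((\<lambda>z. FD w z b) has_derivative
      FD (\<lambda>z. FD w z b) y) (at y)" for b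
    by (rule smooth_on_imp_has_derivative[OF smooth_on_frechet_derivative[OF assms(2)] assms(4)])
  have dX: "(X has_derivative FD X y) (at y)"
    by (rule smooth_on_imp_has_derivative[OF assms(3,4)])
  have "((\<lambda>z. \<Sum>b\<in>Basis. (X z \<bullet> b) * FD w z b) has_derivative
     (\<lambda>v. \<Sum>b\<in>Basis. (X y \<bullet> b) * FD (\<lambda>z. FD w z b) y v
        + (FD X y v \<bullet> b) * FD w y b)) (at y)"
    by (intro has_derivative_sum has_derivative_mult has_derivative_inner_left dX dw)
  then have "((\<lambda>z. FD w z (X z)) has_derivative
     (\<lambda>v. \<Sum>b\<in>Basis. (X y \<bullet> b) * FD (\<lambda>z. FD w z b) y v
        + (FD X y v \<bullet> b) * FD w y b)) (at y)"
    by (rule has_derivative_transform_within_open[OF _ assms(1,4)]) (use ex in auto)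
  note 1 = frechet_derivative_at[OF this, symmetric]
  have "((\<lambda>z. \<Sum>b\<in>Basis. (X y \<bullet> b) * FD w z b) has_derivative
     (\<lambda>v. \<Sum>b\<in>Basis. (X y \<bullet> b) * FD (\<lambda>z. FD w z b) y v)) (at y)"
    by (intro has_derivative_sum has_derivative_mult_right dw)
  then have "((\<lambda>z. FD w z (X y)) has_derivative
     (\<lambda>v. \<Sum>b\<in>Basis. (X y \<bullet> b) * FD (\<lambda>z. FD w z b) y v)) (at y)"
    by (rule has_derivative_transform_within_open[OF _ assms(1,4)]) (use ex in auto)
  note 2 = frechet_derivative_at[OF this, symmetric]
  show ?thesis unfolding 1 2
    using ex[OF assms(4), of "FD X y v"] by (simp add: sum.distrib)
qed

text \<open>At a maximum the first derivative vanishes, so the derivative of the field does not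
  contribute and the second derivative along a straight line decides.\<close>

lemma second_derivative_le_0_at_max:
  fixes w :: "'a::euclidean_space \<Rightarrow> real"
  assumes "open S" "smooth_on S w" "smooth_on S X" "y \<in> S" and max: "\<And>z. z \<in> S \<Longrightarrow> w z \<le> w y"
  shows "FD w y = (\<lambda>v. 0)"
    and "FD (\<lambda>z. FD w z (X z)) y (X y) \<le> 0"
proof -
  show D0: "FD w y = (\<lambda>v. 0)"
    by (rule differential_zero_maxmin[OF assms(4,1) smooth_on_imp_has_derivative[OF assms(2,4)]])
      (use max in auto)
  let ?v = "X y"
  let ?D = "\<lambda>z. FD w z ?v"
  have "FD ?D y ?v \<le> 0"
  proof (rule ccontr)
    assume "\<not> ?thesis"
    then have pos: "FD ?D y ?v > 0" by simp
    have "open ((\<lambda>t. y + t *\<^sub>R ?v) -` S)"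
      by (rule open_vimage[OF assms(1)]) (auto intro!: continuous_intros)
    then obtain r where r: "r > 0" "\<And>t. \<bar>t\<bar> < r \<Longrightarrow> y + t *\<^sub>R ?v \<in> S"
    proof -
      have "(0::real) \<in> (\<lambda>t. y + t *\<^sub>R ?v) -` S" using assms(4) by simp
      then obtain r where "r > 0" "ball 0 r \<subseteq> (\<lambda>t. y + t *\<^sub>R ?v) -` S"
        using \<open>open ((\<lambda>t. y + t *\<^sub>R ?v) -` S)\<close> openE by blast
      then show ?thesis by (intro that[of r]) (auto simp: subset_eq dist_real_def)
    qed
    have "((\<lambda>t. ?D (y + t *\<^sub>R ?v)) has_real_derivative FD ?D (y + 0 *\<^sub>R ?v) ?v) (at 0)"
      by (rule has_real_derivative_along_line)
        (use assms(4) smooth_on_imp_differentiable[OF smooth_on_frechet_derivative[OF assms(2)]] in auto)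
    from DERIV_pos_inc_right[OF this] pos
    obtain d where d: "d > 0" "\<And>h. h > 0 \<Longrightarrow> h < d \<Longrightarrow> ?D y < ?D (y + h *\<^sub>R ?v)" by auto
    define h where "h = min d r / 2"
    have h: "0 < h" "h < d" "h < r" using d r by (auto simp: h_def)
    have "((\<lambda>t. w (y + t *\<^sub>R ?v)) has_real_derivative ?D (y + t *\<^sub>R ?v)) (at t)" if "0 \<le> t" "t \<le> h" for t
      using that h r by (intro has_real_derivative_along_line smooth_on_imp_differentiable[OF assms(2)]) auto
    from MVT2[OF h(1) this] obtain t where t: "0 < t" "t < h"
      "w (y + h *\<^sub>R ?v) - w (y + 0 *\<^sub>R ?v) = (h - 0) * ?D (y + t *\<^sub>R ?v)" by blast
    have "?D (y + t *\<^sub>R ?v) > 0" using d(2)[of t] t h D0 by auto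
    then have "h * ?D (y + t *\<^sub>R ?v) > 0" using h(1) by (intro mult_pos_pos)
    then have "w (y + h *\<^sub>R ?v) > w y" using t(3) by (simp only: scaleR_zero_left add_0_right diff_zero)
    moreover have "y + h *\<^sub>R ?v \<in> S" using h r by auto
    ultimately show False using max by fastforce
  qed
  then show "FD (\<lambda>z. FD w z (X z)) y (X y) \<le> 0"
    by (simp add: frechet_derivative_field_twice[OF assms(1-4)] D0)
qed

text \<open>A second-order operator in the form in which Laplacians arise from frames: the sum of
  the squares of the fields \<open>X k\<close>, as first-order operators, minus the field
  \<open>Y\<close>. In this form it is elliptic exactly when the fields \<open>X k\<close>
  span.\<close>

definition sum_squares_op ::
  "('k::finite \<Rightarrow> 'a::euclidean_space \<Rightarrow> 'a) \<Rightarrow> ('a \<Rightarrow> 'a) \<Rightarrow> ('a \<Rightarrow> real) \<Rightarrow> 'a \<Rightarrow> real" where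
  "sum_squares_op X Y u y =
     (\<Sum>k\<in>UNIV. FD (\<lambda>z. FD u z (X k z)) y (X k y))
     - FD u y (Y y)"

lemma sum_squares_op_add_scaled:
  assumes "open S" "smooth_on S u" "smooth_on S v" "\<And>k. smooth_on S (X k)" "y \<in> S"
  shows "sum_squares_op X Y (\<lambda>x. u x + a * v x) y = sum_squares_op X Y u y + a * sum_squares_op X Y v y"
proof -
  have D: "FD (\<lambda>x. p x + a * q x) z b
      = FD p z b + a * FD q z b"
    if "smooth_on S p" "smooth_on S q" "z \<in> S" for p q z b
    using frechet_derivative_at[OF has_derivative_add[OF smooth_on_imp_has_derivative[OF that(1,3)]
        has_derivative_mult_right[OF smooth_on_imp_has_derivative[OF that(2,3)]]]] by metis
  have "FD (\<lambda>z. FD (\<lambda>x. u x + a * v x) z (X k z)) y =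
    FD (\<lambda>z. FD u z (X k z) + a * FD v z (X k z)) y" for k
    by (rule frechet_derivative_cong_open[OF assms(1,5)]) (use D assms in auto)
  then show ?thesis
    using assms
    by (simp add: sum_squares_op_def D smooth_on_frechet_derivative_field sum.distrib sum_distrib_left algebra_simps)
qed

lemma sum_squares_op_le_0_at_max:
  assumes "open S" "smooth_on S w" "\<And>k. smooth_on S (X k)" "y \<in> S" "\<And>z. z \<in> S \<Longrightarrow> w z \<le> w y"
  shows "sum_squares_op X Y w y \<le> 0"
  using second_derivative_le_0_at_max[OF assms(1,2,3,4,5)]
  by (auto simp: sum_squares_op_def intro!: sum_nonpos)

text \<open>The term quadratic in \<open>\<alpha>\<close> dominates for large
  \<open>\<alpha>\<close> wherever the fields \<open>X k\<close> span and \<open>y \<noteq>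
  z\<close>; this makes the Gaussian a barrier.\<close>

lemma sum_squares_op_gaussian:
  fixes X :: "'k::finite \<Rightarrow> 'a::euclidean_space \<Rightarrow> 'a"
  assumes "open S" "\<And>k. smooth_on S (X k)" "y \<in> S"
  shows "sum_squares_op X Y (\<lambda>x. exp (- \<alpha> * ((x - z) \<bullet> (x - z)))) y =
    exp (- \<alpha> * ((y - z) \<bullet> (y - z))) * (4 * \<alpha>\<^sup>2 * (\<Sum>k\<in>UNIV. ((y - z) \<bullet> X k y)\<^sup>2)
      - 2 * \<alpha> * ((\<Sum>k\<in>UNIV. X k y \<bullet> X k y + (y - z) \<bullet> FD (X k) y (X k y)) - (y - z) \<bullet> Y y))"
proof -
  let ?v = "\<lambda>x. exp (- \<alpha> * ((x - z) \<bullet> (x - z)))"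
  have d1: "(?v has_derivative (\<lambda>a. - 2 * \<alpha> * ((x - z) \<bullet> a) * ?v x)) (at x)" for x
    by (auto intro!: derivative_eq_intros simp: fun_eq_iff inner_commute algebra_simps)
  have D1: "FD ?v x a = - 2 * \<alpha> * ((x - z) \<bullet> a) * ?v x" for x a
    using frechet_derivative_at[OF d1] by metis
  have D2: "FD (\<lambda>x. - 2 * \<alpha> * ((x - z) \<bullet> X k x) * ?v x) y (X k y)
    = ?v y * (4 * \<alpha>\<^sup>2 * ((y - z) \<bullet> X k y)\<^sup>2
       - 2 * \<alpha> * (X k y \<bullet> X k y + (y - z) \<bullet> FD (X k) y (X k y)))" for k
  proof -
    have dX: "(X k has_derivative FD (X k) y) (at y)"
      by (rule smooth_on_imp_has_derivative[OF assms(2,3)])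
    have "((\<lambda>x. - 2 * \<alpha> * ((x - z) \<bullet> X k x)) has_derivative
      (\<lambda>a. - 2 * \<alpha> * ((y - z) \<bullet> FD (X k) y a + a \<bullet> X k y))) (at y)"
      by (intro has_derivative_mult_right has_derivative_inner dX) (auto intro!: derivative_eq_intros)
    note frechet_derivative_at[OF has_derivative_mult[OF this d1], symmetric]
    then show ?thesis
      by (simp add: power2_eq_square algebra_simps inner_commute)
  qed
  have sums: "(\<Sum>k\<in>UNIV. V * (a * p k - b * q k)) - (- b * r * V)
      = V * (a * (\<Sum>k\<in>UNIV. p k) - b * ((\<Sum>k\<in>UNIV. q k) - r))"
    for V a b r :: real and p q :: "'k \<Rightarrow> real"
    by (simp add: sum_distrib_left sum_subtractf right_diff_distrib)
  show ?thesis
    unfolding sum_squares_op_def D1 D2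
    using sums[of "?v y" "4 * \<alpha>\<^sup>2" _ "2 * \<alpha>"] by simp
qed

text \<open>Hopf's barrier argument: if \<open>u\<close> were not constant near \<open>y0\<close>, a ball on which \<open>u < m\<close>
  would touch the set \<open>u = m\<close>; near the point of contact a small multiple of a steep Gaussian
  centred in the ball is added to \<open>u\<close>, which produces an interior maximum at which the operator is
  strictly positive.\<close>

lemma strong_maximum_principle_local:
  fixes X :: "'k::finite \<Rightarrow> 'a::euclidean_space \<Rightarrow> 'a"
  assumes S: "open S" and su: "smooth_on S u" and sX: "\<And>k. smooth_on S (X k)" and sY: "smooth_on S Y"
    and elliptic: "\<And>y w. y \<in> S \<Longrightarrow> w \<noteq> 0 \<Longrightarrow> \<exists>k. X k y \<bullet> w \<noteq> 0"
    and sub: "\<And>y. y \<in> S \<Longrightarrow> sum_squares_op X Y u y \<ge> 0"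
    and le: "\<And>y. y \<in> S \<Longrightarrow> u y \<le> m" and y0: "y0 \<in> S" "u y0 = m"
  obtains r where "r > 0" "ball y0 r \<subseteq> S" "\<And>y. y \<in> ball y0 r \<Longrightarrow> u y = m"
proof -
  obtain r0 where r0: "r0 > 0" "ball y0 (3 * r0) \<subseteq> S"
  proof -
    obtain e where "e > 0" "ball y0 e \<subseteq> S" using S y0 openE by blast
    then show ?thesis by (intro that[of "e / 3"]) auto
  qed
  have "u x1 = m" if x1: "x1 \<in> ball y0 r0" for x1
  proof (rule ccontr)
    assume ne: "u x1 \<noteq> m"
    \<comment> \<open>The ball around \<open>x1\<close> reaching to the set \<open>u = m\<close>.\<close>
    have cont: "continuous_on S u" by (rule smooth_on_imp_continuous_on[OF su])
    define C where "C = cball y0 (2 * r0) \<inter> {x \<in> S. u x = m}"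
    have CS: "cball y0 (2 * r0) \<subseteq> S" using r0 by (auto simp: subset_eq)
    have "C = {x \<in> cball y0 (2 * r0). u x = m}" using CS by (auto simp: C_def)
    then have "closed C"
      using continuous_closed_preimage_constant[OF continuous_on_subset[OF cont CS]] by simp
    moreover have "y0 \<in> C" using y0 r0 by (simp add: C_def)
    ultimately obtain y where y: "y \<in> C" "\<And>z. z \<in> C \<Longrightarrow> dist x1 y \<le> dist x1 z"
      using distance_attains_inf[of C x1] by blast
    define d where "d = dist x1 y"
    have dlt: "d < r0" using y(2)[OF \<open>y0 \<in> C\<close>] x1 by (simp add: d_def dist_commute)
    have yS: "y \<in> S" "u y = m" using y(1) by (auto simp: C_def)
    then have "d > 0" using ne by (auto simp: d_def)
    have lt: "u x < m" if "dist x1 x < d" for x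
    proof -
      have "dist y0 x < 2 * r0" using that x1 dlt dist_triangle[of y0 x x1] by auto
      then have "x \<in> S" using CS by auto
      moreover have "x \<notin> C" using y(2)[of x] that by (auto simp: d_def)
      ultimately show ?thesis using le[of x] \<open>dist y0 x < 2 * r0\<close> by (auto simp: C_def)
    qed
    \<comment> \<open>A smaller ball touching the set \<open>u = m\<close> only at \<open>y\<close>.\<close>
    define z where "z = midpoint x1 y"
    define R where "R = d / 2"
    have R: "R > 0" using \<open>d > 0\<close> by (simp add: R_def)
    have zy: "dist z y = R" and zx: "dist x1 z = R"
      by (simp_all add: z_def R_def d_def dist_midpoint)
    have lt': "u x < m" if "dist z x \<le> R" "x \<noteq> y" for x
    proof -
      have "dist x1 x < d"
      proof (rule ccontr)
        assume "\<not> dist x1 x < d"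
        then have "dist x1 x = dist x1 z + dist z x" "dist z x = R"
          using that dist_triangle[of x1 x z] zx by (auto simp: R_def)
        then have "norm (x1 - z) = R" "norm (z - x) = R" "norm ((x1 - z) + (z - x)) = norm (x1 - z) + norm (z - x)"
          using zx by (auto simp: dist_norm)
        then have "x1 - z = z - x" 
          using norm_triangle_eq[of "x1 - z" "z - x"] R by simp
        moreover have "z + z = x1 + y" by (simp add: z_def midpoint_def flip: scaleR_2)
        moreover have "x = (z + z) - x1" using \<open>x1 - z = z - x\<close> by (simp add: algebra_simps)
        ultimately have "x = y" by simp
        then show False using that by simp
      qed
      then show ?thesis by (rule lt)
    qed
    define K where "K = cball y (R / 2)"
    have K: "compact K" "y \<in> K" using R by (auto simp: K_def)
    have KS: "K \<subseteq> S"
    proof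
      fix x assume "x \<in> K"
      then have "dist y x \<le> R / 2" by (simp add: K_def)
      moreover have "dist y0 y \<le> dist y0 x1 + d" using dist_triangle[of y0 y x1] by (simp add: d_def)
      ultimately have "dist y0 x < 3 * r0"
        using dist_triangle[of y0 x y] x1 dlt r0(1) by (auto simp: R_def)
      then show "x \<in> S" using r0 by auto
    qed
    have zK: "x \<noteq> z" if "x \<in> K" for x using that zy R by (auto simp: K_def dist_commute)
    define P where "P = (\<lambda>x. \<Sum>k\<in>UNIV. ((x - z) \<bullet> X k x)\<^sup>2)"
    define Q where "Q = (\<lambda>x. (\<Sum>k\<in>UNIV. X k x \<bullet> X k x + (x - z) \<bullet> FD (X k) x (X k x)) - (x - z) \<bullet> Y x)"
    have cX: "continuous_on K (X k)" and cY: "continuous_on K Y"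
      and cD: "continuous_on K (\<lambda>x. FD (X k) x (X k x))" for k
      using continuous_on_subset[OF _ KS] smooth_on_imp_continuous_on
        smooth_on_frechet_derivative_field[OF S sX sX] sX sY by blast+
    have "continuous_on K P" "continuous_on K Q"
      unfolding P_def Q_def by (intro continuous_intros cX cY cD)+
    then obtain a b where a: "a \<in> K" "\<And>x. x \<in> K \<Longrightarrow> P a \<le> P x"
      and b: "b \<in> K" "\<And>x. x \<in> K \<Longrightarrow> Q x \<le> Q b"
      using continuous_attains_inf[OF K(1), of P] continuous_attains_sup[OF K(1), of Q] K(2) by blast
    have "P a > 0"
    proof -
      obtain k where "X k a \<bullet> (a - z) \<noteq> 0" using elliptic[of a "a - z"] a(1) KS zK by auto
      then have "((a - z) \<bullet> X k a)\<^sup>2 > 0" by (simp add: inner_commute)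
      then show ?thesis unfolding P_def by (intro sum_pos2[of _ k]) auto
    qed
    define \<alpha> where "\<alpha> = (\<bar>Q b\<bar> + 1) / P a"
    have \<alpha>: "\<alpha> > 0" "\<alpha> * P a = \<bar>Q b\<bar> + 1" using \<open>P a > 0\<close> by (auto simp: \<alpha>_def)
    let ?v = "\<lambda>x. exp (- \<alpha> * ((x - z) \<bullet> (x - z)))"
    have Lv: "sum_squares_op X Y ?v x > 0" if "x \<in> K" for x
    proof -
      have "sum_squares_op X Y ?v x = ?v x * (4 * \<alpha>\<^sup>2 * P x - 2 * \<alpha> * Q x)"
        unfolding P_def Q_def by (rule sum_squares_op_gaussian[OF S sX]) (use that KS in auto)
      also have "\<dots> = ?v x * (2 * \<alpha>) * (2 * (\<alpha> * P x) - Q x)"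
        by (simp add: power2_eq_square algebra_simps)
      also have "\<dots> > 0"
      proof -
        have "\<alpha> * P a \<le> \<alpha> * P x" using a(2)[OF that] \<alpha>(1) by simp
        then have "2 * (\<alpha> * P x) - Q x > 0" using b(2)[OF that] \<alpha>(2) by linarith
        then show ?thesis using \<alpha>(1) by simp
      qed
      finally show ?thesis .
    qed
    have sv: "smooth_on S ?v"
    proof (rule smooth_on_compose[OF S open_UNIV _ smooth_on_exp])
      show "smooth_on S (\<lambda>x. - \<alpha> * ((x - z) \<bullet> (x - z)))"
        by (intro smooth_on_mult smooth_on_bilinear[OF bounded_bilinear_inner] S smooth_on_diff_const smooth_on_const)
    qed auto
    \<comment> \<open>On the boundary of \<open>K\<close> the perturbed function stays below its value at \<open>y\<close>.\<close>
    define T where "T = sphere y (R / 2) \<inter> cball z R"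
    have "compact T" unfolding T_def by (intro compact_Int compact_sphere compact_cball)
    obtain \<eta> where \<eta>: "\<eta> > 0" "\<And>x. x \<in> T \<Longrightarrow> u x \<le> m - \<eta>"
    proof (cases "T = {}")
      case False
      have "continuous_on T u"
        by (rule continuous_on_subset[OF cont]) (use KS in \<open>auto simp: T_def K_def\<close>)
      then obtain t where t: "t \<in> T" "\<And>x. x \<in> T \<Longrightarrow> u x \<le> u t"
        using continuous_attains_sup[OF \<open>compact T\<close> False] by blast
      have "u t < m" by (rule lt') (use t R in \<open>auto simp: T_def\<close>)
      then show ?thesis using t by (intro that[of "m - u t"]) auto
    qed (use that[of 1] in auto)
    define \<epsilon> where "\<epsilon> = \<eta> / 2"
    have \<epsilon>: "0 < \<epsilon>" "\<epsilon> < \<eta>" using \<eta> by (auto simp: \<epsilon>_def)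
    let ?w = "\<lambda>x. u x + \<epsilon> * ?v x"
    have v1: "0 < ?v x" "?v x \<le> 1" for x using \<alpha>(1) by auto
    have vmono: "?v x < ?v x' \<longleftrightarrow> dist z x' < dist z x" for x x'
    proof -
      have "?v x < ?v x' \<longleftrightarrow> (dist z x')\<^sup>2 < (dist z x)\<^sup>2"
        using \<alpha>(1) by (simp add: dist_norm power2_norm_eq_inner norm_minus_commute[of z])
      also have "\<dots> \<longleftrightarrow> dist z x' < dist z x"
        using power_mono_iff[of "dist z x" "dist z x'" 2] by (auto simp: not_le[symmetric])
      finally show ?thesis .
    qed
    have bd: "?w x < ?w y" if "x \<in> sphere y (R / 2)" for x
    proof (cases "dist z x \<le> R")
      case True
      then have "u x \<le> m - \<eta>" using that \<eta>(2) by (auto simp: T_def)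
      moreover have "\<epsilon> * ?v x \<le> \<epsilon> * 1" using v1[of x] \<epsilon> by (intro mult_left_mono) auto
      moreover have "\<epsilon> * ?v y > 0" using v1[of y] \<epsilon> by simp
      ultimately show ?thesis using yS(2) \<epsilon> by linarith
    next
      case False
      then have "?v x < ?v y" using vmono zy by auto
      then have "\<epsilon> * ?v x < \<epsilon> * ?v y" using \<epsilon> by simp
      moreover have "u x \<le> m" using le KS that by (auto simp: K_def)
      ultimately show ?thesis using yS(2) by linarith
    qed
    have sw: "smooth_on S ?w"
      by (intro smooth_on_add smooth_on_mult smooth_on_const S su sv)
    then have "continuous_on K ?w" using smooth_on_imp_continuous_on continuous_on_subset KS by blast
    then obtain x where x: "x \<in> K" "\<And>x'. x' \<in> K \<Longrightarrow> ?w x' \<le> ?w x"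
      using continuous_attains_sup[OF K(1), of ?w] K(2) by blast
    have "x \<notin> sphere y (R / 2)" using bd[of x] x(2)[OF K(2)] by fastforce
    then have xb: "x \<in> ball y (R / 2)" using x(1) by (auto simp: K_def)
    have bK: "ball y (R / 2) \<subseteq> K" by (auto simp: K_def)
    have "sum_squares_op X Y ?w x \<le> 0"
      by (rule sum_squares_op_le_0_at_max[OF open_ball smooth_on_subset[OF sw] smooth_on_subset[OF sX] xb])
        (use x(2) bK KS in auto)
    moreover have "sum_squares_op X Y ?w x = sum_squares_op X Y u x + \<epsilon> * sum_squares_op X Y ?v x"
      by (rule sum_squares_op_add_scaled[OF S su sv sX]) (use x(1) KS in auto)
    moreover have "\<epsilon> * sum_squares_op X Y ?v x > 0" using Lv[OF x(1)] \<epsilon> by simp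
    ultimately show False using sub[of x] x(1) KS by fastforce
  qed
  moreover have "ball y0 r0 \<subseteq> S" using r0 by (auto simp: subset_eq)
  ultimately show ?thesis using that r0(1) by blast
qed

section \<open>Charts, bump functions and vector fields\<close>

abbreviation transition :: "('a, 'n::finite) chart \<Rightarrow> ('a, 'n) chart \<Rightarrow> real^'n \<Rightarrow> real^'n" where
  "transition c c' \<equiv> cmap c' \<circ> cinv c"

lemma cinv_in_cdom: "y \<in> cimg c \<Longrightarrow> cinv c y \<in> cdom c"
  by (simp add: cinv_def inv_into_into)

lemma cmap_cinv: "y \<in> cimg c \<Longrightarrow> cmap c (cinv c y) = y"
  by (simp add: cinv_def f_inv_into_f)

locale smooth_mfd =
  fixes M :: "'a topology" and A :: "('a, 'n::finite) chart set"
  assumes mfd: "smooth_manifold M A"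
begin

abbreviation SF where "SF \<equiv> smooth_fun A"
abbreviation VF where "VF \<equiv> vector_field M A"
abbreviation T where "T \<equiv> tangent_space A"

lemma
  assumes c: "c \<in> A"
  shows openin_cdom: "openin M (cdom c)" and cdom_subset: "cdom c \<subseteq> topspace M"
    and open_cimg: "open (cimg c)"
    and chart_homeo: "homeomorphic_map (subtopology M (cdom c)) (top_of_set (cimg c)) (cmap c)"
proof -
  have "is_chart M c" using mfd c unfolding smooth_manifold_def by blast
  then show "openin M (cdom c)" "open (cimg c)"
    "homeomorphic_map (subtopology M (cdom c)) (top_of_set (cimg c)) (cmap c)"
    unfolding is_chart_def by blast+
  then show "cdom c \<subseteq> topspace M" by (simp add: openin_subset)
qed

lemma chart_around: "p \<in> topspace M \<Longrightarrow> \<exists>c\<in>A. p \<in> cdom c"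
  using mfd unfolding smooth_manifold_def by blast

lemma cinv_in_topspace: "c \<in> A \<Longrightarrow> y \<in> cimg c \<Longrightarrow> cinv c y \<in> topspace M"
  using cdom_subset cinv_in_cdom by (rule subsetD)

lemma inj_on_cmap: "c \<in> A \<Longrightarrow> inj_on (cmap c) (cdom c)"
  using homeomorphic_imp_injective_map[OF chart_homeo, of c] cdom_subset[of c]
  by (simp add: Int_absorb1)

lemma cinv_cmap: "c \<in> A \<Longrightarrow> p \<in> cdom c \<Longrightarrow> cinv c (cmap c p) = p"
  by (simp add: cinv_def inj_on_cmap)

lemma open_cmap_image:
  assumes "c \<in> A" "openin M U"
  shows "open (cmap c ` (U \<inter> cdom c))"
proof -
  have "openin (subtopology M (cdom c)) (U \<inter> cdom c)"
    using assms(2) openin_subtopology by blast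
  then have "openin (top_of_set (cimg c)) (cmap c ` (U \<inter> cdom c))"
    using homeomorphic_imp_open_map[OF chart_homeo[OF assms(1)]] by (simp add: open_map_def)
  then show ?thesis using open_cimg[OF assms(1)] openin_open_trans by blast
qed

lemma openin_cmap_vimage:
  assumes "c \<in> A" "open V"
  shows "openin M {q \<in> cdom c. cmap c q \<in> V}"
proof -
  have "openin (subtopology M (cdom c)) {q \<in> topspace (subtopology M (cdom c)). cmap c q \<in> cimg c \<inter> V}"
    using homeomorphic_imp_continuous_map[OF chart_homeo[OF assms(1)]] assms(2)
    by (intro openin_continuous_map_preimage) (auto simp: openin_open)
  moreover have "{q \<in> topspace (subtopology M (cdom c)). cmap c q \<in> cimg c \<inter> V} = {q \<in> cdom c. cmap c q \<in> V}"
    using cdom_subset[OF assms(1)] by auto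
  ultimately show ?thesis
    using openin_trans_full[OF _ openin_cdom[OF assms(1)]] by simp
qed

lemma open_overlap: "c \<in> A \<Longrightarrow> c' \<in> A \<Longrightarrow> open (cmap c ` (cdom c \<inter> cdom c'))"
  using open_cmap_image[of c "cdom c'"] openin_cdom by (simp add: Int_commute)

lemma smooth_transition:
  "c \<in> A \<Longrightarrow> c' \<in> A \<Longrightarrow> smooth_on (cmap c ` (cdom c \<inter> cdom c')) (transition c c')"
  using mfd unfolding smooth_manifold_def by blast

lemma transition_has_derivative:
  assumes "c \<in> A" "c' \<in> A" "p \<in> cdom c" "p \<in> cdom c'"
  shows "(transition c c' has_derivative FD (transition c c') (cmap c p)) (at (cmap c p))"
  by (rule smooth_on_imp_has_derivative[OF smooth_transition[OF assms(1,2)]]) (use assms in auto)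

text \<open>For a real-valued \<open>f\<close> this makes directional derivatives independent of the chart; for a chart
  map \<open>f\<close> it is the cocycle rule for transition maps.\<close>

lemma change_chart_chain:
  assumes c: "c \<in> A" "c' \<in> A" "p \<in> cdom c" "p \<in> cdom c'"
    and f: "(\<lambda>y. f (cinv c' y)) differentiable (at (cmap c' p))"
  shows "FD (\<lambda>y. f (cinv c y)) (cmap c p) v
    = FD (\<lambda>y. f (cinv c' y)) (cmap c' p) (FD (transition c c') (cmap c p) v)"
proof -
  have "((\<lambda>y. f (cinv c' (transition c c' y))) has_derivative
    (\<lambda>v. FD (\<lambda>y. f (cinv c' y)) (cmap c' p) (FD (transition c c') (cmap c p) v))) (at (cmap c p))"
  proof (rule has_derivative_compose[OF transition_has_derivative[OF c]])
    show "((\<lambda>y. f (cinv c' y)) has_derivative FD (\<lambda>y. f (cinv c' y)) (cmap c' p))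
       (at (transition c c' (cmap c p)))"
      using f c by (simp add: cinv_cmap frechet_derivative_works)
  qed
  then have "((\<lambda>y. f (cinv c y)) has_derivative
    (\<lambda>v. FD (\<lambda>y. f (cinv c' y)) (cmap c' p) (FD (transition c c') (cmap c p) v))) (at (cmap c p))"
    by (rule has_derivative_transform_within_open[OF _ open_overlap[OF c(1,2)]])
      (use c in \<open>auto simp: cinv_cmap\<close>)
  from frechet_derivative_at[OF this] show ?thesis by metis
qed

lemma transition_cocycle:
  assumes "c \<in> A" "c' \<in> A" "c'' \<in> A" "p \<in> cdom c" "p \<in> cdom c'" "p \<in> cdom c''"
  shows "FD (transition c c'') (cmap c p) v =
    FD (transition c' c'') (cmap c' p) (FD (transition c c') (cmap c p) v)"
proof -
  have "(\<lambda>y. cmap c'' (cinv c' y)) differentiable (at (cmap c' p))"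
    using transition_has_derivative[OF assms(2,3,5,6)] unfolding differentiable_def o_def by blast
  from change_chart_chain[OF assms(1,2,4,5) this, of v] show ?thesis by (simp add: o_def)
qed

lemma transition_self:
  assumes "c \<in> A" "p \<in> cdom c"
  shows "FD (transition c c) (cmap c p) v = v"
proof -
  have "(transition c c has_derivative (\<lambda>v. v)) (at (cmap c p))"
    by (rule has_derivative_transform_within_open[of "\<lambda>x. x" _ _ UNIV "cimg c"])
      (use assms open_cimg in \<open>auto simp: cmap_cinv cinv_cmap\<close>)
  from frechet_derivative_at[OF this] show ?thesis by metis
qed

lemma linear_transition:
  "c \<in> A \<Longrightarrow> c' \<in> A \<Longrightarrow> p \<in> cdom c \<Longrightarrow> p \<in> cdom c' \<Longrightarrow>
    linear (FD (transition c c') (cmap c p))"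
  using has_derivative_linear[OF transition_has_derivative] .

subsection \<open>Tangent vectors\<close>

lemma tangent_lin:
  assumes "u \<in> T p" "v \<in> T p"
  shows "(\<lambda>c. a *\<^sub>R u c + v c) \<in> T p"
proof -
  have "a *\<^sub>R u c' + v c' = FD (transition c c') (cmap c p) (a *\<^sub>R u c + v c)"
    if "c \<in> A" "c' \<in> A" "p \<in> cdom c" "p \<in> cdom c'" for c c'
  proof -
    have "u c' = FD (transition c c') (cmap c p) (u c)"
      "v c' = FD (transition c c') (cmap c p) (v c)"
      using assms that unfolding tangent_space_def by blast+
    then show ?thesis
      by (simp add: linear_add[OF linear_transition[OF that]] linear_scale[OF linear_transition[OF that]])
  qed
  moreover have "a *\<^sub>R u c + v c = 0" if "c \<notin> A \<or> p \<notin> cdom c" for c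
  proof -
    have "u c = 0" "v c = 0" using assms that unfolding tangent_space_def by blast+
    then show ?thesis by simp
  qed
  ultimately show ?thesis unfolding tangent_space_def by blast
qed

lemma tangent_0: "(\<lambda>c. 0) \<in> T p"
  by (simp add: tangent_space_def linear_0[OF linear_transition])

lemma tangent_sum: "finite I \<Longrightarrow> (\<And>i. i \<in> I \<Longrightarrow> u i \<in> T p) \<Longrightarrow> (\<lambda>c. \<Sum>i\<in>I. a i *\<^sub>R u i c) \<in> T p"
proof (induction I rule: finite_induct)
  case (insert x F)
  then have "(\<lambda>c. a x *\<^sub>R u x c + (\<Sum>i\<in>F. a i *\<^sub>R u i c)) \<in> T p"
    by (intro tangent_lin) auto
  then show ?case using insert by simp
qed (simp add: tangent_0)

lemma tangent_scale: "u \<in> T p \<Longrightarrow> (\<lambda>c. a *\<^sub>R u c) \<in> T p"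
  using tangent_lin[OF _ tangent_0, of u p a] by simp

lemma tangent_eqI:
  assumes "u \<in> T p" "v \<in> T p" "c \<in> A" "p \<in> cdom c" "u c = v c"
  shows "u = v"
proof
  fix c'
  show "u c' = v c'"
  proof (cases "c' \<in> A \<and> p \<in> cdom c'")
    case True
    then have "u c' = FD (transition c c') (cmap c p) (u c)"
      "v c' = FD (transition c c') (cmap c p) (v c)"
      using assms(1-4) unfolding tangent_space_def by blast+
    then show ?thesis using assms(5) by simp
  next
    case False
    then have "u c' = 0" "v c' = 0" using assms(1,2) unfolding tangent_space_def by blast+
    then show ?thesis by simp
  qed
qed

lemma tangent_transition:
  "v \<in> T p \<Longrightarrow> c \<in> A \<Longrightarrow> c' \<in> A \<Longrightarrow> p \<in> cdom c \<Longrightarrow> p \<in> cdom c' \<Longrightarrow>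
    v c' = FD (transition c c') (cmap c p) (v c)"
  unfolding tangent_space_def by blast

lemma coord_vec_tangent:
  assumes "c \<in> A" "p \<in> cdom c"
  shows "coord_vec A c i p \<in> T p"
proof -
  have "coord_vec A c i p c'' = FD (transition c' c'') (cmap c' p) (coord_vec A c i p c')"
    if "c' \<in> A" "c'' \<in> A" "p \<in> cdom c'" "p \<in> cdom c''" for c' c''
    using transition_cocycle[OF assms(1) that(1,2) assms(2) that(3,4)] that by (simp add: coord_vec_def)
  moreover have "coord_vec A c i p c' = 0" if "c' \<notin> A \<or> p \<notin> cdom c'" for c'
    using that unfolding coord_vec_def by meson
  ultimately show ?thesis unfolding tangent_space_def by blast
qed

lemma coord_vec_self:
  assumes "c \<in> A" "p \<in> cdom c"
  shows "coord_vec A c i p c = axis i 1"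
proof -
  have "coord_vec A c i p c = FD (transition c c) (cmap c p) (axis i 1)"
    unfolding coord_vec_def by (rule if_P) (use assms in blast)
  also have "\<dots> = axis i 1" by (rule transition_self[OF assms])
  finally show ?thesis .
qed


lemma tangent_expand_coord:
  assumes "v \<in> T p" "c \<in> A" "p \<in> cdom c"
  shows "v = (\<lambda>c'. \<Sum>i\<in>UNIV. (v c $ i) *\<^sub>R coord_vec A c i p c')"
  by (rule tangent_eqI[OF assms(1) tangent_sum assms(2,3)])
    (simp_all add: assms coord_vec_tangent coord_vec_self basis_expansion_axis[symmetric])

subsection \<open>Smoothness is a local property\<close>

text \<open>Around a given point one chart is enough, because transition maps are smooth.\<close>

lemma SF_localI:
  assumes "\<And>p. p \<in> topspace M \<Longrightarrow> \<exists>c\<in>A. \<exists>V. open V \<and> p \<in> cdom c \<and> cmap c p \<in> V \<and> smooth_on V (\<lambda>y. f (cinv c y))"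
  shows "SF f"
  unfolding smooth_fun_def o_def
proof (intro ballI smooth_on_local)
  fix c' y assume c': "c' \<in> A" and y: "y \<in> cimg c'"
  then have "cinv c' y \<in> topspace M" by (rule cinv_in_topspace)
  from assms[OF this] obtain c V where c: "c \<in> A" "open V" "cinv c' y \<in> cdom c"
    "cmap c (cinv c' y) \<in> V" "smooth_on V (\<lambda>y. f (cinv c y))" by blast
  let ?U = "{q \<in> cdom c. cmap c q \<in> V}"
  let ?W = "cmap c' ` (?U \<inter> cdom c')"
  have W: "open ?W" by (intro open_cmap_image c' openin_cmap_vimage c)
  have "cmap c' (cinv c' y) \<in> ?W" using c(3,4) cinv_in_cdom[OF y] by (intro imageI) simp
  then have yW: "y \<in> ?W" using cmap_cinv[OF y] by simp
  have "smooth_on ?W (\<lambda>z. f (cinv c (transition c' c z)))"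
  proof (rule smooth_on_compose[OF W c(2) _ c(5)])
    show "smooth_on ?W (transition c' c)"
      by (rule smooth_on_subset[OF smooth_transition[OF c' c(1)]]) auto
    show "transition c' c x \<in> V" if "x \<in> ?W" for x
      using that cinv_cmap[OF c'] by auto
  qed
  then have "smooth_on ?W (\<lambda>z. f (cinv c' z))"
    by (rule smooth_on_cong[OF W]) (use cinv_cmap[OF c(1)] cinv_cmap[OF c'] in auto)
  then show "\<exists>W. open W \<and> y \<in> W \<and> smooth_on W (\<lambda>y. f (cinv c' y))" using W yW by blast
qed

lemma SF_chart: "SF f \<Longrightarrow> c \<in> A \<Longrightarrow> smooth_on (cimg c) (\<lambda>y. f (cinv c y))"
  unfolding smooth_fun_def o_def by (rule bspec)

lemma SF_I: "(\<And>c. c \<in> A \<Longrightarrow> smooth_on (cimg c) (\<lambda>y. f (cinv c y))) \<Longrightarrow> SF f"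
  unfolding smooth_fun_def o_def by (rule ballI)

lemma SF_cong_local:
  assumes "\<And>p. p \<in> topspace M \<Longrightarrow> \<exists>U h. openin M U \<and> p \<in> U \<and> SF h \<and> (\<forall>q\<in>U. f q = h q)"
  shows "SF f"
proof (rule SF_localI)
  fix p assume p: "p \<in> topspace M"
  from assms[OF this] obtain U h where U: "openin M U" "p \<in> U" "SF h" and fh: "\<forall>q\<in>U. f q = h q"
    by (elim exE conjE)
  obtain c where c: "c \<in> A" "p \<in> cdom c" using chart_around p by blast
  let ?V = "cmap c ` (U \<inter> cdom c)"
  have V: "open ?V" by (rule open_cmap_image[OF c(1) U(1)])
  have "smooth_on ?V (\<lambda>y. f (cinv c y))"
    by (rule smooth_on_cong[OF V smooth_on_subset[OF SF_chart[OF U(3) c(1)]]])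
      (use cinv_cmap[OF c(1)] fh in auto)
  then show "\<exists>c\<in>A. \<exists>V. open V \<and> p \<in> cdom c \<and> cmap c p \<in> V \<and> smooth_on V (\<lambda>y. f (cinv c y))"
    using V c U by blast
qed

lemma SF_const [simp]: "SF (\<lambda>q. a)"
  by (rule SF_I) (rule smooth_on_const)

lemma SF_add: "SF f \<Longrightarrow> SF h \<Longrightarrow> SF (\<lambda>q. f q + h q)"
  by (rule SF_I) (simp add: smooth_on_add open_cimg SF_chart)

lemma SF_mult: "SF f \<Longrightarrow> SF h \<Longrightarrow> SF (\<lambda>q. f q * h q)"
  by (rule SF_I) (simp add: smooth_on_mult open_cimg SF_chart)

lemma SF_sum: "(\<And>i. i \<in> I \<Longrightarrow> SF (f i)) \<Longrightarrow> SF (\<lambda>q. \<Sum>i\<in>I. f i q)"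
  by (rule SF_I) (simp add: smooth_on_sum open_cimg SF_chart)

lemma SF_diff: "SF f \<Longrightarrow> SF h \<Longrightarrow> SF (\<lambda>q. f q - h q)"
  using SF_add[OF _ SF_mult[OF SF_const[of "-1"], of h], of f] by simp

lemma SF_continuous: 
  assumes "SF f"
  shows "continuous_map M euclideanreal f"
  unfolding continuous_map_def
proof (intro conjI allI impI)
  fix V :: "real set" assume "openin euclideanreal V"
  then have V: "open V" by simp
  show "openin M {q \<in> topspace M. f q \<in> V}"
  proof (subst openin_subopen, intro ballI)
    fix p assume p: "p \<in> {q \<in> topspace M. f q \<in> V}"
    then obtain c where c: "c \<in> A" "p \<in> cdom c" using chart_around by blast
    let ?W = "cimg c \<inter> (\<lambda>y. f (cinv c y)) -` V"
    have W: "open ?W"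
      by (rule continuous_open_preimage[OF smooth_on_imp_continuous_on[OF SF_chart[OF assms c(1)]]
          open_cimg[OF c(1)] V])
    have "p \<in> {q \<in> cdom c. cmap c q \<in> ?W}" using c(2) p cinv_cmap[OF c] by simp
    moreover have "{q \<in> cdom c. cmap c q \<in> ?W} \<subseteq> {q \<in> topspace M. f q \<in> V}"
    proof
      fix q assume "q \<in> {q \<in> cdom c. cmap c q \<in> ?W}"
      then have "q \<in> cdom c" "f (cinv c (cmap c q)) \<in> V" by auto
      then show "q \<in> {q \<in> topspace M. f q \<in> V}"
        using subsetD[OF cdom_subset[OF c(1)]] cinv_cmap[OF c(1)] by simp
    qed
    ultimately show "\<exists>W. openin M W \<and> p \<in> W \<and> W \<subseteq> {q \<in> topspace M. f q \<in> V}"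
      using openin_cmap_vimage[OF c(1) W] by blast
  qed
qed auto

lemma VF_tangent: "VF X \<Longrightarrow> p \<in> topspace M \<Longrightarrow> X p \<in> T p"
  unfolding vector_field_def by blast

lemma VF_chart: "VF X \<Longrightarrow> c \<in> A \<Longrightarrow> smooth_on (cimg c) (\<lambda>y. X (cinv c y) c)"
  unfolding vector_field_def by blast

text \<open>Coordinate vectors in another chart are obtained by applying the derivative of a
  transition map, which depends smoothly on the point.\<close>

lemma VF_localI:
  assumes tan: "\<And>p. p \<in> topspace M \<Longrightarrow> X p \<in> T p"
    and loc: "\<And>p. p \<in> topspace M \<Longrightarrow> \<exists>c\<in>A. \<exists>V. open V \<and> p \<in> cdom c \<and> cmap c p \<in> V \<and> smooth_on V (\<lambda>y. X (cinv c y) c)"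
  shows "VF X"
  unfolding vector_field_def
proof (intro conjI ballI smooth_on_local)
  fix c' y assume c': "c' \<in> A" and y: "y \<in> cimg c'"
  then have "cinv c' y \<in> topspace M" by (rule cinv_in_topspace)
  from loc[OF this] obtain c V where c: "c \<in> A" "open V" "cinv c' y \<in> cdom c"
    "cmap c (cinv c' y) \<in> V" "smooth_on V (\<lambda>y. X (cinv c y) c)" by blast
  let ?U = "{q \<in> cdom c. cmap c q \<in> V}"
  let ?W = "cmap c' ` (?U \<inter> cdom c')"
  have W: "open ?W" by (intro open_cmap_image c' openin_cmap_vimage c)
  have "cmap c' (cinv c' y) \<in> ?W" using c(3,4) cinv_in_cdom[OF y] by (intro imageI) simp
  then have yW: "y \<in> ?W" using cmap_cinv[OF y] by simp
  let ?V = "V \<inter> cmap c ` (cdom c \<inter> cdom c')"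
  have V: "open ?V" using c c' by (intro open_Int open_overlap)
  have "smooth_on ?V (\<lambda>z. FD (transition c c') z (X (cinv c z) c))"
    using smooth_on_subset[OF smooth_transition[OF c(1) c'], of ?V] smooth_on_subset[OF c(5), of ?V]
    by (intro smooth_on_frechet_derivative_field[OF V]) auto
  then have "smooth_on ?W (\<lambda>z. FD (transition c c') (transition c' c z) (X (cinv c (transition c' c z)) c))"
  proof (rule smooth_on_compose[OF W V, rotated])
    show "smooth_on ?W (transition c' c)"
      by (rule smooth_on_subset[OF smooth_transition[OF c' c(1)]]) auto
    show "transition c' c x \<in> ?V" if "x \<in> ?W" for x
      using that cinv_cmap[OF c'] by auto
  qed
  then have "smooth_on ?W (\<lambda>z. X (cinv c' z) c')"
  proof (rule smooth_on_cong[OF W])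
    fix z assume "z \<in> ?W"
    then obtain q where q: "q \<in> cdom c" "q \<in> cdom c'" "z = cmap c' q" by auto
    have "X q \<in> T q" using tan subsetD[OF cdom_subset[OF c'] q(2)] .
    from tangent_transition[OF this c(1) c' q(1,2)]
    show "FD (transition c c') (transition c' c z) (X (cinv c (transition c' c z)) c) = X (cinv c' z) c'"
      by (simp add: q(3) cinv_cmap[OF c' q(2)] cinv_cmap[OF c(1) q(1)])
  qed
  then show "\<exists>W. open W \<and> y \<in> W \<and> smooth_on W (\<lambda>y. X (cinv c' y) c')" using W yW by blast
qed (use tan in auto)

lemma VF_lin:
  assumes "SF f" "VF X" "VF Y"
  shows "VF (\<lambda>q c. f q *\<^sub>R X q c + Y q c)"
  unfolding vector_field_def
  by (intro conjI ballI tangent_lin VF_tangent smooth_on_add smooth_on_scaleR open_cimg SF_chart VF_chart assms)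

lemma VF_0: "VF (\<lambda>q c. 0)"
  by (simp add: vector_field_def tangent_0)

lemma VF_scale: "SF f \<Longrightarrow> VF X \<Longrightarrow> VF (\<lambda>q c. f q *\<^sub>R X q c)"
  using VF_lin[OF _ _ VF_0, of f X] by simp

lemma VF_sum: "finite I \<Longrightarrow> (\<And>i. i \<in> I \<Longrightarrow> SF (f i)) \<Longrightarrow> (\<And>i. i \<in> I \<Longrightarrow> VF (X i)) \<Longrightarrow>
    VF (\<lambda>q c. \<Sum>i\<in>I. f i q *\<^sub>R X i q c)"
proof (induction I rule: finite_induct)
  case (insert x F)
  then have "VF (\<lambda>q c. f x q *\<^sub>R X x q c + (\<Sum>i\<in>F. f i q *\<^sub>R X i q c))"
    by (intro VF_lin) auto
  then show ?case using insert by simp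
qed (simp add: VF_0)

subsection \<open>Bump functions and extension of local objects\<close>

lemma smooth_zero_off_closed:
  assumes "closedin M K" "q \<in> topspace M" "q \<notin> K" "\<And>r c. r \<notin> K \<Longrightarrow> h r c = 0"
  shows "\<exists>c\<in>A. \<exists>V. open V \<and> q \<in> cdom c \<and> cmap c q \<in> V \<and> smooth_on V (\<lambda>y. h (cinv c y) c)"
proof -
  obtain c where c: "c \<in> A" "q \<in> cdom c" using chart_around assms(2) by blast
  let ?W = "cmap c ` ((topspace M - K) \<inter> cdom c)"
  have W: "open ?W" by (rule open_cmap_image[OF c(1)]) (use assms(1) in blast)
  have "smooth_on ?W (\<lambda>y. h (cinv c y) c)"
    by (rule smooth_on_cong[OF W smooth_on_const[of _ 0]]) (use cinv_cmap[OF c(1)] assms(4)[of _ c] in auto)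
  then show ?thesis using W c assms(2,3) by blast
qed

text \<open>The support of the cutoff in a chart is compact, hence closed because \<open>M\<close>
  is Hausdorff; so the extension by zero is smooth.
  The conclusion mentions the closed set \<open>K\<close> and not only \<open>U\<close>, so that products with the
  function extend smoothly by zero across the boundary of \<open>U\<close>.\<close>

lemma bump_function_exists:
  assumes "openin M U" "p \<in> U"
  obtains f K W where "SF f" "closedin M K" "K \<subseteq> U" "\<And>q. q \<notin> K \<Longrightarrow> f q = 0"
    "openin M W" "p \<in> W" "W \<subseteq> U" "\<And>q. q \<in> W \<Longrightarrow> f q = 1"
proof -
  have "p \<in> topspace M" using assms openin_subset by blast
  then obtain c where c: "c \<in> A" "p \<in> cdom c" using chart_around by blast
  let ?y = "cmap c p"
  let ?V = "cmap c ` (U \<inter> cdom c)"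
  have V: "open ?V" by (rule open_cmap_image[OF c(1) assms(1)])
  moreover have "?y \<in> ?V" using c assms by blast
  ultimately obtain e where e: "e > 0" "cball ?y e \<subseteq> ?V" using open_contains_cball by blast
  define r where "r = e / 2"
  have r: "r > 0" "cball ?y (2 * r) \<subseteq> ?V" using e by (auto simp: r_def)
  obtain \<kappa> where \<kappa>: "smooth_on UNIV \<kappa>" "\<And>y. dist y ?y \<le> r \<Longrightarrow> \<kappa> y = (1::real)"
    "\<And>y. dist y ?y \<ge> 2 * r \<Longrightarrow> \<kappa> y = 0" using smooth_cutoff_exists[OF r(1)] by blast
  define K where "K = cinv c ` cball ?y (2 * r)"
  define f where "f = (\<lambda>q. if q \<in> U \<inter> cdom c then \<kappa> (cmap c q) else 0)"
  have KU: "K \<subseteq> U \<inter> cdom c"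
  proof
    fix q assume "q \<in> K"
    then obtain y where "y \<in> cball ?y (2 * r)" "q = cinv c y" unfolding K_def by blast
    then obtain q' where "q' \<in> U \<inter> cdom c" "q = cinv c (cmap c q')" using r(2) by blast
    then show "q \<in> U \<inter> cdom c" using cinv_cmap[OF c(1)] by simp
  qed
  have "compactin M K"
  proof -
    obtain h where h: "homeomorphic_maps (subtopology M (cdom c)) (top_of_set (cimg c)) (cmap c) h"
      using chart_homeo[OF c(1)] homeomorphic_map_maps by blast
    have "h y = cinv c y" if "y \<in> cimg c" for y
    proof -
      have "h (cmap c q) = q" if "q \<in> cdom c" for q
        using h that subsetD[OF cdom_subset[OF c(1)]] unfolding homeomorphic_maps_def by simp
      then show ?thesis using that cinv_cmap[OF c(1)] by auto
    qed
    moreover have "cball ?y (2 * r) \<subseteq> cimg c" using r(2) by blast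
    ultimately have "h ` cball ?y (2 * r) = K" unfolding K_def by (intro image_cong) auto
    moreover have "compactin (subtopology M (cdom c)) (h ` cball ?y (2 * r))"
    proof (rule image_compactin)
      show "continuous_map (top_of_set (cimg c)) (subtopology M (cdom c)) h"
        using h by (simp add: homeomorphic_maps_def)
      show "compactin (top_of_set (cimg c)) (cball ?y (2 * r))"
        using r(2) by (auto simp: compactin_subtopology)
    qed
    ultimately show ?thesis by (simp add: compactin_subtopology)
  qed
  then have K: "closedin M K"
    using mfd compactin_imp_closedin unfolding smooth_manifold_def by blast
  have f0: "f q = 0" if "q \<notin> K" for q
  proof (cases "q \<in> U \<inter> cdom c")
    case True
    have "cmap c q \<notin> cball ?y (2 * r)"
    proof
      assume "cmap c q \<in> cball ?y (2 * r)"
      then have "cinv c (cmap c q) \<in> K" unfolding K_def by (rule imageI)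
      then show False using that True cinv_cmap[OF c(1)] by simp
    qed
    then show ?thesis using \<kappa>(3)[of "cmap c q"] by (auto simp: f_def dist_commute)
  qed (auto simp: f_def)
  have sf: "SF f"
  proof (rule SF_localI)
    fix q assume q: "q \<in> topspace M"
    show "\<exists>c\<in>A. \<exists>V. open V \<and> q \<in> cdom c \<and> cmap c q \<in> V \<and> smooth_on V (\<lambda>y. f (cinv c y))"
    proof (cases "q \<in> U \<inter> cdom c")
      case True
      have "smooth_on ?V (\<lambda>y. f (cinv c y))"
        by (rule smooth_on_cong[OF V smooth_on_subset[OF \<kappa>(1)]])
          (use cinv_cmap[OF c(1)] in \<open>auto simp: f_def\<close>)
      then show ?thesis using V c True by blast
    next
      case False
      then have "q \<notin> K" using KU by blast
      from smooth_zero_off_closed[OF K q this, of "\<lambda>r c. f r"] f0 show ?thesis by blast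
    qed
  qed
  have oW: "openin M ({q \<in> cdom c. cmap c q \<in> ball ?y r} \<inter> U)"
    by (intro openin_Int openin_cmap_vimage c assms) simp
  have KU': "K \<subseteq> U" using KU by blast
  show ?thesis
    by (rule that[OF sf K KU' f0 oW])
      (use c(2) assms(2) r(1) \<kappa>(2) in \<open>simp_all add: f_def dist_commute\<close>)
qed

lemma coordinate_field_extension:
  assumes c: "c \<in> A" "p \<in> cdom c"
  obtains X where "VF X" "X p = coord_vec A c i p"
proof -
  obtain f K W where f: "SF f" "closedin M K" "K \<subseteq> cdom c" "\<And>q. q \<notin> K \<Longrightarrow> f q = 0"
    "p \<in> W" "\<And>q. q \<in> W \<Longrightarrow> f q = 1"
    by (rule bump_function_exists[OF openin_cdom[OF c(1)] c(2)]) blast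
  let ?X = "\<lambda>q c'. f q *\<^sub>R coord_vec A c i q c'"
  have "VF ?X"
  proof (rule VF_localI)
    fix q assume q: "q \<in> topspace M"
    show "?X q \<in> T q"
    proof (cases "q \<in> cdom c")
      case True
      then show ?thesis by (intro tangent_scale coord_vec_tangent c)
    next
      case False
      then have "f q = 0" using f(3,4) by blast
      then show ?thesis using tangent_0 by simp
    qed
    show "\<exists>c'\<in>A. \<exists>V. open V \<and> q \<in> cdom c' \<and> cmap c' q \<in> V \<and> smooth_on V (\<lambda>y. ?X (cinv c' y) c')"
    proof (cases "q \<in> cdom c")
      case True
      have "smooth_on (cimg c) (\<lambda>y. f (cinv c y) *\<^sub>R axis i 1)"
        by (intro smooth_on_scaleR open_cimg c SF_chart f smooth_on_const)
      then have "smooth_on (cimg c) (\<lambda>y. ?X (cinv c y) c)"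
        by (rule smooth_on_cong[OF open_cimg[OF c(1)]])
          (use coord_vec_self[OF c(1) cinv_in_cdom] in simp)
      then show ?thesis using open_cimg c True by blast
    next
      case False
      then have "q \<notin> K" using f(3) by blast
      then show ?thesis by (rule smooth_zero_off_closed[OF f(2) q]) (simp add: f(4))
    qed
  qed
  moreover have "?X p = coord_vec A c i p" using f(5,6) by simp
  ultimately show ?thesis by (rule that)
qed

lemma tangent_extension:
  assumes "v \<in> T p" "p \<in> topspace M"
  obtains X where "VF X" "X p = v"
proof -
  obtain c where c: "c \<in> A" "p \<in> cdom c" using chart_around assms by blast
  have "\<exists>X. VF X \<and> X p = coord_vec A c i p" for i
    using coordinate_field_extension[OF c] by metis
  then obtain X where X: "\<And>i. VF (X i)" "\<And>i. X i p = coord_vec A c i p" by metis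
  have "VF (\<lambda>q c'. \<Sum>i\<in>UNIV. (\<lambda>q. v c $ i) q *\<^sub>R X i q c')"
    by (rule VF_sum) (simp_all add: X)
  then show ?thesis
    by (rule that) (use tangent_expand_coord[OF assms(1) c] X in simp)
qed

text \<open>A normalising factor for Gram--Schmidt: a function with the prescribed values near
  \<open>p\<close> that stays smooth where \<open>f\<close> is not positive.\<close>

lemma inverse_sqrt_extension:
  assumes f: "SF f" and p: "p \<in> topspace M" "f p > 0"
  obtains r W where "SF r" "openin M W" "p \<in> W" "\<And>q. q \<in> W \<Longrightarrow> f q > 0 \<and> r q = 1 / sqrt (f q)"
proof -
  let ?U = "{q \<in> topspace M. f q \<in> {0<..}}"
  have U: "openin M ?U"
    by (rule openin_continuous_map_preimage[OF SF_continuous[OF f]]) simp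
  have "p \<in> ?U" using p by simp
  from bump_function_exists[OF U this] obtain h K W where h: "SF h" "closedin M K" "K \<subseteq> ?U"
    "\<And>q. q \<notin> K \<Longrightarrow> h q = 0" "openin M W" "p \<in> W" "W \<subseteq> ?U" "\<And>q. q \<in> W \<Longrightarrow> h q = 1" by blast
  let ?r = "\<lambda>q. h q * (1 / sqrt (f q))"
  have "SF ?r"
  proof (rule SF_localI)
    fix q assume q: "q \<in> topspace M"
    obtain c where c: "c \<in> A" "q \<in> cdom c" using chart_around q by blast
    show "\<exists>c\<in>A. \<exists>V. open V \<and> q \<in> cdom c \<and> cmap c q \<in> V \<and> smooth_on V (\<lambda>y. ?r (cinv c y))"
    proof (cases "q \<in> ?U")
      case True
      let ?V = "cmap c ` (?U \<inter> cdom c)"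
      have V: "open ?V" by (rule open_cmap_image[OF c(1) U])
      have sub: "?V \<subseteq> cimg c" by auto
      have "smooth_on ?V (\<lambda>y. 1 / sqrt (f (cinv c y)))"
        by (rule smooth_on_compose[OF V _ _ smooth_on_inverse_sqrt smooth_on_subset[OF SF_chart[OF f c(1)] sub]])
          (use cinv_cmap[OF c(1)] in auto)
      then have "smooth_on ?V (\<lambda>y. ?r (cinv c y))"
        by (intro smooth_on_mult V smooth_on_subset[OF SF_chart[OF h(1) c(1)] sub])
      then show ?thesis using V c True by blast
    next
      case False
      then have "q \<notin> K" using h(3) by blast
      from smooth_zero_off_closed[OF h(2) q this, of "\<lambda>r c. ?r r"] h(4) show ?thesis by simp
    qed
  qed
  then show ?thesis
    by (rule that[OF _ h(5,6)]) (use h in auto)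
qed

subsection \<open>Directional derivatives\<close>

lemma dir_deriv_cong:
  assumes "openin M U" "p \<in> U" "\<And>q. q \<in> U \<Longrightarrow> f q = h q"
  shows "dir_deriv A p v f = dir_deriv A p v h"
proof -
  have p: "p \<in> topspace M" using assms openin_subset by blast
  define c where "c = (SOME c. c \<in> A \<and> p \<in> cdom c)"
  have "\<exists>c. c \<in> A \<and> p \<in> cdom c" using chart_around p by blast
  from someI_ex[OF this] have c: "c \<in> A" "p \<in> cdom c" by (auto simp: c_def)
  have "FD (f \<circ> cinv c) (cmap c p) = FD (h \<circ> cinv c) (cmap c p)"
    by (rule frechet_derivative_cong_open[OF open_cmap_image[OF c(1) assms(1)]])
      (use cinv_cmap[OF c(1)] c(2) assms(2,3) in auto)
  then show ?thesis unfolding dir_deriv_def Let_def c_def[symmetric] by simp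
qed

lemma dir_deriv_chart:
  assumes "SF f" "v \<in> T p" "c \<in> A" "p \<in> cdom c"
  shows "dir_deriv A p v f = FD (\<lambda>y. f (cinv c y)) (cmap c p) (v c)"
proof -
  define c0 where "c0 = (SOME c. c \<in> A \<and> p \<in> cdom c)"
  have "\<exists>c. c \<in> A \<and> p \<in> cdom c" using assms by blast
  from someI_ex[OF this] have c0: "c0 \<in> A" "p \<in> cdom c0" by (auto simp: c0_def)
  have "(\<lambda>y. f (cinv c y)) differentiable (at (cmap c p))"
    by (rule smooth_on_imp_differentiable[OF SF_chart[OF assms(1,3)]]) (use assms in auto)
  from change_chart_chain[OF c0(1) assms(3) c0(2) assms(4) this, of "v c0"]
  have "FD (\<lambda>y. f (cinv c0 y)) (cmap c0 p) (v c0)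
     = FD (\<lambda>y. f (cinv c y)) (cmap c p) (v c)"
    by (simp only: tangent_transition[OF assms(2) c0(1) assms(3) c0(2) assms(4), symmetric])
  then show ?thesis unfolding dir_deriv_def Let_def c0_def[symmetric] o_def .
qed

lemma chart_has_derivative:
  assumes "SF f" "c \<in> A" "p \<in> cdom c"
  shows "((\<lambda>y. f (cinv c y)) has_derivative FD (\<lambda>y. f (cinv c y)) (cmap c p)) (at (cmap c p))"
  by (rule smooth_on_imp_has_derivative[OF SF_chart[OF assms(1,2)]]) (use assms in auto)

lemma dir_deriv_sum_vec:
  assumes "SF f" "p \<in> topspace M" "\<And>i. i \<in> I \<Longrightarrow> u i \<in> T p" "finite I"
  shows "dir_deriv A p (\<lambda>c. \<Sum>i\<in>I. a i *\<^sub>R u i c) f = (\<Sum>i\<in>I. a i * dir_deriv A p (u i) f)"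
proof -
  obtain c where c: "c \<in> A" "p \<in> cdom c" using chart_around assms(2) by blast
  have "linear (FD (\<lambda>y. f (cinv c y)) (cmap c p))"
    by (rule has_derivative_linear[OF chart_has_derivative[OF assms(1) c]])
  then show ?thesis
    using assms c by (simp add: dir_deriv_chart[OF _ _ c] tangent_sum linear_sum linear_scale)
qed

lemma dir_deriv_lin_vec:
  assumes "SF f" "p \<in> topspace M" "u \<in> T p" "v \<in> T p"
  shows "dir_deriv A p (\<lambda>c. a *\<^sub>R u c + v c) f = a * dir_deriv A p u f + dir_deriv A p v f"
proof -
  obtain c where c: "c \<in> A" "p \<in> cdom c" using chart_around assms(2) by blast
  have "linear (FD (\<lambda>y. f (cinv c y)) (cmap c p))"
    by (rule has_derivative_linear[OF chart_has_derivative[OF assms(1) c]])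
  then show ?thesis
    using assms c by (simp add: dir_deriv_chart[OF _ _ c] tangent_lin linear_add linear_scale)
qed

lemma dir_deriv_mult:
  assumes "SF f" "SF h" "p \<in> topspace M" "v \<in> T p"
  shows "dir_deriv A p v (\<lambda>q. f q * h q) = f p * dir_deriv A p v h + dir_deriv A p v f * h p"
proof -
  obtain c where c: "c \<in> A" "p \<in> cdom c" using chart_around assms(3) by blast
  have "FD (\<lambda>y. f (cinv c y) * h (cinv c y)) (cmap c p) (v c)
    = f p * FD (\<lambda>y. h (cinv c y)) (cmap c p) (v c)
      + FD (\<lambda>y. f (cinv c y)) (cmap c p) (v c) * h p"
    using frechet_derivative_at[OF has_derivative_mult[OF chart_has_derivative[OF assms(1) c]
      chart_has_derivative[OF assms(2) c]], symmetric] c by (simp add: cinv_cmap)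
  then show ?thesis
    using assms c by (simp add: dir_deriv_chart[OF _ _ c] SF_mult)
qed

lemma dir_deriv_add:
  assumes "SF f" "SF h" "p \<in> topspace M" "v \<in> T p"
  shows "dir_deriv A p v (\<lambda>q. f q + h q) = dir_deriv A p v f + dir_deriv A p v h"
proof -
  obtain c where c: "c \<in> A" "p \<in> cdom c" using chart_around assms(3) by blast
  show ?thesis
    using frechet_derivative_at[OF has_derivative_add[OF chart_has_derivative[OF assms(1) c]
      chart_has_derivative[OF assms(2) c]], symmetric] assms c
    by (simp add: dir_deriv_chart[OF _ _ c] SF_add)
qed

lemma dir_deriv_const:
  assumes "p \<in> topspace M" "v \<in> T p"
  shows "dir_deriv A p v (\<lambda>q. a) = 0"
proof -
  obtain c where c: "c \<in> A" "p \<in> cdom c" using chart_around assms(1) by blast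
  show ?thesis using assms by (simp add: dir_deriv_chart[OF _ _ c])
qed

lemma dir_deriv_cmult:
  assumes "SF f" "p \<in> topspace M" "v \<in> T p"
  shows "dir_deriv A p v (\<lambda>q. a * f q) = a * dir_deriv A p v f"
  using dir_deriv_mult[OF SF_const assms(1,2,3)] dir_deriv_const[OF assms(2,3)] by simp

lemma dir_deriv_diff:
  assumes "SF f" "SF h" "p \<in> topspace M" "v \<in> T p"
  shows "dir_deriv A p v (\<lambda>q. f q - h q) = dir_deriv A p v f - dir_deriv A p v h"
  using dir_deriv_add[OF assms(1) SF_mult[OF SF_const assms(2)] assms(3,4), of "-1"]
    dir_deriv_cmult[OF assms(2,3,4), of "-1"] by simp

lemma dir_deriv_sum:
  assumes "finite I" "\<And>i. i \<in> I \<Longrightarrow> SF (f i)" "p \<in> topspace M" "v \<in> T p"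
  shows "dir_deriv A p v (\<lambda>q. \<Sum>i\<in>I. f i q) = (\<Sum>i\<in>I. dir_deriv A p v (f i))"
  using assms(1,2)
  by (induction I rule: finite_induct) (auto simp: dir_deriv_const dir_deriv_add SF_sum assms(3,4))

lemma dir_deriv_field_chart:
  assumes "SF f" "VF X" "c \<in> A" "y \<in> cimg c"
  shows "dir_deriv A (cinv c y) (X (cinv c y)) f = FD (\<lambda>y. f (cinv c y)) y (X (cinv c y) c)"
proof -
  have q: "cinv c y \<in> cdom c" by (rule cinv_in_cdom[OF assms(4)])
  have "X (cinv c y) \<in> T (cinv c y)" by (rule VF_tangent[OF assms(2) cinv_in_topspace[OF assms(3,4)]])
  from dir_deriv_chart[OF assms(1) this assms(3) q] show ?thesis by (simp add: cmap_cinv[OF assms(4)])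
qed

lemma SF_dir_deriv:
  assumes "SF f" "VF X"
  shows "SF (\<lambda>q. dir_deriv A q (X q) f)"
proof (rule SF_I)
  fix c assume c: "c \<in> A"
  show "smooth_on (cimg c) (\<lambda>y. dir_deriv A (cinv c y) (X (cinv c y)) f)"
    by (rule smooth_on_cong[OF open_cimg[OF c]
          smooth_on_frechet_derivative_field[OF open_cimg[OF c] SF_chart[OF assms(1) c] VF_chart[OF assms(2) c]]])
      (rule dir_deriv_field_chart[OF assms c, symmetric])
qed

lemma dir_deriv_twice_chart:
  assumes "SF f" "VF X" "VF Y" "c \<in> A" "y \<in> cimg c"
  shows "dir_deriv A (cinv c y) (X (cinv c y)) (\<lambda>q. dir_deriv A q (Y q) f)
    = FD (\<lambda>z. FD (\<lambda>y. f (cinv c y)) z (Y (cinv c z) c)) y (X (cinv c y) c)"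
proof -
  have "FD (\<lambda>z. dir_deriv A (cinv c z) (Y (cinv c z)) f) y
    = FD (\<lambda>z. FD (\<lambda>y. f (cinv c y)) z (Y (cinv c z) c)) y"
    by (rule frechet_derivative_cong_open[OF open_cimg[OF assms(4)] assms(5)])
      (rule dir_deriv_field_chart[OF assms(1,3,4)])
  then show ?thesis
    using dir_deriv_field_chart[OF SF_dir_deriv[OF assms(1,3)] assms(2,4,5)] by simp
qed

text \<open>In a chart the second derivatives of \<open>f\<close> are symmetric and cancel; the
  derivatives of the coordinates of the fields remain.\<close>

lemma dir_deriv_lie_bracket:
  assumes "SF f" "VF X" "VF Y" "p \<in> topspace M"
  shows "dir_deriv A p (lie_bracket A X Y p) f
    = dir_deriv A p (X p) (\<lambda>q. dir_deriv A q (Y q) f) - dir_deriv A p (Y p) (\<lambda>q. dir_deriv A q (X q) f)"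
proof -
  define c where "c = (SOME c. c \<in> A \<and> p \<in> cdom c)"
  have "\<exists>c. c \<in> A \<and> p \<in> cdom c" using chart_around assms by blast
  from someI_ex[OF this] have c: "c \<in> A" "p \<in> cdom c" by (auto simp: c_def)
  let ?y = "cmap c p" and ?F = "\<lambda>y. f (cinv c y)"
  have y: "?y \<in> cimg c" "cinv c ?y = p" using c by (auto simp: cinv_cmap)
  have twice: "dir_deriv A p (X p) (\<lambda>q. dir_deriv A q (Y q) f) =
     FD (\<lambda>z. FD ?F z (Y p c)) ?y (X p c)
     + FD ?F ?y (FD (\<lambda>y. Y (cinv c y) c) ?y (X p c))"
    if "VF X" "VF Y" for X Y
    using dir_deriv_twice_chart[OF assms(1) that c(1) y(1)]
      frechet_derivative_field_twice[OF open_cimg[OF c(1)] SF_chart[OF assms(1) c(1)] VF_chart[OF that(2) c(1)] y(1)]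
    by (simp add: y(2))
  have "linear (FD ?F ?y)"
    by (rule has_derivative_linear[OF chart_has_derivative[OF assms(1) c]])
  moreover have "dir_deriv A p (lie_bracket A X Y p) f = FD ?F ?y (lie_bracket A X Y p c)"
    unfolding dir_deriv_def Let_def c_def[symmetric] o_def ..
  moreover have "FD (\<lambda>z. FD ?F z (Y p c)) ?y (X p c)
     = FD (\<lambda>z. FD ?F z (X p c)) ?y (Y p c)"
    by (rule frechet_derivative_symmetric[OF open_cimg[OF c(1)] SF_chart[OF assms(1) c(1)] y(1)])
  ultimately show ?thesis
    using c by (simp add: twice[OF assms(2,3)] twice[OF assms(3,2)] lie_bracket_def linear_diff)
qed

end

section \<open>Symmetric bilinear forms and the Levi-Civita connection\<close>

context smooth_mfd
begin

lemma form_sym: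
  "smooth_sym_form M A \<phi> \<Longrightarrow> p \<in> topspace M \<Longrightarrow> u \<in> T p \<Longrightarrow> v \<in> T p \<Longrightarrow> \<phi> p u v = \<phi> p v u"
  unfolding smooth_sym_form_def by blast

lemma form_lin_left:
  "smooth_sym_form M A \<phi> \<Longrightarrow> p \<in> topspace M \<Longrightarrow> u \<in> T p \<Longrightarrow> v \<in> T p \<Longrightarrow> w \<in> T p \<Longrightarrow>
    \<phi> p (\<lambda>c. a *\<^sub>R u c + v c) w = a * \<phi> p u w + \<phi> p v w"
  unfolding smooth_sym_form_def by blast

lemma form_zero_left:
  assumes "smooth_sym_form M A \<phi>" "p \<in> topspace M" "w \<in> T p"
  shows "\<phi> p (\<lambda>c. 0) w = 0"
  using form_lin_left[OF assms(1,2) tangent_0 tangent_0 assms(3), of 1] by simp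

lemma form_sum_left:
  assumes "smooth_sym_form M A \<phi>" "p \<in> topspace M" "w \<in> T p" "finite I" "\<And>i. i \<in> I \<Longrightarrow> u i \<in> T p"
  shows "\<phi> p (\<lambda>c. \<Sum>i\<in>I. a i *\<^sub>R u i c) w = (\<Sum>i\<in>I. a i * \<phi> p (u i) w)"
  using assms(4,5)
proof (induction I rule: finite_induct)
  case (insert x F)
  then have "\<phi> p (\<lambda>c. a x *\<^sub>R u x c + (\<Sum>i\<in>F. a i *\<^sub>R u i c)) w = a x * \<phi> p (u x) w + \<phi> p (\<lambda>c. \<Sum>i\<in>F. a i *\<^sub>R u i c) w"
    by (intro form_lin_left assms(1-3) tangent_sum) auto
  then show ?case using insert by simp
qed (simp add: form_zero_left[OF assms(1-3)])

lemma form_sum_right: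
  assumes "smooth_sym_form M A \<phi>" "p \<in> topspace M" "w \<in> T p" "finite I" "\<And>i. i \<in> I \<Longrightarrow> u i \<in> T p"
  shows "\<phi> p w (\<lambda>c. \<Sum>i\<in>I. a i *\<^sub>R u i c) = (\<Sum>i\<in>I. a i * \<phi> p w (u i))"
proof -
  have "(\<lambda>c. \<Sum>i\<in>I. a i *\<^sub>R u i c) \<in> T p" by (rule tangent_sum) (use assms in auto)
  from form_sym[OF assms(1,2,3) this] form_sum_left[OF assms, where a=a]
  have "\<phi> p w (\<lambda>c. \<Sum>i\<in>I. a i *\<^sub>R u i c) = (\<Sum>i\<in>I. a i * \<phi> p (u i) w)" by simp
  also have "\<dots> = (\<Sum>i\<in>I. a i * \<phi> p w (u i))"
    by (rule sum.cong[OF refl]) (simp add: form_sym[OF assms(1,2,3) assms(5)])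
  finally show ?thesis .
qed

lemma form_lin_right:
  assumes "smooth_sym_form M A \<phi>" "p \<in> topspace M" "u \<in> T p" "v \<in> T p" "w \<in> T p"
  shows "\<phi> p w (\<lambda>c. a *\<^sub>R u c + v c) = a * \<phi> p w u + \<phi> p w v"
  using form_lin_left[OF assms, of a] form_sym[OF assms(1,2,5) tangent_lin[OF assms(3,4)], of a]
    form_sym[OF assms(1,2,5,3)] form_sym[OF assms(1,2,5,4)] by simp

lemma form_diff2_left:
  assumes "smooth_sym_form M A \<phi>" "p \<in> topspace M" "a \<in> T p" "b \<in> T p" "d \<in> T p" "w \<in> T p"
  shows "\<phi> p (\<lambda>c. a c - b c - d c) w = \<phi> p a w - \<phi> p b w - \<phi> p d w"
proof -
  have "(\<lambda>c. a c - b c - d c) = (\<lambda>c. (-1) *\<^sub>R d c + ((-1) *\<^sub>R b c + a c))" by (simp add: algebra_simps)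
  then show ?thesis
    using form_lin_left[OF assms(1,2,5) tangent_lin[OF assms(4,3)] assms(6), of "-1" "-1"]
      form_lin_left[OF assms(1,2,4,3,6), of "-1"] by simp
qed

lemma tangent_diff2: "a \<in> T p \<Longrightarrow> b \<in> T p \<Longrightarrow> d \<in> T p \<Longrightarrow> (\<lambda>c. a c - b c - d c) \<in> T p"
  using tangent_lin[of d p "\<lambda>c. (-1) *\<^sub>R b c + a c" "-1"] tangent_lin[of b p a "-1"]
  by (simp add: algebra_simps)

lemma SF_form:
  assumes "smooth_sym_form M A \<phi>" "VF X" "VF Y"
  shows "SF (\<lambda>q. \<phi> q (X q) (Y q))"
proof (rule SF_I)
  fix c assume c: "c \<in> A"
  let ?h = "\<lambda>y. \<Sum>i\<in>UNIV. \<Sum>j\<in>UNIV. (X (cinv c y) c $ i) * ((Y (cinv c y) c $ j) *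
      \<phi> (cinv c y) (coord_vec A c i (cinv c y)) (coord_vec A c j (cinv c y)))"
  have coeff: "smooth_on (cimg c) (\<lambda>y. \<phi> (cinv c y) (coord_vec A c i (cinv c y)) (coord_vec A c j (cinv c y)))" for i j
    using assms(1) c unfolding smooth_sym_form_def o_def by blast
  have "smooth_on (cimg c) ?h"
    by (intro smooth_on_sum smooth_on_mult smooth_on_vec_nth open_cimg c VF_chart assms coeff)
  then show "smooth_on (cimg c) (\<lambda>y. \<phi> (cinv c y) (X (cinv c y)) (Y (cinv c y)))"
  proof (rule smooth_on_cong[OF open_cimg[OF c]])
    fix y assume y: "y \<in> cimg c"
    let ?q = "cinv c y"
    have q: "?q \<in> topspace M" "?q \<in> cdom c" by (rule cinv_in_topspace[OF c y], rule cinv_in_cdom[OF y])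
    have co: "coord_vec A c i ?q \<in> T ?q" for i by (rule coord_vec_tangent[OF c q(2)])
    have X: "X ?q \<in> T ?q" and Y: "Y ?q \<in> T ?q" using VF_tangent assms q by blast+
    have "\<phi> ?q (X ?q) (Y ?q) = \<phi> ?q (\<lambda>c'. \<Sum>i\<in>UNIV. (X ?q c $ i) *\<^sub>R coord_vec A c i ?q c') (Y ?q)"
      using tangent_expand_coord[OF X c q(2)] by simp
    also have "\<dots> = (\<Sum>i\<in>UNIV. (X ?q c $ i) * \<phi> ?q (coord_vec A c i ?q) (Y ?q))"
      by (rule form_sum_left[OF assms(1) q(1) Y]) (simp_all add: co)
    also have "\<dots> = (\<Sum>i\<in>UNIV. (X ?q c $ i) * \<phi> ?q (coord_vec A c i ?q) (\<lambda>c'. \<Sum>j\<in>UNIV. (Y ?q c $ j) *\<^sub>R coord_vec A c j ?q c'))"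
      using tangent_expand_coord[OF Y c q(2)] by simp
    also have "\<dots> = (\<Sum>i\<in>UNIV. (X ?q c $ i) * (\<Sum>j\<in>UNIV. (Y ?q c $ j) * \<phi> ?q (coord_vec A c i ?q) (coord_vec A c j ?q)))"
      by (subst form_sum_right[OF assms(1) q(1)]) (simp_all add: co)
    finally show "?h y = \<phi> ?q (X ?q) (Y ?q)" by (simp add: sum_distrib_left)
  qed
qed

text \<open>Coordinates identify a tangent space with \<open>real ^ 'n\<close>, where linear algebra for bilinear forms is
  available.\<close>

definition coord_tangent :: "('a, 'n) chart \<Rightarrow> 'a \<Rightarrow> real^'n \<Rightarrow> ('a, 'n) tvec" where
  "coord_tangent c p x = (\<lambda>c'. \<Sum>i\<in>UNIV. (x $ i) *\<^sub>R coord_vec A c i p c')"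

lemma coord_tangent_in: "c \<in> A \<Longrightarrow> p \<in> cdom c \<Longrightarrow> coord_tangent c p x \<in> T p"
  unfolding coord_tangent_def by (rule tangent_sum) (simp_all add: coord_vec_tangent)

lemma coord_tangent_self: "c \<in> A \<Longrightarrow> p \<in> cdom c \<Longrightarrow> coord_tangent c p x c = x"
  unfolding coord_tangent_def by (simp add: coord_vec_self basis_expansion_axis[symmetric])

lemma coord_tangent_of: "v \<in> T p \<Longrightarrow> c \<in> A \<Longrightarrow> p \<in> cdom c \<Longrightarrow> coord_tangent c p (v c) = v"
  unfolding coord_tangent_def by (rule tangent_expand_coord[symmetric])

lemma bilinear_coord_form:
  assumes "smooth_sym_form M A \<phi>" "c \<in> A" "p \<in> cdom c"
  shows "bilinear (\<lambda>x y. \<phi> p (coord_tangent c p x) (coord_tangent c p y))"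
proof -
  have p: "p \<in> topspace M" by (rule subsetD[OF cdom_subset[OF assms(2)] assms(3)])
  have ct: "coord_tangent c p x \<in> T p" for x by (rule coord_tangent_in[OF assms(2,3)])
  have lin: "coord_tangent c p (a *\<^sub>R x + y) = (\<lambda>c'. a *\<^sub>R coord_tangent c p x c' + coord_tangent c p y c')" for a x y
    by (rule tangent_eqI[OF ct tangent_lin[OF ct ct] assms(2,3)])
      (simp add: coord_tangent_self[OF assms(2,3)])
  have add: "coord_tangent c p (x + y) = (\<lambda>c'. 1 *\<^sub>R coord_tangent c p x c' + coord_tangent c p y c')" for x y
    using lin[of 1 x y] by simp
  have scale: "coord_tangent c p (a *\<^sub>R x) = (\<lambda>c'. a *\<^sub>R coord_tangent c p x c' + (\<lambda>c. 0) c')" for a x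
    by (rule tangent_eqI[OF ct tangent_lin[OF ct tangent_0] assms(2,3)])
      (simp add: coord_tangent_self[OF assms(2,3)])
  have l: "\<phi> p (coord_tangent c p (x + y)) w = \<phi> p (coord_tangent c p x) w + \<phi> p (coord_tangent c p y) w"
    "\<phi> p w (coord_tangent c p (x + y)) = \<phi> p w (coord_tangent c p x) + \<phi> p w (coord_tangent c p y)"
    "\<phi> p (coord_tangent c p (a *\<^sub>R x)) w = a * \<phi> p (coord_tangent c p x) w"
    "\<phi> p w (coord_tangent c p (a *\<^sub>R x)) = a * \<phi> p w (coord_tangent c p x)" if "w \<in> T p" for x y w a
    unfolding add scale
    by (simp_all only: form_lin_left[OF assms(1) p ct ct that] form_lin_right[OF assms(1) p ct ct that]
        form_lin_left[OF assms(1) p ct tangent_0 that] form_lin_right[OF assms(1) p ct tangent_0 that]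
        form_zero_left[OF assms(1) p that] form_sym[OF assms(1) p that tangent_0])
  show ?thesis
    unfolding bilinear_def by (auto intro!: linearI simp: l[OF ct])
qed

end

locale riemannian_mfd = smooth_mfd M A
  for M :: "'a topology" and A :: "('a, 'n::finite) chart set" +
  fixes g :: "('a, 'n) bform" and D :: "('a, 'n) connection"
  assumes metric: "riemannian_metric M A g" and LC: "levi_civita_connection M A g D"
begin

abbreviation frame where "frame U E \<equiv> orthonormal_frame_on M A g U E"
abbreviation nab where "nab \<equiv> nabla A D"
abbreviation sform where "sform \<equiv> smooth_sym_form M A"

lemma g_form: "sform g"
  using metric unfolding riemannian_metric_def by blast

lemma g_pos: "p \<in> topspace M \<Longrightarrow> u \<in> T p \<Longrightarrow> u \<noteq> (\<lambda>_. 0) \<Longrightarrow> g p u u > 0"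
  using metric unfolding riemannian_metric_def by blast

lemma D_VF: "VF X \<Longrightarrow> VF Y \<Longrightarrow> VF (D X Y)"
  using LC unfolding levi_civita_connection_def affine_connection_def by blast

lemma
  assumes "SF f" "VF X" "VF Y" "VF Z" "p \<in> topspace M"
  shows D_lin_left: "D (\<lambda>q c. f q *\<^sub>R X q c + Y q c) Z p c = f p *\<^sub>R D X Z p c + D Y Z p c"
    and D_lin_right: "D Z (\<lambda>q c. f q *\<^sub>R X q c + Y q c) p c =
      dir_deriv A p (Z p) f *\<^sub>R X p c + f p *\<^sub>R D Z X p c + D Z Y p c"
proof -
  have "affine_connection M A D"
    using LC unfolding levi_civita_connection_def by (rule conjunct1)
  then have *: "\<forall>f X Y Z. SF f \<and> VF X \<and> VF Y \<and> VF Z \<longrightarrow>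
        (\<forall>p\<in>topspace M. \<forall>c.
           D (\<lambda>q c. f q *\<^sub>R X q c + Y q c) Z p c = f p *\<^sub>R D X Z p c + D Y Z p c \<and>
           D Z (\<lambda>q c. f q *\<^sub>R X q c + Y q c) p c =
             dir_deriv A p (Z p) f *\<^sub>R X p c + f p *\<^sub>R D Z X p c + D Z Y p c)"
    unfolding affine_connection_def by (rule conjunct2)
  note ** = *[rule_format, OF conjI[OF assms(1) conjI[OF assms(2) conjI[OF assms(3,4)]]] assms(5)]
  show "D (\<lambda>q c. f q *\<^sub>R X q c + Y q c) Z p c = f p *\<^sub>R D X Z p c + D Y Z p c"
    by (rule conjunct1[OF **])
  show "D Z (\<lambda>q c. f q *\<^sub>R X q c + Y q c) p c =
      dir_deriv A p (Z p) f *\<^sub>R X p c + f p *\<^sub>R D Z X p c + D Z Y p c"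
    by (rule conjunct2[OF **])
qed

lemma torsion_free:
  assumes "VF X" "VF Y" "p \<in> topspace M"
  shows "D X Y p c - D Y X p c = lie_bracket A X Y p c"
proof -
  have "\<forall>X Y. VF X \<and> VF Y \<longrightarrow> (\<forall>p\<in>topspace M. \<forall>c. D X Y p c - D Y X p c = lie_bracket A X Y p c)"
    using LC unfolding levi_civita_connection_def by (elim conjE)
  from this[rule_format, OF conjI[OF assms(1,2)] assms(3)] show ?thesis .
qed

lemma metric_compatible:
  assumes "VF X" "VF Y" "VF Z" "p \<in> topspace M"
  shows "dir_deriv A p (X p) (\<lambda>q. g q (Y q) (Z q)) = g p (D X Y p) (Z p) + g p (Y p) (D X Z p)"
proof -
  have "\<forall>X Y Z. VF X \<and> VF Y \<and> VF Z \<longrightarrow> (\<forall>p\<in>topspace M.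
      dir_deriv A p (X p) (\<lambda>q. g q (Y q) (Z q)) = g p (D X Y p) (Z p) + g p (Y p) (D X Z p))"
    using LC unfolding levi_civita_connection_def by (elim conjE)
  from this[rule_format, OF conjI[OF assms(1) conjI[OF assms(2,3)]] assms(4)] show ?thesis .
qed

lemma D_tangent: "VF X \<Longrightarrow> VF Y \<Longrightarrow> p \<in> topspace M \<Longrightarrow> D X Y p \<in> T p"
  by (rule VF_tangent[OF D_VF])

text \<open>Vector fields that agree near a point agree everywhere after multiplication with a bump
  function, and the Leibniz rules remove the bump function at the point.\<close>

lemma D_local_left:
  assumes "openin M U" "p \<in> U" "\<And>q. q \<in> U \<Longrightarrow> X q = X' q" "VF X" "VF X'" "VF Z"
  shows "D X Z p = D X' Z p"
proof
  fix c
  have p: "p \<in> topspace M" using assms(1,2) openin_subset by blast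
  obtain f K W where f: "SF f" "K \<subseteq> U" "\<And>q. q \<notin> K \<Longrightarrow> f q = 0" "p \<in> W" "\<And>q. q \<in> W \<Longrightarrow> f q = 1"
    by (rule bump_function_exists[OF assms(1,2)]) blast
  have eq: "(\<lambda>q c. f q *\<^sub>R X q c + 0) = (\<lambda>q c. f q *\<^sub>R X' q c + 0)"
  proof (intro ext)
    fix q c
    show "f q *\<^sub>R X q c + 0 = f q *\<^sub>R X' q c + 0"
      using f(2,3) assms(3)[of q] by (cases "q \<in> K") auto
  qed
  have "D (\<lambda>q c. f q *\<^sub>R X q c + 0) Z p c = f p *\<^sub>R D X Z p c + D (\<lambda>q c. 0) Z p c"
    by (rule D_lin_left[OF f(1) assms(4) VF_0 assms(6) p])
  moreover have "D (\<lambda>q c. f q *\<^sub>R X' q c + 0) Z p c = f p *\<^sub>R D X' Z p c + D (\<lambda>q c. 0) Z p c"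
    by (rule D_lin_left[OF f(1) assms(5) VF_0 assms(6) p])
  moreover have "f p = 1" using f(4,5) by blast
  ultimately show "D X Z p c = D X' Z p c" using eq by simp
qed

lemma D_zero_left: "VF Z \<Longrightarrow> p \<in> topspace M \<Longrightarrow> D (\<lambda>q c. 0) Z p c = 0"
  using D_lin_left[OF SF_const VF_0 VF_0, of Z p 1 c] by simp

lemma D_zero_right: "VF Z \<Longrightarrow> p \<in> topspace M \<Longrightarrow> D Z (\<lambda>q c. 0) p c = 0"
  using D_lin_right[OF SF_const VF_0 VF_0, of Z p 1 c] by simp

lemma D_sum_left:
  assumes "VF Z" "p \<in> topspace M" "finite I" "\<And>i. i \<in> I \<Longrightarrow> SF (f i)" "\<And>i. i \<in> I \<Longrightarrow> VF (X i)"
  shows "D (\<lambda>q c. \<Sum>i\<in>I. f i q *\<^sub>R X i q c) Z p c = (\<Sum>i\<in>I. f i p *\<^sub>R D (X i) Z p c)"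
  using assms(3-5)
proof (induction I rule: finite_induct)
  case (insert x F)
  then have "D (\<lambda>q c. f x q *\<^sub>R X x q c + (\<Sum>i\<in>F. f i q *\<^sub>R X i q c)) Z p c
    = f x p *\<^sub>R D (X x) Z p c + D (\<lambda>q c. \<Sum>i\<in>F. f i q *\<^sub>R X i q c) Z p c"
    by (intro D_lin_left VF_sum assms(1,2)) auto
  then show ?case using insert by simp
qed (simp add: D_zero_left[OF assms(1,2)])

lemma D_const_sum_right:
  assumes "VF Z" "p \<in> topspace M" "finite I" "\<And>i. i \<in> I \<Longrightarrow> VF (X i)"
  shows "D Z (\<lambda>q c. \<Sum>i\<in>I. a i *\<^sub>R X i q c) p c = (\<Sum>i\<in>I. a i *\<^sub>R D Z (X i) p c)"
  using assms(3,4)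
proof (induction I rule: finite_induct)
  case (insert x F)
  have "VF (\<lambda>q c. \<Sum>i\<in>F. a i *\<^sub>R X i q c)"
    using VF_sum[of F "\<lambda>i q. a i" X] insert by simp
  from D_lin_right[OF SF_const _ this assms(1,2), of "X x" "a x" c] insert
  have "D Z (\<lambda>q c. a x *\<^sub>R X x q c + (\<Sum>i\<in>F. a i *\<^sub>R X i q c)) p c
    = a x *\<^sub>R D Z (X x) p c + D Z (\<lambda>q c. \<Sum>i\<in>F. a i *\<^sub>R X i q c) p c"
    by (simp add: dir_deriv_const[OF assms(2) VF_tangent[OF assms(1,2)]])
  then show ?case using insert by simp
qed (simp add: D_zero_right[OF assms(1,2)])

subsection \<open>Covariant derivatives of forms\<close>

lemma nabla_sym:
  assumes "sform \<phi>" "VF X" "VF Y" "VF Z" "p \<in> topspace M"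
  shows "nab \<phi> X Y Z p = nab \<phi> X Z Y p"
proof -
  have "dir_deriv A p (X p) (\<lambda>q. \<phi> q (Y q) (Z q)) = dir_deriv A p (X p) (\<lambda>q. \<phi> q (Z q) (Y q))"
    by (rule dir_deriv_cong[OF openin_topspace assms(5)])
      (rule form_sym[OF assms(1) _ VF_tangent[OF assms(3)] VF_tangent[OF assms(4)]])
  moreover have "\<phi> p (D X Y p) (Z p) = \<phi> p (Z p) (D X Y p)" "\<phi> p (Y p) (D X Z p) = \<phi> p (D X Z p) (Y p)"
    by (intro form_sym assms D_tangent VF_tangent)+
  ultimately show ?thesis unfolding nabla_def by linarith
qed

lemma SF_nabla:
  assumes "sform \<phi>" "VF X" "VF Y" "VF Z"
  shows "SF (\<lambda>q. nab \<phi> X Y Z q)"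
  unfolding nabla_def by (intro SF_diff SF_dir_deriv SF_form D_VF assms)

lemma nabla_metric: "VF X \<Longrightarrow> VF Y \<Longrightarrow> VF Z \<Longrightarrow> p \<in> topspace M \<Longrightarrow> nab g X Y Z p = 0"
  unfolding nabla_def using metric_compatible by simp

lemma nabla_local_left:
  assumes "openin M U" "p \<in> U" "\<And>q. q \<in> U \<Longrightarrow> X q = X' q" "VF X" "VF X'" "VF Y" "VF Z"
  shows "nab \<phi> X Y Z p = nab \<phi> X' Y Z p"
  unfolding nabla_def
  using D_local_left[OF assms(1-5,6)] D_local_left[OF assms(1-5,7)] assms(3)[OF assms(2)] by simp

lemma nabla_sum_left:
  assumes "sform \<phi>" "VF Y" "VF Z" "p \<in> topspace M" "finite I"
    "\<And>i. i \<in> I \<Longrightarrow> SF (f i)" "\<And>i. i \<in> I \<Longrightarrow> VF (X i)"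
  shows "nab \<phi> (\<lambda>q c. \<Sum>i\<in>I. f i q *\<^sub>R X i q c) Y Z p = (\<Sum>i\<in>I. f i p * nab \<phi> (X i) Y Z p)"
proof -
  have Y: "Y p \<in> T p" and Z: "Z p \<in> T p" using VF_tangent assms by blast+
  have DY: "D (\<lambda>q c. \<Sum>i\<in>I. f i q *\<^sub>R X i q c) Y p = (\<lambda>c. \<Sum>i\<in>I. f i p *\<^sub>R D (X i) Y p c)"
    and DZ: "D (\<lambda>q c. \<Sum>i\<in>I. f i q *\<^sub>R X i q c) Z p = (\<lambda>c. \<Sum>i\<in>I. f i p *\<^sub>R D (X i) Z p c)"
    by (intro ext D_sum_left assms; assumption)+
  have "dir_deriv A p (\<lambda>c. \<Sum>i\<in>I. f i p *\<^sub>R X i p c) (\<lambda>q. \<phi> q (Y q) (Z q))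
      = (\<Sum>i\<in>I. f i p * dir_deriv A p (X i p) (\<lambda>q. \<phi> q (Y q) (Z q)))"
    by (intro dir_deriv_sum_vec SF_form VF_tangent assms; assumption)
  moreover have "\<phi> p (\<lambda>c. \<Sum>i\<in>I. f i p *\<^sub>R D (X i) Y p c) (Z p) = (\<Sum>i\<in>I. f i p * \<phi> p (D (X i) Y p) (Z p))"
    by (intro form_sum_left D_tangent assms Z; assumption)
  moreover have "\<phi> p (Y p) (\<lambda>c. \<Sum>i\<in>I. f i p *\<^sub>R D (X i) Z p c) = (\<Sum>i\<in>I. f i p * \<phi> p (Y p) (D (X i) Z p))"
    by (intro form_sum_right D_tangent assms Y; assumption)
  ultimately show ?thesis
    unfolding nabla_def DY DZ by (simp add: sum_subtractf right_diff_distrib)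
qed

text \<open>The second covariant derivative \<open>(\<nabla>\<^sup>2\<phi>)(W, X, Y, Z)\<close>, differentiating first in the
  direction of \<open>X\<close>.\<close>

definition nabla2 :: "('a, 'n) bform \<Rightarrow> ('a, 'n) vfield \<Rightarrow> ('a, 'n) vfield \<Rightarrow> ('a, 'n) vfield \<Rightarrow> ('a, 'n) vfield \<Rightarrow> 'a \<Rightarrow> real" where
  "nabla2 \<phi> W X Y Z p = dir_deriv A p (W p) (\<lambda>q. nab \<phi> X Y Z q)
     - nab \<phi> (D W X) Y Z p - nab \<phi> X (D W Y) Z p - nab \<phi> X Y (D W Z) p"

text \<open>The bracket is identified with a combination of covariant derivatives, from which it
  inherits that it is a smooth vector field.\<close>

lemma lie_bracket_eq_connection:
  assumes "VF X" "VF Y" "p \<in> topspace M"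
  shows "lie_bracket A X Y p = (\<lambda>c. (-1) *\<^sub>R D Y X p c + D X Y p c)"
  using torsion_free[OF assms] by (auto simp: fun_eq_iff)

lemma VF_lie_bracket:
  assumes "VF X" "VF Y"
  shows "VF (lie_bracket A X Y)"
proof -
  have B: "VF (\<lambda>q c. (-1) *\<^sub>R D Y X q c + D X Y q c)"
    by (intro VF_lin[of "\<lambda>_. -1"] D_VF assms SF_const)
  show ?thesis
    unfolding vector_field_def
  proof (intro conjI ballI)
    fix p assume p: "p \<in> topspace M"
    show "lie_bracket A X Y p \<in> T p"
      unfolding lie_bracket_eq_connection[OF assms p] by (rule VF_tangent[OF B p])
  next
    fix c assume c: "c \<in> A"
    show "smooth_on (cimg c) (\<lambda>y. lie_bracket A X Y (cinv c y) c)"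
      by (rule smooth_on_cong[OF open_cimg[OF c] VF_chart[OF B c]])
        (simp add: lie_bracket_eq_connection[OF assms cinv_in_topspace[OF c]])
  qed
qed

lemma D_lie_bracket:
  assumes "VF X" "VF Y" "VF Z" "p \<in> topspace M"
  shows "D (lie_bracket A X Y) Z p c = D (D X Y) Z p c - D (D Y X) Z p c"
proof -
  have B: "VF (\<lambda>q c. (-1) *\<^sub>R D Y X q c + D X Y q c)"
    by (intro VF_lin[of "\<lambda>_. -1"] D_VF assms SF_const)
  have "D (lie_bracket A X Y) Z p = D (\<lambda>q c. (-1) *\<^sub>R D Y X q c + D X Y q c) Z p"
    by (rule D_local_left[OF openin_topspace assms(4) lie_bracket_eq_connection[OF assms(1,2)]
          VF_lie_bracket[OF assms(1,2)] B assms(3)])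
  then show ?thesis
    using D_lin_left[OF SF_const D_VF[OF assms(2,1)] D_VF[OF assms(1,2)] assms(3,4), of "-1" c] by simp
qed

lemma curvature_tangent:
  assumes "VF X" "VF Y" "VF Z" "p \<in> topspace M"
  shows "curvature A D X Y Z p \<in> T p"
  unfolding curvature_def by (intro tangent_diff2 D_tangent D_VF VF_lie_bracket assms)

lemma curvature_swap:
  assumes "VF X" "VF Y" "VF Z" "p \<in> topspace M"
  shows "curvature A D Y X Z p = (\<lambda>c. (-1) *\<^sub>R curvature A D X Y Z p c + 0)"
proof
  fix c
  have L: "D (lie_bracket A Y X) Z p c = - D (lie_bracket A X Y) Z p c"
    unfolding D_lie_bracket[OF assms] D_lie_bracket[OF assms(2,1,3,4)] by simp
  show "curvature A D Y X Z p c = (-1) *\<^sub>R curvature A D X Y Z p c + 0"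
    unfolding curvature_def L by simp
qed

text \<open>Expanding both second derivatives, the terms in which \<open>\<nabla>\<phi>\<close> is applied to a derivative of \<open>Z\<close>
  or \<open>W\<close>, and those in which \<open>\<phi>\<close> pairs a derivative of \<open>Z\<close> with one of \<open>W\<close>, are symmetric in \<open>X\<close> and
  \<open>Y\<close>. The rest consists of commutators, in which the bracket \<open>[X, Y]\<close> is replaced by
  \<open>D X Y - D Y X\<close>.\<close>

theorem ricci_identity:
  assumes \<phi>: "sform \<phi>" and X: "VF X" and Y: "VF Y" and Z: "VF Z" and W: "VF W" and p: "p \<in> topspace M"
  shows "nabla2 \<phi> X Y Z W p - nabla2 \<phi> Y X Z W p
    = - \<phi> p (curvature A D X Y Z p) (W p) - \<phi> p (Z p) (curvature A D X Y W p)"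
proof -
  let ?h = "\<lambda>q. \<phi> q (Z q) (W q)"
  let ?d = "\<lambda>X f. dir_deriv A p (X p) f"
  have h: "SF ?h" by (rule SF_form[OF \<phi> Z W])
  have first: "?d X (\<lambda>q. nab \<phi> Y Z W q) = ?d X (\<lambda>q. dir_deriv A q (Y q) ?h)
      - ?d X (\<lambda>q. \<phi> q (D Y Z q) (W q)) - ?d X (\<lambda>q. \<phi> q (Z q) (D Y W q))"
    if "VF X" "VF Y" for X Y
  proof -
    have Xp: "X p \<in> T p" by (rule VF_tangent[OF that(1) p])
    show ?thesis
      unfolding nabla_def
      by (subst dir_deriv_diff, intro SF_diff SF_dir_deriv SF_form D_VF \<phi> Z W that,
          intro SF_form D_VF \<phi> Z W that, rule p, rule Xp,
          subst dir_deriv_diff, intro SF_dir_deriv SF_form D_VF \<phi> Z W that,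
          intro SF_form D_VF \<phi> Z W that, rule p, rule Xp) simp
  qed
  have brk: "?d (lie_bracket A X Y) ?h = ?d (D X Y) ?h - ?d (D Y X) ?h"
    unfolding lie_bracket_eq_connection[OF X Y p]
    using dir_deriv_lin_vec[OF h p D_tangent[OF Y X p] D_tangent[OF X Y p], of "-1"] by simp
  have brk2: "?d (lie_bracket A X Y) ?h = ?d X (\<lambda>q. dir_deriv A q (Y q) ?h) - ?d Y (\<lambda>q. dir_deriv A q (X q) ?h)"
    by (rule dir_deriv_lie_bracket[OF h X Y p])
  have t: "Z p \<in> T p" "W p \<in> T p" by (intro VF_tangent Z W p)+
  have lieD: "\<phi> p (D (lie_bracket A X Y) Z p) w = \<phi> p (D (D X Y) Z p) w - \<phi> p (D (D Y X) Z p) w"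
    if "w \<in> T p" "VF Z" for w Z
  proof -
    have "D (lie_bracket A X Y) Z p = (\<lambda>c. (-1) *\<^sub>R D (D Y X) Z p c + D (D X Y) Z p c)"
      using D_lie_bracket[OF X Y that(2) p] by (simp add: fun_eq_iff)
    then show ?thesis
      using form_lin_left[OF \<phi> p D_tangent[OF D_VF[OF Y X] that(2) p] D_tangent[OF D_VF[OF X Y] that(2) p] that(1), of "-1"]
      by simp
  qed
  have c1: "\<phi> p (curvature A D X Y Z p) (W p)
     = \<phi> p (D X (D Y Z) p) (W p) - \<phi> p (D Y (D X Z) p) (W p) - \<phi> p (D (lie_bracket A X Y) Z p) (W p)"
    unfolding curvature_def
    by (intro form_diff2_left \<phi> p D_tangent D_VF VF_lie_bracket X Y Z t)
  have c2: "\<phi> p (Z p) (curvature A D X Y W p)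
     = \<phi> p (D X (D Y W) p) (Z p) - \<phi> p (D Y (D X W) p) (Z p) - \<phi> p (D (lie_bracket A X Y) W p) (Z p)"
    unfolding form_sym[OF \<phi> p t(1) curvature_tangent[OF X Y W p]] unfolding curvature_def
    by (intro form_diff2_left \<phi> p D_tangent D_VF VF_lie_bracket X Y W t)
  have s: "\<phi> p (Z p) (D V V' p) = \<phi> p (D V V' p) (Z p)" if "VF V" "VF V'" for V V'
    by (intro form_sym \<phi> p t D_tangent that)
  have s': "\<phi> p (D X Z p) (D Y W p) = \<phi> p (D Y W p) (D X Z p)" "\<phi> p (D Y Z p) (D X W p) = \<phi> p (D X W p) (D Y Z p)"
    by (intro form_sym \<phi> p D_tangent X Y Z W)+
  show ?thesis
    unfolding nabla2_def first[OF X Y] first[OF Y X] c1 c2 lieD[OF t(2) Z] lieD[OF t(1) W]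
    unfolding nabla_def
    using brk brk2 s[OF X D_VF[OF Y W]] s[OF Y D_VF[OF X W]] s[OF D_VF[OF X Y] W] s[OF D_VF[OF Y X] W]
    by linarith
qed

text \<open>The Ricci identity for \<open>g\<close> itself, whose derivatives vanish.\<close>

lemma curvature_antisym:
  assumes "VF X" "VF Y" "VF Z" "VF W" "p \<in> topspace M"
  shows "g p (curvature A D X Y Z p) (W p) = - g p (Z p) (curvature A D X Y W p)"
proof -
  have "nabla2 g X Y Z W p = 0" if "VF X" "VF Y" for X Y
  proof -
    have "dir_deriv A p (X p) (\<lambda>q. nab g Y Z W q) = dir_deriv A p (X p) (\<lambda>q. 0)"
      by (rule dir_deriv_cong[OF openin_topspace assms(5)]) (rule nabla_metric[OF that(2) assms(3,4)])
    then have "dir_deriv A p (X p) (\<lambda>q. nab g Y Z W q) = 0"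
      using dir_deriv_const[OF assms(5) VF_tangent[OF that(1) assms(5)]] by simp
    then show ?thesis
      unfolding nabla2_def by (simp add: nabla_metric D_VF that assms)
  qed
  then show ?thesis
    using ricci_identity[OF g_form assms] assms by simp
qed

subsection \<open>Orthonormal frames\<close>

lemma frame_tangent: "frame U E \<Longrightarrow> q \<in> U \<Longrightarrow> E i q \<in> T q"
  unfolding orthonormal_frame_on_def using VF_tangent openin_subset by blast

lemma frame_VF: "frame U E \<Longrightarrow> VF (E i)"
  unfolding orthonormal_frame_on_def by blast

lemma frame_open: "frame U E \<Longrightarrow> openin M U"
  unfolding orthonormal_frame_on_def by blast

lemma frame_topspace: "frame U E \<Longrightarrow> q \<in> U \<Longrightarrow> q \<in> topspace M"
  unfolding orthonormal_frame_on_def using openin_subset by blast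

lemma frame_orthonormal: "frame U E \<Longrightarrow> q \<in> U \<Longrightarrow> g q (E i q) (E j q) = (if i = j then 1 else 0)"
  unfolding orthonormal_frame_on_def by blast

lemma orthonormal_expand:
  fixes e :: "'n \<Rightarrow> ('a, 'n) tvec"
  assumes "q \<in> topspace M" "\<And>i. e i \<in> T q" "\<And>i j. g q (e i) (e j) = (if i = j then 1 else 0)" "v \<in> T q"
  shows "v = (\<lambda>c. \<Sum>i\<in>UNIV. g q v (e i) *\<^sub>R e i c)"
proof -
  obtain c where c: "c \<in> A" "q \<in> cdom c" using chart_around[OF assms(1)] by blast
  let ?B = "\<lambda>x y. g q (coord_tangent c q x) (coord_tangent c q y)"
  have "v c = (\<Sum>i\<in>UNIV. ?B (v c) (e i c) *\<^sub>R e i c)"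
    by (rule bilinear_orthonormal_expansion[of ?B "\<lambda>i. e i c", OF bilinear_coord_form[OF g_form c]])
      (simp add: coord_tangent_of[OF assms(2) c] assms(3))
  then show ?thesis
    by (intro tangent_eqI[OF assms(4) tangent_sum c])
      (simp_all add: assms(2) coord_tangent_of[OF assms(2) c] coord_tangent_of[OF assms(4) c])
qed

lemma frame_expand:
  "frame U E \<Longrightarrow> q \<in> U \<Longrightarrow> v \<in> T q \<Longrightarrow> v = (\<lambda>c. \<Sum>i\<in>UNIV. g q v (E i q) *\<^sub>R E i q c)"
  by (rule orthonormal_expand) (simp_all add: frame_topspace frame_tangent frame_orthonormal)

text \<open>Diagonalise the coordinate expression of \<open>g\<close> with respect to the standard
  inner product and normalise.\<close>

lemma orthonormal_basis_exists:
  assumes "p \<in> topspace M"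
  obtains e :: "'n \<Rightarrow> ('a, 'n) tvec" where "\<And>i. e i \<in> T p" "\<And>i j. g p (e i) (e j) = (if i = j then 1 else 0)"
proof -
  obtain c where c: "c \<in> A" "p \<in> cdom c" using chart_around[OF assms(1)] by blast
  let ?t = "coord_tangent c p"
  let ?B = "\<lambda>x y. g p (?t x) (?t y)"
  have B: "bilinear ?B" by (rule bilinear_coord_form[OF g_form c])
  have ct: "?t x \<in> T p" for x by (rule coord_tangent_in[OF c])
  have sym: "?B x y = ?B y x" for x y by (rule form_sym[OF g_form assms ct ct])
  obtain b :: "'n \<Rightarrow> real^'n" where b: "\<And>i j. b i \<bullet> b j = (if i = j then 1 else 0)" "\<And>i j. i \<noteq> j \<Longrightarrow> ?B (b i) (b j) = 0"
    using symmetric_bilinear_eigenbasis[of ?B, OF B sym] by blast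
  have pos: "?B (b i) (b i) > 0" for i
  proof (rule g_pos[OF assms ct])
    have "b i \<noteq> 0" using b(1)[of i i] by auto
    then show "?t (b i) \<noteq> (\<lambda>_. 0)" using coord_tangent_self[OF c, of "b i"] by auto
  qed
  let ?e = "\<lambda>i. (1 / sqrt (?B (b i) (b i))) *\<^sub>R b i"
  show ?thesis
  proof
    show "?t (?e i) \<in> T p" for i by (rule ct)
    show "g p (?t (?e i)) (?t (?e j)) = (if i = j then 1 else 0)" for i j
      using bilinear_lmul[OF B, of "1 / sqrt (?B (b i) (b i))" "b i" "?e j"]
        bilinear_rmul[OF B, of "b i" "1 / sqrt (?B (b j) (b j))" "b j"] b(2)[of i j] pos[of i]
      by (auto simp: real_sqrt_mult_self field_simps)
  qed
qed

text \<open>Gram--Schmidt, started from fields extending an orthonormal basis at \<open>p\<close>: the vectors that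
  get normalised then have length \<open>1\<close> at \<open>p\<close>, so their length stays positive nearby.\<close>

lemma frame_exists:
  assumes p: "p \<in> topspace M"
  obtains U E where "frame U E" "p \<in> U"
proof -
  obtain e :: "'n \<Rightarrow> ('a, 'n) tvec" where e: "\<And>i. e i \<in> T p" "\<And>i j. g p (e i) (e j) = (if i = j then 1 else 0)"
    using orthonormal_basis_exists[OF p] by blast
  have "\<exists>X. VF X \<and> X p = e i" for i using tangent_extension[OF e(1) p] by metis
  then obtain X where X: "\<And>i. VF (X i)" "\<And>i. X i p = e i" by metis
  have "\<exists>U E. openin M U \<and> p \<in> U \<and> (\<forall>i. VF (E i)) \<and> (\<forall>i\<in>I. E i p = e i) \<and>
      (\<forall>q\<in>U. \<forall>i\<in>I. \<forall>j\<in>I. g q (E i q) (E j q) = (if i = j then 1 else 0))" for I :: "'n set"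
    using finite[of I]
  proof (induction I rule: finite_induct)
    case empty
    then show ?case
      by (intro exI[of _ "topspace M"] exI[of _ X]) (simp add: p X)
  next
    case (insert a I)
    then obtain U E where U: "openin M U" "p \<in> U" and E: "\<And>i. VF (E i)"
      and Ep: "\<And>i. i \<in> I \<Longrightarrow> E i p = e i"
      and on: "\<And>q i j. q \<in> U \<Longrightarrow> i \<in> I \<Longrightarrow> j \<in> I \<Longrightarrow> g q (E i q) (E j q) = (if i = j then 1 else 0)"
      by blast
    define S where "S = (\<lambda>q c. \<Sum>i\<in>I. g q (X a q) (E i q) *\<^sub>R E i q c)"
    define V where "V = (\<lambda>q c. (-1) *\<^sub>R S q c + X a q c)"
    have S: "VF S" unfolding S_def by (intro VF_sum insert SF_form g_form X E)
    have V: "VF V" unfolding V_def by (intro VF_lin[of "\<lambda>_. -1"] S X SF_const)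
    let ?f = "\<lambda>q. g q (V q) (V q)"
    have f: "SF ?f" by (rule SF_form[OF g_form V V])
    have Vp: "V p = e a"
    proof
      fix c
      have "S p c = 0" unfolding S_def by (rule sum.neutral) (use insert(2) in \<open>auto simp: X Ep e\<close>)
      then show "V p c = e a c" by (simp add: V_def X)
    qed
    have "?f p = 1" unfolding Vp by (simp add: e)
    then have "?f p > 0" by simp
    then obtain r W where r: "SF r" "openin M W" "p \<in> W"
      and rW: "\<And>q. q \<in> W \<Longrightarrow> ?f q > 0 \<and> r q = 1 / sqrt (?f q)"
      by (rule inverse_sqrt_extension[OF f p]) blast
    let ?E = "E(a := \<lambda>q c. r q *\<^sub>R V q c)"
    have Ea: "VF (\<lambda>q c. r q *\<^sub>R V q c)" by (rule VF_scale[OF r(1) V])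
    have VFE: "VF (?E i)" for i using E Ea by simp
    have Eap: "r p *\<^sub>R V p c = e a c" for c
    proof -
      have "r p = 1" using rW[OF r(3)] \<open>?f p = 1\<close> by simp
      then show ?thesis using fun_cong[OF Vp, of c] by simp
    qed
    have scale: "g q (\<lambda>c. s *\<^sub>R v c) w = s * g q v w" if "q \<in> topspace M" "v \<in> T q" "w \<in> T q" for q s v w
      using form_lin_left[OF g_form that(1,2) tangent_0 that(3), of s] form_zero_left[OF g_form that(1,3)] by simp
    have orth: "g q (V q) (E j q) = 0" if q: "q \<in> U" and j: "j \<in> I" for q j
    proof -
      have qM: "q \<in> topspace M" using q U openin_subset by blast
      have t: "E i q \<in> T q" "X a q \<in> T q" "S q \<in> T q" for i by (intro VF_tangent E X S qM)+
      have "g q (V q) (E j q) = - g q (S q) (E j q) + g q (X a q) (E j q)"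
        unfolding V_def using form_lin_left[OF g_form qM t(3) t(2) t(1)[of j], of "-1"] by simp
      also have "g q (S q) (E j q) = (\<Sum>i\<in>I. g q (X a q) (E i q) * g q (E i q) (E j q))"
        unfolding S_def by (intro form_sum_left g_form qM t insert)
      also have "\<dots> = (\<Sum>i\<in>I. if i = j then g q (X a q) (E i q) else 0)"
        by (rule sum.cong) (auto simp: on[OF q _ j])
      also have "\<dots> = g q (X a q) (E j q)" using j insert(1) by simp
      finally show ?thesis by simp
    qed
    have "g q (?E i q) (?E j q) = (if i = j then 1 else 0)"
      if q: "q \<in> U \<inter> W" and i: "i \<in> insert a I" and j: "j \<in> insert a I" for q i j
    proof -
      have qM: "q \<in> topspace M" using q U openin_subset by blast
      have t: "E i q \<in> T q" "V q \<in> T q" for i by (rule VF_tangent[OF E qM], rule VF_tangent[OF V qM])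
      have tr: "(\<lambda>c. r q *\<^sub>R V q c) \<in> T q" by (rule tangent_scale[OF t(2)])
      have aj: "g q (\<lambda>c. r q *\<^sub>R V q c) (E j q) = 0" if "j \<in> I" for j
        using scale[OF qM t(2) t(1), of "r q" j] orth[OF _ that, of q] q by simp
      have ja: "g q (E j q) (\<lambda>c. r q *\<^sub>R V q c) = 0" if "j \<in> I" for j
        using form_sym[OF g_form qM t(1) tr] aj[OF that] by simp
      have aa: "g q (\<lambda>c. r q *\<^sub>R V q c) (\<lambda>c. r q *\<^sub>R V q c) = 1"
      proof -
        have "g q (\<lambda>c. r q *\<^sub>R V q c) (\<lambda>c. r q *\<^sub>R V q c) = r q * g q (V q) (\<lambda>c. r q *\<^sub>R V q c)"
          by (rule scale[OF qM t(2) tr])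
        also have "g q (V q) (\<lambda>c. r q *\<^sub>R V q c) = r q * ?f q"
          using form_sym[OF g_form qM t(2) tr] scale[OF qM t(2) t(2), of "r q"] by simp
        also have "r q * (r q * ?f q) = 1"
          using rW[of q] q by (simp add: field_simps)
        finally show ?thesis .
      qed
      consider "i = a" "j = a" | "i = a" "j \<in> I" "j \<noteq> a" | "i \<in> I" "i \<noteq> a" "j = a"
        | "i \<in> I" "i \<noteq> a" "j \<in> I" "j \<noteq> a" using i j by blast
      then show ?thesis
      proof cases
        case 1
        then show ?thesis using aa by (simp only: fun_upd_same if_True refl)
      next
        case 2
        then show ?thesis using aj[of j] by (simp only: fun_upd_same fun_upd_other) simp
      next
        case 3
        then show ?thesis using ja[of i] by (simp only: fun_upd_same fun_upd_other) simp
      next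
        case 4
        then show ?thesis using on[of q i j] q by simp
      qed
    qed
    moreover have "?E i p = e i" if "i \<in> insert a I" for i
      using that Eap Ep by (cases "i = a") auto
    moreover have "openin M (U \<inter> W)" "p \<in> U \<inter> W" using U r by auto
    ultimately show ?case using VFE by (intro exI[of _ "U \<inter> W"] exI[of _ ?E]) blast
  qed
  from this[of UNIV] obtain U and E :: "'n \<Rightarrow> ('a, 'n) vfield" where "openin M U" "p \<in> U" "\<forall>i. VF (E i)"
    "\<forall>q\<in>U. \<forall>i\<in>UNIV. \<forall>j\<in>UNIV. g q (E i q) (E j q) = (if i = j then 1 else 0)"
    by (elim exE conjE)
  then have "frame U E" unfolding orthonormal_frame_on_def by simp
  then show ?thesis using \<open>p \<in> U\<close> by (rule that)
qed

end

section \<open>The Bochner formula for harmonic forms\<close>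

lemma antisym_sym_sum_zero:
  fixes w s :: "'n::finite \<Rightarrow> 'n \<Rightarrow> real"
  assumes "\<And>i k. w i k = - w k i" "\<And>i k. s i k = s k i"
  shows "(\<Sum>i\<in>UNIV. \<Sum>k\<in>UNIV. w i k * s i k) = 0"
proof -
  have "(\<Sum>i\<in>UNIV. \<Sum>k\<in>UNIV. w i k * s i k) = (\<Sum>k\<in>UNIV. \<Sum>i\<in>UNIV. w i k * s i k)"
    by (rule sum.swap)
  also have "\<dots> = (\<Sum>k\<in>UNIV. \<Sum>i\<in>UNIV. - (w k i * s k i))"
  proof (intro sum.cong refl)
    fix k i
    show "w i k * s i k = - (w k i * s k i)" using assms(1)[of i k] assms(2)[of i k] by simp
  qed
  also have "\<dots> = - (\<Sum>k\<in>UNIV. \<Sum>i\<in>UNIV. w k i * s k i)" by (simp add: sum_negf)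
  finally show ?thesis by simp
qed

text \<open>An infinitesimal rotation acting on both indices preserves the inner product of two matrices.\<close>

lemma infinitesimal_rotation_cancel:
  fixes w P Q :: "'n::finite \<Rightarrow> 'n \<Rightarrow> real"
  assumes w: "\<And>i k. w i k = - w k i"
  shows "(\<Sum>i\<in>UNIV. \<Sum>j\<in>UNIV. P i j * ((\<Sum>k\<in>UNIV. w i k * Q k j) + (\<Sum>k\<in>UNIV. w j k * Q i k))
      + ((\<Sum>k\<in>UNIV. w i k * P k j) + (\<Sum>k\<in>UNIV. w j k * P i k)) * Q i j) = 0"
proof -
  have v: "(\<Sum>i\<in>UNIV. \<Sum>k\<in>UNIV. w i k * (p i * q k + q i * p k)) = 0" for p q :: "'n \<Rightarrow> real"
    by (rule antisym_sym_sum_zero[OF w]) simp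
  have "(\<Sum>i\<in>UNIV. \<Sum>j\<in>UNIV. \<Sum>k\<in>UNIV. w i k * (P i j * Q k j + Q i j * P k j))
    = (\<Sum>j\<in>UNIV. \<Sum>i\<in>UNIV. \<Sum>k\<in>UNIV. w i k * (P i j * Q k j + Q i j * P k j))"
    by (rule sum.swap)
  also have "\<dots> = 0" by (simp only: v) simp
  finally have 1: "(\<Sum>i\<in>UNIV. \<Sum>j\<in>UNIV. \<Sum>k\<in>UNIV. w i k * (P i j * Q k j + Q i j * P k j)) = 0" .
  have 2: "(\<Sum>i\<in>UNIV. \<Sum>j\<in>UNIV. \<Sum>k\<in>UNIV. w j k * (P i j * Q i k + Q i j * P i k)) = 0"
    by (simp only: v) simp
  have "(\<Sum>i\<in>UNIV. \<Sum>j\<in>UNIV. P i j * ((\<Sum>k\<in>UNIV. w i k * Q k j) + (\<Sum>k\<in>UNIV. w j k * Q i k))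
      + ((\<Sum>k\<in>UNIV. w i k * P k j) + (\<Sum>k\<in>UNIV. w j k * P i k)) * Q i j)
    = (\<Sum>i\<in>UNIV. \<Sum>j\<in>UNIV. (\<Sum>k\<in>UNIV. w i k * (P i j * Q k j + Q i j * P k j))
        + (\<Sum>k\<in>UNIV. w j k * (P i j * Q i k + Q i j * P i k)))"
    by (simp add: sum_distrib_left sum_distrib_right sum.distrib distrib_left distrib_right mult_ac add_ac)
  also have "\<dots> = 0" by (simp only: sum.distrib 1 2)
  finally show ?thesis .
qed

text \<open>Averaging the sum with the one in which \<open>k\<close> and \<open>j\<close> are
  exchanged completes the square.\<close>

lemma symmetrized_difference_sum:
  fixes K :: "'n::finite \<Rightarrow> 'n \<Rightarrow> real"
  assumes "\<And>k j. K k j = K j k"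
  shows "2 * (\<Sum>k\<in>UNIV. \<Sum>j\<in>UNIV. l j * ((l j - l k) * K k j)) = (\<Sum>k\<in>UNIV. \<Sum>j\<in>UNIV. K k j * (l j - l k)\<^sup>2)"
proof -
  have "(\<Sum>k\<in>UNIV. \<Sum>j\<in>UNIV. l j * ((l j - l k) * K k j)) = (\<Sum>j\<in>UNIV. \<Sum>k\<in>UNIV. l j * ((l j - l k) * K k j))"
    by (rule sum.swap)
  also have "\<dots> = (\<Sum>k\<in>UNIV. \<Sum>j\<in>UNIV. l k * ((l k - l j) * K k j))"
    by (intro sum.cong refl) (use assms in simp)
  finally have "2 * (\<Sum>k\<in>UNIV. \<Sum>j\<in>UNIV. l j * ((l j - l k) * K k j))
    = (\<Sum>k\<in>UNIV. \<Sum>j\<in>UNIV. l j * ((l j - l k) * K k j)) + (\<Sum>k\<in>UNIV. \<Sum>j\<in>UNIV. l k * ((l k - l j) * K k j))"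
    by simp
  also have "\<dots> = (\<Sum>k\<in>UNIV. \<Sum>j\<in>UNIV. l j * ((l j - l k) * K k j) + l k * ((l k - l j) * K k j))"
    by (simp only: sum.distrib)
  also have "\<dots> = (\<Sum>k\<in>UNIV. \<Sum>j\<in>UNIV. K k j * (l j - l k)\<^sup>2)"
    by (intro sum.cong refl) (simp add: power2_eq_square algebra_simps)
  finally show ?thesis .
qed

context riemannian_mfd
begin

text \<open>The inner products of the frame fields are constant near \<open>q\<close>.\<close>

lemma frame_connection_antisym:
  assumes "frame U E" "q \<in> U" "VF W"
  shows "g q (D W (E i) q) (E k q) = - g q (D W (E k) q) (E i q)"
proof -
  have q: "q \<in> topspace M" by (rule frame_topspace[OF assms(1,2)])
  have "dir_deriv A q (W q) (\<lambda>r. g r (E i r) (E k r)) = dir_deriv A q (W q) (\<lambda>r. if i = k then 1 else 0)"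
    by (rule dir_deriv_cong[OF frame_open[OF assms(1)] assms(2)]) (rule frame_orthonormal[OF assms(1)])
  then have "g q (D W (E i) q) (E k q) + g q (E i q) (D W (E k) q) = 0"
    using metric_compatible[OF assms(3) frame_VF[OF assms(1)] frame_VF[OF assms(1)] q]
      dir_deriv_const[OF q VF_tangent[OF assms(3) q]] by simp
  then show ?thesis
    using form_sym[OF g_form q frame_tangent[OF assms(1,2)] D_tangent[OF assms(3) frame_VF[OF assms(1)] q]] by simp
qed

text \<open>Near \<open>q\<close> the field \<open>X\<close> agrees with a combination of the
  frame with smooth coefficients, and \<open>\<nabla>\<phi>\<close> is local and linear over
  functions in this slot.\<close>

lemma nabla_frame_expand:
  assumes "sform \<phi>" "frame U E" "q \<in> U" "VF X" "VF Y" "VF Z"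
  shows "nab \<phi> X Y Z q = (\<Sum>k\<in>UNIV. g q (X q) (E k q) * nab \<phi> (E k) Y Z q)"
proof -
  let ?a = "\<lambda>k r. g r (X r) (E k r)"
  let ?X = "\<lambda>r c. \<Sum>k\<in>UNIV. ?a k r *\<^sub>R E k r c"
  have X': "VF ?X" by (intro VF_sum SF_form g_form assms(4) frame_VF[OF assms(2)]) simp
  have "nab \<phi> X Y Z q = nab \<phi> ?X Y Z q"
    by (rule nabla_local_left[OF frame_open[OF assms(2)] assms(3) _ assms(4) X' assms(5,6)])
      (rule frame_expand[OF assms(2) _ VF_tangent[OF assms(4)]], assumption, rule frame_topspace[OF assms(2)])
  also have "\<dots> = (\<Sum>k\<in>UNIV. ?a k q * nab \<phi> (E k) Y Z q)"
    by (intro nabla_sum_left SF_form g_form assms frame_VF[OF assms(2)] frame_topspace[OF assms(2,3)]) simp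
  finally show ?thesis .
qed

lemma form_frame_expand:
  assumes "sform \<phi>" "frame U E" "q \<in> U" "v \<in> T q" "w \<in> T q"
  shows "\<phi> q v w = (\<Sum>k\<in>UNIV. g q v (E k q) * \<phi> q (E k q) w)"
proof -
  have "\<phi> q v w = \<phi> q (\<lambda>c. \<Sum>k\<in>UNIV. g q v (E k q) *\<^sub>R E k q c) w"
    using frame_expand[OF assms(2,3,4)] by simp
  also have "\<dots> = (\<Sum>k\<in>UNIV. g q v (E k q) * \<phi> q (E k q) w)"
    by (intro form_sum_left assms frame_tangent[OF assms(2,3)] frame_topspace[OF assms(2,3)]) simp
  finally show ?thesis .
qed

lemma form_frame_deriv:
  assumes "sform \<phi>" "frame U E" "q \<in> U" "VF W"
  shows "dir_deriv A q (W q) (\<lambda>r. \<phi> r (E i r) (E j r)) = nab \<phi> W (E i) (E j) q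
    + ((\<Sum>k\<in>UNIV. g q (D W (E i) q) (E k q) * \<phi> q (E k q) (E j q))
     + (\<Sum>k\<in>UNIV. g q (D W (E j) q) (E k q) * \<phi> q (E i q) (E k q)))"
proof -
  have q: "q \<in> topspace M" by (rule frame_topspace[OF assms(2,3)])
  note Et = frame_tangent[OF assms(2,3)]
  have Dt: "D W (E i) q \<in> T q" for i by (rule D_tangent[OF assms(4) frame_VF[OF assms(2)] q])
  have "\<phi> q (D W (E i) q) (E j q) = (\<Sum>k\<in>UNIV. g q (D W (E i) q) (E k q) * \<phi> q (E k q) (E j q))"
    by (rule form_frame_expand[OF assms(1-3) Dt Et])
  moreover have "\<phi> q (E i q) (D W (E j) q) = (\<Sum>k\<in>UNIV. g q (D W (E j) q) (E k q) * \<phi> q (E i q) (E k q))"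
    unfolding form_sym[OF assms(1) q Et Dt] form_sym[OF assms(1) q Et[of i] Et]
    by (rule form_frame_expand[OF assms(1-3) Dt Et])
  ultimately show ?thesis unfolding nabla_def by linarith
qed

text \<open>The trace of the Hessian of \<open>f\<close>, that is the Laplacian of \<open>f\<close>, when \<open>E\<close> is orthonormal near
  \<open>q\<close>.\<close>

definition frame_laplacian :: "('n \<Rightarrow> ('a, 'n) vfield) \<Rightarrow> ('a \<Rightarrow> real) \<Rightarrow> 'a \<Rightarrow> real" where
  "frame_laplacian E f q = (\<Sum>k\<in>UNIV. dir_deriv A q (E k q) (\<lambda>r. dir_deriv A r (E k r) f)
     - dir_deriv A q (D (E k) (E k) q) f)"

definition sqnorm :: "('a, 'n) bform \<Rightarrow> ('n \<Rightarrow> ('a, 'n) vfield) \<Rightarrow> 'a \<Rightarrow> real" where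
  "sqnorm \<phi> E q = (\<Sum>i\<in>UNIV. \<Sum>j\<in>UNIV. \<phi> q (E i q) (E j q) * \<phi> q (E i q) (E j q))"

lemma SF_sqnorm: "sform \<phi> \<Longrightarrow> frame U E \<Longrightarrow> SF (sqnorm \<phi> E)"
  unfolding sqnorm_def by (intro SF_sum SF_mult SF_form frame_VF)

text \<open>Expanding one factor in the other frame, the sum over \<open>j\<close> becomes an
  expansion back in the frame \<open>E'\<close>.\<close>

lemma sum_squares_frame_independent:
  assumes "sform \<phi>" "frame U E" "frame U' E'" "q \<in> U" "q \<in> U'" "u \<in> T q"
  shows "(\<Sum>j\<in>UNIV. \<phi> q u (E' j q) * \<phi> q u (E' j q)) = (\<Sum>j\<in>UNIV. \<phi> q u (E j q) * \<phi> q u (E j q))"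
proof -
  have q: "q \<in> topspace M" by (rule frame_topspace[OF assms(2,4)])
  note Et = frame_tangent[OF assms(2,4)] and Et' = frame_tangent[OF assms(3,5)]
  have ex: "\<phi> q u (E' j q) = (\<Sum>k\<in>UNIV. g q (E' j q) (E k q) * \<phi> q u (E k q))" for j
    unfolding form_sym[OF assms(1) q assms(6) Et'] form_sym[OF assms(1) q assms(6) Et]
    by (rule form_frame_expand[OF assms(1,2,4) Et' assms(6)])
  have ex': "\<phi> q u (E k q) = (\<Sum>j\<in>UNIV. g q (E' j q) (E k q) * \<phi> q u (E' j q))" for k
    unfolding form_sym[OF assms(1) q assms(6) Et'] form_sym[OF assms(1) q assms(6) Et] form_sym[OF g_form q Et' Et]
    by (rule form_frame_expand[OF assms(1,3,5) Et assms(6)])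
  have "(\<Sum>j\<in>UNIV. \<phi> q u (E' j q) * \<phi> q u (E' j q))
    = (\<Sum>j\<in>UNIV. \<Sum>k\<in>UNIV. g q (E' j q) (E k q) * \<phi> q u (E k q) * \<phi> q u (E' j q))"
    by (subst (1) ex) (simp add: sum_distrib_right)
  also have "\<dots> = (\<Sum>k\<in>UNIV. \<Sum>j\<in>UNIV. g q (E' j q) (E k q) * \<phi> q u (E k q) * \<phi> q u (E' j q))"
    by (rule sum.swap)
  also have "\<dots> = (\<Sum>k\<in>UNIV. \<phi> q u (E k q) * (\<Sum>j\<in>UNIV. g q (E' j q) (E k q) * \<phi> q u (E' j q)))"
    by (simp add: sum_distrib_left mult_ac)
  also have "\<dots> = (\<Sum>k\<in>UNIV. \<phi> q u (E k q) * \<phi> q u (E k q))"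
    by (simp only: ex'[symmetric])
  finally show ?thesis .
qed

lemma sqnorm_frame_independent:
  assumes "sform \<phi>" "frame U E" "frame U' E'" "q \<in> U" "q \<in> U'"
  shows "sqnorm \<phi> E' q = sqnorm \<phi> E q"
proof -
  have q: "q \<in> topspace M" by (rule frame_topspace[OF assms(2,4)])
  note Et = frame_tangent[OF assms(2,4)] and Et' = frame_tangent[OF assms(3,5)]
  have "sqnorm \<phi> E' q = (\<Sum>i\<in>UNIV. \<Sum>j\<in>UNIV. \<phi> q (E' i q) (E j q) * \<phi> q (E' i q) (E j q))"
    unfolding sqnorm_def by (intro sum.cong refl sum_squares_frame_independent[OF assms] Et')
  also have "\<dots> = (\<Sum>j\<in>UNIV. \<Sum>i\<in>UNIV. \<phi> q (E' i q) (E j q) * \<phi> q (E' i q) (E j q))"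
    by (rule sum.swap)
  also have "\<dots> = (\<Sum>j\<in>UNIV. \<Sum>i\<in>UNIV. \<phi> q (E j q) (E' i q) * \<phi> q (E j q) (E' i q))"
    by (intro sum.cong refl) (simp only: form_sym[OF assms(1) q Et Et'])
  also have "\<dots> = (\<Sum>j\<in>UNIV. \<Sum>i\<in>UNIV. \<phi> q (E j q) (E i q) * \<phi> q (E j q) (E i q))"
    by (intro sum.cong refl sum_squares_frame_independent[OF assms] Et)
  finally show ?thesis unfolding sqnorm_def .
qed

lemma sqnorm_zero_imp_form_zero:
  assumes "sform \<phi>" "frame U E" "q \<in> U" "sqnorm \<phi> E q = 0" "u \<in> T q" "v \<in> T q"
  shows "\<phi> q u v = 0"
proof -
  have "\<phi> q (E i q) (E j q) * \<phi> q (E i q) (E j q) = 0" for i j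
  proof -
    have "(\<Sum>j\<in>UNIV. \<phi> q (E i q) (E j q) * \<phi> q (E i q) (E j q)) = 0"
      using assms(4) unfolding sqnorm_def
      by (subst (asm) sum_nonneg_eq_0_iff) (auto intro: sum_nonneg)
    then show ?thesis by (subst (asm) sum_nonneg_eq_0_iff) auto
  qed
  then have E0: "\<phi> q (E i q) (E j q) = 0" for i j by simp
  have "\<phi> q v (E i q) = 0" for i
    unfolding form_frame_expand[OF assms(1-3,6) frame_tangent[OF assms(2,3)]] by (simp add: E0)
  then have "\<phi> q (E i q) v = 0" for i
    using form_sym[OF assms(1) frame_topspace[OF assms(2,3)] frame_tangent[OF assms(2,3)] assms(6)] by simp
  then show ?thesis
    unfolding form_frame_expand[OF assms(1-3,5,6)] by simp
qed

subsection \<open>Rotating a frame\<close>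

definition rotate_frame :: "('n \<Rightarrow> real^'n) \<Rightarrow> ('n \<Rightarrow> ('a, 'n) vfield) \<Rightarrow> 'n \<Rightarrow> ('a, 'n) vfield" where
  "rotate_frame b E k = (\<lambda>q c. \<Sum>j\<in>UNIV. (b k $ j) *\<^sub>R E j q c)"

lemma VF_rotate: "frame U E \<Longrightarrow> VF (rotate_frame b E k)"
  unfolding rotate_frame_def by (rule VF_sum[of UNIV "\<lambda>j q. b k $ j"]) (simp_all add: frame_VF)

lemma form_rotate:
  assumes "sform \<phi>" "frame U E" "q \<in> U"
  shows "\<phi> q (rotate_frame b E k q) (rotate_frame b E l q) = (\<Sum>i\<in>UNIV. \<Sum>j\<in>UNIV. (b k $ i) * (b l $ j) * \<phi> q (E i q) (E j q))"
proof -
  have q: "q \<in> topspace M" by (rule frame_topspace[OF assms(2,3)])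
  note Et = frame_tangent[OF assms(2,3)]
  have Rt: "rotate_frame b E l q \<in> T q" by (rule VF_tangent[OF VF_rotate[OF assms(2)] q])
  have "\<phi> q (rotate_frame b E k q) (rotate_frame b E l q) = (\<Sum>i\<in>UNIV. (b k $ i) * \<phi> q (E i q) (rotate_frame b E l q))"
    unfolding rotate_frame_def[of b E k] by (intro form_sum_left assms q Rt Et) simp
  also have "\<dots> = (\<Sum>i\<in>UNIV. (b k $ i) * (\<Sum>j\<in>UNIV. (b l $ j) * \<phi> q (E i q) (E j q)))"
    unfolding rotate_frame_def[of b E l] by (intro sum.cong refl arg_cong2[of _ _ _ _ "(*)"] form_sum_right assms q Et) simp
  finally show ?thesis by (simp add: sum_distrib_left mult.assoc)
qed

lemma frame_rotate:
  assumes "frame U E" and b: "\<And>i j. b i \<bullet> b j = (if i = j then 1 else 0)"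
  shows "frame U (rotate_frame b E)"
  unfolding orthonormal_frame_on_def
proof (intro conjI allI ballI)
  show "openin M U" by (rule frame_open[OF assms(1)])
  show "VF (rotate_frame b E i)" for i by (rule VF_rotate[OF assms(1)])
  fix q i j assume q: "q \<in> U"
  have "g q (rotate_frame b E i q) (rotate_frame b E j q) = b i \<bullet> b j"
    unfolding form_rotate[OF g_form assms(1) q] frame_orthonormal[OF assms(1) q]
    by (simp add: inner_vec_def if_distrib[of "\<lambda>x. _ * x"] cong: if_cong)
  then show "g q (rotate_frame b E i q) (rotate_frame b E j q) = (if i = j then 1 else 0)" using b by simp
qed

text \<open>The coefficients are constant, so both terms of the Laplacian transform like a
  bilinear form, whose trace does not depend on the orthonormal basis.\<close>

lemma frame_laplacian_rotate:
  assumes E: "frame U E" and b: "\<And>i j. b i \<bullet> b j = (if i = j then 1 else 0)" and q: "q \<in> U" and f: "SF f"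
  shows "frame_laplacian (rotate_frame b E) f q = frame_laplacian E f q"
proof -
  have qM: "q \<in> topspace M" by (rule frame_topspace[OF E q])
  have V: "VF (E i)" for i by (rule frame_VF[OF E])
  have t: "E i r \<in> T r" if "r \<in> topspace M" for i r by (rule VF_tangent[OF V that])
  let ?h = "\<lambda>j r. dir_deriv A r (E j r) f"
  have h: "SF (?h j)" for j by (rule SF_dir_deriv[OF f V])
  let ?H = "\<lambda>j l. dir_deriv A q (E l q) (?h j)"
  let ?C = "\<lambda>j l. dir_deriv A q (D (E j) (E l) q) f"
  have rot: "dir_deriv A r (rotate_frame b E k r) u = (\<Sum>j\<in>UNIV. (b k $ j) * dir_deriv A r (E j r) u)"
    if "r \<in> topspace M" "SF u" for k r u
    unfolding rotate_frame_def by (intro dir_deriv_sum_vec that t) simp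
  have first: "dir_deriv A q (rotate_frame b E k q) (\<lambda>r. dir_deriv A r (rotate_frame b E k r) f)
     = (\<Sum>l\<in>UNIV. \<Sum>j\<in>UNIV. (b k $ l) * (b k $ j) * ?H j l)" for k
  proof -
    have "dir_deriv A q (rotate_frame b E k q) (\<lambda>r. dir_deriv A r (rotate_frame b E k r) f)
      = dir_deriv A q (rotate_frame b E k q) (\<lambda>r. \<Sum>j\<in>UNIV. (b k $ j) * ?h j r)"
      by (rule dir_deriv_cong[OF openin_topspace qM]) (rule rot[OF _ f])
    also have "\<dots> = (\<Sum>l\<in>UNIV. (b k $ l) * dir_deriv A q (E l q) (\<lambda>r. \<Sum>j\<in>UNIV. (b k $ j) * ?h j r))"
      by (intro rot qM SF_sum SF_mult SF_const h)
    also have "\<dots> = (\<Sum>l\<in>UNIV. (b k $ l) * (\<Sum>j\<in>UNIV. (b k $ j) * ?H j l))"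
      by (simp add: dir_deriv_sum[OF _ _ qM t[OF qM]] dir_deriv_cmult[OF h qM t[OF qM]] SF_mult h)
    finally show ?thesis by (simp add: sum_distrib_left mult.assoc)
  qed
  have second: "dir_deriv A q (D (rotate_frame b E k) (rotate_frame b E k) q) f
     = (\<Sum>j\<in>UNIV. \<Sum>l\<in>UNIV. (b k $ j) * (b k $ l) * ?C j l)" for k
  proof -
    have Dt: "D X Y q \<in> T q" if "VF X" "VF Y" for X Y by (rule D_tangent[OF that qM])
    have "D (rotate_frame b E k) (rotate_frame b E k) q = (\<lambda>c. \<Sum>j\<in>UNIV. (b k $ j) *\<^sub>R D (E j) (rotate_frame b E k) q c)"
      unfolding rotate_frame_def[of b E k]
      using D_sum_left[OF VF_rotate[OF E, of b k, unfolded rotate_frame_def] qM, of UNIV "\<lambda>j q. b k $ j" E] V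
      by (simp add: fun_eq_iff)
    then have "dir_deriv A q (D (rotate_frame b E k) (rotate_frame b E k) q) f
      = (\<Sum>j\<in>UNIV. (b k $ j) * dir_deriv A q (D (E j) (rotate_frame b E k) q) f)"
      by (simp only:) (intro dir_deriv_sum_vec f qM Dt V VF_rotate[OF E] finite)
    also have "\<dots> = (\<Sum>j\<in>UNIV. (b k $ j) * (\<Sum>l\<in>UNIV. (b k $ l) * ?C j l))"
    proof (intro sum.cong refl arg_cong2[of _ _ _ _ "(*)"])
      fix j
      have "D (E j) (rotate_frame b E k) q = (\<lambda>c. \<Sum>l\<in>UNIV. (b k $ l) *\<^sub>R D (E j) (E l) q c)"
        unfolding rotate_frame_def[of b E k]
        using D_const_sum_right[OF V qM, of UNIV E j "\<lambda>l. b k $ l"] V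
        by (simp add: fun_eq_iff)
      then show "dir_deriv A q (D (E j) (rotate_frame b E k) q) f = (\<Sum>l\<in>UNIV. (b k $ l) * ?C j l)"
        by (simp only:) (intro dir_deriv_sum_vec f qM Dt V finite)
    qed
    finally show ?thesis by (simp add: sum_distrib_left mult.assoc)
  qed
  have contract: "(\<Sum>k\<in>UNIV. \<Sum>l\<in>UNIV. \<Sum>j\<in>UNIV. (b k $ l) * (b k $ j) * S l j) = (\<Sum>l\<in>UNIV. S l l)" for S :: "'n \<Rightarrow> 'n \<Rightarrow> real"
  proof -
    have "(\<Sum>k\<in>UNIV. \<Sum>l\<in>UNIV. \<Sum>j\<in>UNIV. (b k $ l) * (b k $ j) * S l j)
      = (\<Sum>l\<in>UNIV. \<Sum>k\<in>UNIV. \<Sum>j\<in>UNIV. (b k $ l) * (b k $ j) * S l j)" by (rule sum.swap)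
    also have "\<dots> = (\<Sum>l\<in>UNIV. \<Sum>j\<in>UNIV. \<Sum>k\<in>UNIV. (b k $ l) * (b k $ j) * S l j)"
      by (intro sum.cong refl sum.swap)
    also have "\<dots> = (\<Sum>l\<in>UNIV. \<Sum>j\<in>UNIV. (if l = j then 1 else 0) * S l j)"
      by (simp only: sum_distrib_right[symmetric] orthonormal_columns[OF b])
    also have "\<dots> = (\<Sum>l\<in>UNIV. S l l)" by (simp add: if_distrib[of "\<lambda>x. x * _"] cong: if_cong)
    finally show ?thesis .
  qed
  show ?thesis
    unfolding frame_laplacian_def sum_subtractf first second
    using contract[of "\<lambda>l j. ?H j l"] contract[of ?C] by simp
qed

end

subsection \<open>Harmonic forms\<close>

locale harmonic_tensor = riemannian_mfd M A g D
  for M :: "'a topology" and A :: "('a, 'n::finite) chart set" and g D +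
  fixes \<phi> :: "('a, 'n) bform"
  assumes \<phi>: "sform \<phi>" and harmonic: "harmonic_form M A g D \<phi>"
begin

lemma codazzi:
  assumes "VF X" "VF Y" "VF Z" "p \<in> topspace M"
  shows "nab \<phi> X Y Z p = nab \<phi> Y X Z p"
proof -
  have "d_nabla A D \<phi> X Y Z p = 0"
    using harmonic assms unfolding harmonic_form_def by blast
  then show ?thesis unfolding d_nabla_def by simp
qed

lemma divergence_free:
  assumes "frame U E" "VF Y" "q \<in> U"
  shows "(\<Sum>i\<in>UNIV. nab \<phi> (E i) (E i) Y q) = 0"
proof -
  have "\<forall>U E Y. frame U E \<and> VF Y \<longrightarrow> (\<forall>p\<in>U. delta_nabla A D \<phi> E Y p = 0)"
    using harmonic unfolding harmonic_form_def by (elim conjE)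
  from this[rule_format, OF conjI[OF assms(1,2)] assms(3)]
  show ?thesis unfolding delta_nabla_def by simp
qed

lemma nabla2_codazzi:
  assumes "VF W" "VF X" "VF Y" "VF Z" "p \<in> topspace M"
  shows "nabla2 \<phi> W X Y Z p = nabla2 \<phi> W Y X Z p"
proof -
  have "dir_deriv A p (W p) (\<lambda>q. nab \<phi> X Y Z q) = dir_deriv A p (W p) (\<lambda>q. nab \<phi> Y X Z q)"
    by (rule dir_deriv_cong[OF openin_topspace assms(5)]) (rule codazzi[OF assms(2-4)])
  then show ?thesis
    unfolding nabla2_def
    using codazzi[OF D_VF[OF assms(1,2)] assms(3-5)] codazzi[OF assms(2) D_VF[OF assms(1,3)] assms(4,5)]
      codazzi[OF assms(2,3) D_VF[OF assms(1,4)] assms(5)] by linarith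
qed

text \<open>Since \<open>\<nabla>\<phi>\<close> is symmetric in all its arguments, expansion in
  the first slot gives it in the others.\<close>

lemma nabla_frame_expand2:
  assumes "frame U E" "q \<in> U" "VF X" "VF Y" "VF Z"
  shows "nab \<phi> X Y Z q = (\<Sum>k\<in>UNIV. g q (Y q) (E k q) * nab \<phi> X (E k) Z q)"
  unfolding codazzi[OF assms(3,4,5) frame_topspace[OF assms(1,2)]]
    codazzi[OF assms(3) frame_VF[OF assms(1)] assms(5) frame_topspace[OF assms(1,2)]]
  by (rule nabla_frame_expand[OF \<phi> assms(1,2,4,3,5)])

lemma nabla_frame_expand3:
  assumes "frame U E" "q \<in> U" "VF X" "VF Y" "VF Z"
  shows "nab \<phi> X Y Z q = (\<Sum>k\<in>UNIV. g q (Z q) (E k q) * nab \<phi> X Y (E k) q)"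
  unfolding nabla_sym[OF \<phi> assms(3,4,5) frame_topspace[OF assms(1,2)]]
    nabla_sym[OF \<phi> assms(3,4) frame_VF[OF assms(1)] frame_topspace[OF assms(1,2)]]
  by (rule nabla_frame_expand2[OF assms(1,2,3,5,4)])

text \<open>This is the derivative of the vanishing trace of \<open>\<nabla>\<phi>\<close>: the derivatives of the frame only
  contribute an antisymmetric matrix paired with a symmetric one.\<close>

lemma nabla2_trace:
  assumes E: "frame U E" and q: "q \<in> U" and W: "VF W" and Y: "VF Y"
  shows "(\<Sum>i\<in>UNIV. nabla2 \<phi> W (E i) (E i) Y q) = 0"
proof -
  have qM: "q \<in> topspace M" by (rule frame_topspace[OF E q])
  have V: "VF (E i)" for i by (rule frame_VF[OF E])
  let ?w = "\<lambda>i k. g q (D W (E i) q) (E k q)"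
  have "(\<Sum>i\<in>UNIV. dir_deriv A q (W q) (\<lambda>r. nab \<phi> (E i) (E i) Y r))
     = dir_deriv A q (W q) (\<lambda>r. \<Sum>i\<in>UNIV. nab \<phi> (E i) (E i) Y r)"
    by (rule dir_deriv_sum[symmetric]) (simp_all add: SF_nabla[OF \<phi> V V Y] qM VF_tangent[OF W qM])
  also have "\<dots> = dir_deriv A q (W q) (\<lambda>r. 0)"
    by (rule dir_deriv_cong[OF frame_open[OF E] q]) (rule divergence_free[OF E Y])
  also have "\<dots> = 0" by (rule dir_deriv_const[OF qM VF_tangent[OF W qM]])
  finally have 1: "(\<Sum>i\<in>UNIV. dir_deriv A q (W q) (\<lambda>r. nab \<phi> (E i) (E i) Y r)) = 0" .
  have 2: "(\<Sum>i\<in>UNIV. nab \<phi> (D W (E i)) (E i) Y q) = 0"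
    unfolding nabla_frame_expand[OF \<phi> E q D_VF[OF W V] V Y]
    by (rule antisym_sym_sum_zero[OF frame_connection_antisym[OF E q W]]) (rule codazzi[OF V V Y qM])
  have 3: "(\<Sum>i\<in>UNIV. nab \<phi> (E i) (D W (E i)) Y q) = 0"
    using 2 by (simp only: codazzi[OF V D_VF[OF W V] Y qM])
  have 4: "(\<Sum>i\<in>UNIV. nab \<phi> (E i) (E i) (D W Y) q) = 0"
    by (rule divergence_free[OF E D_VF[OF W Y] q])
  show ?thesis unfolding nabla2_def sum_subtractf 1 2 3 4 by simp
qed

lemma nabla_frame_deriv:
  assumes E: "frame U E" and q: "q \<in> U" and W: "VF W"
  shows "dir_deriv A q (W q) (\<lambda>r. nab \<phi> W (E i) (E j) r) = nabla2 \<phi> W W (E i) (E j) q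
    + nab \<phi> (D W W) (E i) (E j) q
    + ((\<Sum>k\<in>UNIV. g q (D W (E i) q) (E k q) * nab \<phi> W (E k) (E j) q)
     + (\<Sum>k\<in>UNIV. g q (D W (E j) q) (E k q) * nab \<phi> W (E i) (E k) q))"
proof -
  have V: "VF (E i)" for i by (rule frame_VF[OF E])
  show ?thesis
    unfolding nabla2_def
    using nabla_frame_expand2[OF E q W D_VF[OF W V] V, of i j] nabla_frame_expand3[OF E q W V D_VF[OF W V], of i j]
    by linarith
qed

text \<open>The coefficients of the form in the frame differ from \<open>\<nabla>\<phi>\<close> in
  their derivatives by an infinitesimal rotation of the frame, which does not change the
  norm.\<close>

lemma dir_deriv_sqnorm:
  assumes E: "frame U E" and q: "q \<in> U" and W: "VF W"
  shows "dir_deriv A q (W q) (sqnorm \<phi> E) = 2 * (\<Sum>i\<in>UNIV. \<Sum>j\<in>UNIV. \<phi> q (E i q) (E j q) * nab \<phi> W (E i) (E j) q)"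
proof -
  have qM: "q \<in> topspace M" by (rule frame_topspace[OF E q])
  have V: "VF (E i)" for i by (rule frame_VF[OF E])
  have Wt: "W q \<in> T q" by (rule VF_tangent[OF W qM])
  let ?P = "\<lambda>i j. \<phi> q (E i q) (E j q)" and ?N = "\<lambda>i j. nab \<phi> W (E i) (E j) q"
  let ?w = "\<lambda>i k. g q (D W (E i) q) (E k q)"
  let ?R = "\<lambda>i j. (\<Sum>k\<in>UNIV. ?w i k * ?P k j) + (\<Sum>k\<in>UNIV. ?w j k * ?P i k)"
  have S: "SF (\<lambda>r. \<phi> r (E i r) (E j r))" for i j by (rule SF_form[OF \<phi> V V])
  have "dir_deriv A q (W q) (sqnorm \<phi> E)
    = (\<Sum>i\<in>UNIV. \<Sum>j\<in>UNIV. ?P i j * (?N i j + ?R i j) + (?N i j + ?R i j) * ?P i j)"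
    unfolding sqnorm_def
    by (simp add: dir_deriv_sum[OF _ _ qM Wt] SF_sum SF_mult S dir_deriv_mult[OF S S qM Wt] form_frame_deriv[OF \<phi> E q W])
  also have "\<dots> = (\<Sum>i\<in>UNIV. \<Sum>j\<in>UNIV. 2 * (?P i j * ?N i j) + (?P i j * ?R i j + ?R i j * ?P i j))"
    by (intro sum.cong refl) (simp add: algebra_simps)
  also have "\<dots> = (\<Sum>i\<in>UNIV. \<Sum>j\<in>UNIV. 2 * (?P i j * ?N i j)) + 0"
    using infinitesimal_rotation_cancel[of ?w ?P ?P, OF frame_connection_antisym[OF E q W]]
    by (simp only: sum.distrib)
  finally show ?thesis by (simp add: sum_distrib_left)
qed

text \<open>As for the first derivative, the rotation of the frame acts on \<open>\<phi>\<close>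
  and on \<open>\<nabla>\<phi>\<close> simultaneously and leaves their inner product
  unchanged.\<close>

lemma bochner_direction:
  assumes E: "frame U E" and q: "q \<in> U" and W: "VF W"
  shows "dir_deriv A q (W q) (\<lambda>r. dir_deriv A r (W r) (sqnorm \<phi> E)) - dir_deriv A q (D W W q) (sqnorm \<phi> E)
    = 2 * (\<Sum>i\<in>UNIV. \<Sum>j\<in>UNIV. (nab \<phi> W (E i) (E j) q)\<^sup>2 + \<phi> q (E i q) (E j q) * nabla2 \<phi> W W (E i) (E j) q)"
proof -
  have qM: "q \<in> topspace M" by (rule frame_topspace[OF E q])
  have V: "VF (E i)" for i by (rule frame_VF[OF E])
  have Wt: "W q \<in> T q" by (rule VF_tangent[OF W qM])
  let ?P = "\<lambda>i j. \<phi> q (E i q) (E j q)" and ?N = "\<lambda>i j. nab \<phi> W (E i) (E j) q"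
  let ?w = "\<lambda>i k. g q (D W (E i) q) (E k q)"
  let ?R = "\<lambda>Q i j. (\<Sum>k\<in>UNIV. ?w i k * Q k j) + (\<Sum>k\<in>UNIV. ?w j k * Q i k)"
  let ?N2 = "\<lambda>i j. nabla2 \<phi> W W (E i) (E j) q" and ?L = "\<lambda>i j. nab \<phi> (D W W) (E i) (E j) q"
  have S: "SF (\<lambda>r. \<phi> r (E i r) (E j r))" for i j by (rule SF_form[OF \<phi> V V])
  have SN: "SF (\<lambda>r. nab \<phi> W (E i) (E j) r)" for i j by (rule SF_nabla[OF \<phi> W V V])
  have S2: "SF (\<lambda>r. \<Sum>i\<in>UNIV. \<Sum>j\<in>UNIV. \<phi> r (E i r) (E j r) * nab \<phi> W (E i) (E j) r)"
    by (intro SF_sum SF_mult S SN)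
  have "dir_deriv A q (W q) (\<lambda>r. dir_deriv A r (W r) (sqnorm \<phi> E))
    = dir_deriv A q (W q) (\<lambda>r. 2 * (\<Sum>i\<in>UNIV. \<Sum>j\<in>UNIV. \<phi> r (E i r) (E j r) * nab \<phi> W (E i) (E j) r))"
    by (rule dir_deriv_cong[OF frame_open[OF E] q]) (rule dir_deriv_sqnorm[OF E _ W])
  also have "\<dots> = 2 * (\<Sum>i\<in>UNIV. \<Sum>j\<in>UNIV. ?P i j * (?N2 i j + ?L i j + ?R ?N i j) + (?N i j + ?R ?P i j) * ?N i j)"
    by (simp add: dir_deriv_cmult[OF S2 qM Wt] dir_deriv_sum[OF _ _ qM Wt] SF_sum SF_mult S SN
        dir_deriv_mult[OF S SN qM Wt] form_frame_deriv[OF \<phi> E q W] nabla_frame_deriv[OF E q W])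
  also have "\<dots> = 2 * (\<Sum>i\<in>UNIV. \<Sum>j\<in>UNIV. ((?N i j)\<^sup>2 + ?P i j * ?N2 i j) + (?P i j * ?L i j)
      + (?P i j * ?R ?N i j + ?R ?P i j * ?N i j))"
    by (intro arg_cong2[of _ _ _ _ "(*)"] sum.cong refl) (simp add: algebra_simps power2_eq_square)
  also have "\<dots> = 2 * ((\<Sum>i\<in>UNIV. \<Sum>j\<in>UNIV. (?N i j)\<^sup>2 + ?P i j * ?N2 i j) + (\<Sum>i\<in>UNIV. \<Sum>j\<in>UNIV. ?P i j * ?L i j) + 0)"
    unfolding infinitesimal_rotation_cancel[of ?w ?P ?N, OF frame_connection_antisym[OF E q W], symmetric]
    by (simp only: sum.distrib)
  finally show ?thesis
    unfolding dir_deriv_sqnorm[OF E q D_VF[OF W W]] by (simp add: algebra_simps)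
qed

text \<open>The right-hand side of the Bochner formula in a frame that diagonalises
  \<open>\<phi>\<close> at \<open>q\<close>; the second sum runs over sectional
  curvatures.\<close>

definition bochner_energy :: "('n \<Rightarrow> ('a, 'n) vfield) \<Rightarrow> 'a \<Rightarrow> real" where
  "bochner_energy E q = 2 * (\<Sum>k\<in>UNIV. \<Sum>i\<in>UNIV. \<Sum>j\<in>UNIV. (nab \<phi> (E k) (E i) (E j) q)\<^sup>2)
    + (\<Sum>k\<in>UNIV. \<Sum>j\<in>UNIV. g q (curvature A D (E k) (E j) (E j) q) (E k q) * (\<phi> q (E j q) (E j q) - \<phi> q (E k q) (E k q))\<^sup>2)"

text \<open>In \<open>commute\<close> the Codazzi equation exchanges the second and third
  arguments of \<open>\<nabla>\<^sup>2\<phi>\<close> and the Ricci identity the first two. After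
  summation over \<open>k\<close> the new second derivative is that of a trace and
  vanishes.\<close>

theorem bochner_formula:
  assumes E: "frame U E" and q: "q \<in> U" and diag: "\<And>i j. i \<noteq> j \<Longrightarrow> \<phi> q (E i q) (E j q) = 0"
  shows "frame_laplacian E (sqnorm \<phi> E) q = bochner_energy E q"
proof -
  have qM: "q \<in> topspace M" by (rule frame_topspace[OF E q])
  have V: "VF (E i)" for i by (rule frame_VF[OF E])
  note Et = frame_tangent[OF E q]
  let ?l = "\<lambda>j. \<phi> q (E j q) (E j q)"
  let ?K = "\<lambda>k j. g q (curvature A D (E k) (E j) (E j) q) (E k q)"
  have ct: "curvature A D (E k) (E j) (E i) q \<in> T q" for i j k
    by (rule curvature_tangent[OF V V V qM])
  have eigen: "\<phi> q v (E j q) = ?l j * g q v (E j q)" if "v \<in> T q" for v j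
  proof -
    have "\<phi> q v (E j q) = (\<Sum>k\<in>UNIV. g q v (E k q) * \<phi> q (E k q) (E j q))"
      by (rule form_frame_expand[OF \<phi> E q that Et])
    also have "\<dots> = (\<Sum>k\<in>UNIV. if k = j then g q v (E k q) * ?l j else 0)"
      by (rule sum.cong) (auto simp: diag)
    finally show ?thesis by simp
  qed
  have anti: "g q (curvature A D (E k) (E j) (E k) q) (E j q) = - ?K k j" for k j
    using curvature_antisym[OF V[of k] V[of j] V[of k] V[of j] qM] form_sym[OF g_form qM ct Et] by simp
  have Ksym: "?K k j = ?K j k" for k j
  proof -
    have "?K j k = - g q (curvature A D (E k) (E j) (E k) q) (E j q)"
      unfolding curvature_swap[OF V[of k] V[of j] V[of k] qM]
      using form_lin_left[OF g_form qM ct[of k j k] tangent_0 Et[of j], of "-1"] form_zero_left[OF g_form qM Et] by simp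
    then show ?thesis using anti by simp
  qed
  have commute: "nabla2 \<phi> (E k) (E k) (E j) (E j) q = nabla2 \<phi> (E j) (E k) (E k) (E j) q + (?l j - ?l k) * ?K k j" for k j
  proof -
    have "nabla2 \<phi> (E k) (E k) (E j) (E j) q = nabla2 \<phi> (E k) (E j) (E k) (E j) q"
      by (rule nabla2_codazzi[OF V V V V qM])
    also have "\<dots> = nabla2 \<phi> (E j) (E k) (E k) (E j) q
        - \<phi> q (curvature A D (E k) (E j) (E k) q) (E j q) - \<phi> q (E k q) (curvature A D (E k) (E j) (E j) q)"
      using ricci_identity[OF \<phi> V[of k] V[of j] V[of k] V[of j] qM] by linarith
    also have "\<phi> q (E k q) (curvature A D (E k) (E j) (E j) q) = ?l k * ?K k j"
      unfolding form_sym[OF \<phi> qM Et ct] by (rule eigen[OF ct])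
    also have "\<phi> q (curvature A D (E k) (E j) (E k) q) (E j q) = - ?l j * ?K k j"
      unfolding eigen[OF ct] anti by simp
    finally show ?thesis by (simp add: algebra_simps)
  qed
  have "(\<Sum>k\<in>UNIV. \<Sum>j\<in>UNIV. ?l j * nabla2 \<phi> (E j) (E k) (E k) (E j) q)
     = (\<Sum>j\<in>UNIV. ?l j * (\<Sum>k\<in>UNIV. nabla2 \<phi> (E j) (E k) (E k) (E j) q))"
    unfolding sum_distrib_left by (rule sum.swap)
  also have "\<dots> = 0" by (simp add: nabla2_trace[OF E q V V])
  finally have tr: "(\<Sum>k\<in>UNIV. \<Sum>j\<in>UNIV. ?l j * nabla2 \<phi> (E j) (E k) (E k) (E j) q) = 0" .
  have "frame_laplacian E (sqnorm \<phi> E) q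
    = (\<Sum>k\<in>UNIV. 2 * (\<Sum>i\<in>UNIV. \<Sum>j\<in>UNIV. (nab \<phi> (E k) (E i) (E j) q)\<^sup>2 + \<phi> q (E i q) (E j q) * nabla2 \<phi> (E k) (E k) (E i) (E j) q))"
    unfolding frame_laplacian_def by (simp only: bochner_direction[OF E q V])
  also have "\<dots> = 2 * (\<Sum>k\<in>UNIV. \<Sum>i\<in>UNIV. \<Sum>j\<in>UNIV. (nab \<phi> (E k) (E i) (E j) q)\<^sup>2)
      + 2 * (\<Sum>k\<in>UNIV. \<Sum>i\<in>UNIV. \<Sum>j\<in>UNIV. \<phi> q (E i q) (E j q) * nabla2 \<phi> (E k) (E k) (E i) (E j) q)"
    by (simp only: sum_distrib_left[symmetric] sum.distrib distrib_left)
  also have "(\<Sum>k\<in>UNIV. \<Sum>i\<in>UNIV. \<Sum>j\<in>UNIV. \<phi> q (E i q) (E j q) * nabla2 \<phi> (E k) (E k) (E i) (E j) q)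
      = (\<Sum>k\<in>UNIV. \<Sum>i\<in>UNIV. ?l i * nabla2 \<phi> (E k) (E k) (E i) (E i) q)"
  proof (intro sum.cong refl)
    fix k i
    have "(\<Sum>j\<in>UNIV. \<phi> q (E i q) (E j q) * nabla2 \<phi> (E k) (E k) (E i) (E j) q)
      = (\<Sum>j\<in>UNIV. if i = j then ?l i * nabla2 \<phi> (E k) (E k) (E i) (E i) q else 0)"
      by (rule sum.cong) (auto simp: diag)
    then show "(\<Sum>j\<in>UNIV. \<phi> q (E i q) (E j q) * nabla2 \<phi> (E k) (E k) (E i) (E j) q) = ?l i * nabla2 \<phi> (E k) (E k) (E i) (E i) q"
      by simp
  qed
  also have "\<dots> = (\<Sum>k\<in>UNIV. \<Sum>j\<in>UNIV. ?l j * ((?l j - ?l k) * ?K k j))"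
    unfolding commute distrib_left sum.distrib tr by simp
  also have "2 * \<dots> = (\<Sum>k\<in>UNIV. \<Sum>j\<in>UNIV. ?K k j * (?l j - ?l k)\<^sup>2)"
    by (rule symmetrized_difference_sum[OF Ksym])
  finally show ?thesis unfolding bochner_energy_def .
qed

end

section \<open>Subharmonic functions on compact manifolds\<close>

context riemannian_mfd
begin

lemma frame_laplacian_cong:
  assumes E: "frame U E" and q: "q \<in> U" and eq: "\<And>r. r \<in> U \<Longrightarrow> f r = h r"
  shows "frame_laplacian E f q = frame_laplacian E h q"
proof -
  note c = dir_deriv_cong[OF frame_open[OF E] _ eq]
  have "dir_deriv A q (E k q) (\<lambda>r. dir_deriv A r (E k r) f) = dir_deriv A q (E k q) (\<lambda>r. dir_deriv A r (E k r) h)" for k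
    by (rule dir_deriv_cong[OF frame_open[OF E] q]) (rule c)
  then show ?thesis unfolding frame_laplacian_def by (simp only: c[OF q])
qed

lemma frame_laplacian_const:
  assumes E: "frame U E" and q: "q \<in> U" and const: "\<And>r. r \<in> topspace M \<Longrightarrow> f r = m"
  shows "frame_laplacian E f q = 0"
proof -
  have qM: "q \<in> topspace M" by (rule frame_topspace[OF E q])
  have V: "VF (E i)" for i by (rule frame_VF[OF E])
  have d: "dir_deriv A r v f = 0" if "r \<in> topspace M" "v \<in> T r" for r v
    using dir_deriv_cong[OF openin_topspace that(1) const] dir_deriv_const[OF that] by simp
  have "dir_deriv A q (E k q) (\<lambda>r. dir_deriv A r (E k r) f) = dir_deriv A q (E k q) (\<lambda>r. 0)" for k
    by (rule dir_deriv_cong[OF openin_topspace qM]) (rule d[OF _ VF_tangent[OF V]])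
  then have "dir_deriv A q (E k q) (\<lambda>r. dir_deriv A r (E k r) f) = 0" for k
    using dir_deriv_const[OF qM VF_tangent[OF V qM]] by simp
  then show ?thesis
    unfolding frame_laplacian_def by (simp add: d[OF qM D_tangent[OF V V qM]])
qed

text \<open>In a chart, the Laplacian of a frame is a sum of squares of the coordinate fields of the frame
  up to a first-order term, and the frame spans, so the strong maximum principle applies.\<close>

lemma frame_laplacian_chart:
  assumes E: "frame U E" and f: "SF f" and c: "c \<in> A" and y: "y \<in> cmap c ` (U \<inter> cdom c)"
  shows "sum_squares_op (\<lambda>k y. E k (cinv c y) c) (\<lambda>y. \<Sum>k\<in>UNIV. D (E k) (E k) (cinv c y) c) (\<lambda>y. f (cinv c y)) y
    = frame_laplacian E f (cinv c y)"
proof -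
  have yc: "y \<in> cimg c" using y by blast
  have V: "VF (E i)" for i by (rule frame_VF[OF E])
  have lin: "linear (FD (\<lambda>y. f (cinv c y)) y)"
    by (rule has_derivative_linear[OF smooth_on_imp_has_derivative[OF SF_chart[OF f c] yc]])
  show ?thesis
    unfolding sum_squares_op_def frame_laplacian_def sum_subtractf
    by (simp only: dir_deriv_twice_chart[OF f V V c yc] dir_deriv_field_chart[OF f D_VF[OF V V] c yc] linear_sum[OF lin])
qed

text \<open>Because the frame spans, a vector orthogonal to all its coordinate vectors would be orthogonal to
  itself.\<close>

lemma frame_elliptic:
  assumes E: "frame U E" and c: "c \<in> A" and q: "q \<in> U" "q \<in> cdom c" and w: "w \<noteq> 0"
  shows "\<exists>k. E k q c \<bullet> w \<noteq> 0"
proof (rule ccontr)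
  assume "\<not> ?thesis"
  then have 0: "E k q c \<bullet> w = 0" for k by blast
  let ?v = "coord_tangent c q w"
  have "w = ?v c" by (rule coord_tangent_self[OF c q(2), symmetric])
  also have "\<dots> = (\<Sum>k\<in>UNIV. g q ?v (E k q) *\<^sub>R E k q c)"
    using fun_cong[OF frame_expand[OF E q(1) coord_tangent_in[OF c q(2)]], of w c] .
  finally have "w \<bullet> w = (\<Sum>k\<in>UNIV. g q ?v (E k q) *\<^sub>R E k q c) \<bullet> w" by simp
  also have "\<dots> = 0" by (simp add: inner_sum_left 0)
  finally show False using w by simp
qed

lemma subharmonic_locally_constant_at_max:
  assumes f: "SF f" and E: "frame U E" and p: "p \<in> U" "f p = m"
    and le: "\<And>q. q \<in> topspace M \<Longrightarrow> f q \<le> m"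
    and sub: "\<And>q. q \<in> U \<Longrightarrow> frame_laplacian E f q \<ge> 0"
  obtains W where "openin M W" "p \<in> W" "\<And>q. q \<in> W \<Longrightarrow> f q = m"
proof -
  have V: "VF (E i)" for i by (rule frame_VF[OF E])
  obtain c where c: "c \<in> A" "p \<in> cdom c" using chart_around[OF frame_topspace[OF E p(1)]] by blast
  let ?S = "cmap c ` (U \<inter> cdom c)"
  have S: "open ?S" by (rule open_cmap_image[OF c(1) frame_open[OF E]])
  have sub_img: "?S \<subseteq> cimg c" by blast
  have inU: "cinv c y \<in> U" "cinv c y \<in> cdom c" if "y \<in> ?S" for y
    using that cinv_cmap[OF c(1)] by auto
  obtain r where r: "r > 0" "ball (cmap c p) r \<subseteq> ?S" "\<And>y. y \<in> ball (cmap c p) r \<Longrightarrow> f (cinv c y) = m"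
  proof (rule strong_maximum_principle_local[OF S])
    show "smooth_on ?S (\<lambda>y. f (cinv c y))" by (rule smooth_on_subset[OF SF_chart[OF f c(1)] sub_img])
    show "smooth_on ?S (\<lambda>y. E k (cinv c y) c)" for k by (rule smooth_on_subset[OF VF_chart[OF V c(1)] sub_img])
    show "smooth_on ?S (\<lambda>y. \<Sum>k\<in>UNIV. D (E k) (E k) (cinv c y) c)"
      by (intro smooth_on_sum S smooth_on_subset[OF VF_chart[OF D_VF[OF V V] c(1)] sub_img])
    show "\<exists>k. E k (cinv c y) c \<bullet> w \<noteq> 0" if "y \<in> ?S" "w \<noteq> 0" for y w
      by (rule frame_elliptic[OF E c(1) inU[OF that(1)] that(2)])
    show "sum_squares_op (\<lambda>k y. E k (cinv c y) c) (\<lambda>y. \<Sum>k\<in>UNIV. D (E k) (E k) (cinv c y) c) (\<lambda>y. f (cinv c y)) y \<ge> 0"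
      if "y \<in> ?S" for y
      unfolding frame_laplacian_chart[OF E f c(1) that] by (rule sub[OF inU(1)[OF that]])
    show "f (cinv c y) \<le> m" if "y \<in> ?S" for y
      by (rule le[OF frame_topspace[OF E inU(1)[OF that]]])
    show "cmap c p \<in> ?S" using p c by blast
    show "f (cinv c (cmap c p)) = m" using cinv_cmap[OF c] p by simp
  qed blast
  show ?thesis
  proof (rule that)
    show "openin M {q \<in> cdom c. cmap c q \<in> ball (cmap c p) r}"
      by (rule openin_cmap_vimage[OF c(1)]) simp
    show "p \<in> {q \<in> cdom c. cmap c q \<in> ball (cmap c p) r}" using c r by simp
    show "f q = m" if "q \<in> {q \<in> cdom c. cmap c q \<in> ball (cmap c p) r}" for q
      using r(3)[of "cmap c q"] cinv_cmap[OF c(1), of q] that by auto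
  qed
qed

text \<open>The set where the maximum is attained is closed by continuity and open by the strong
  maximum principle.\<close>

theorem subharmonic_constant:
  assumes compact: "compact_space M" and connected: "connected_space M" and f: "SF f"
    and sub: "\<And>U E q. frame U E \<Longrightarrow> q \<in> U \<Longrightarrow> frame_laplacian E f q \<ge> 0"
  obtains m where "\<And>q. q \<in> topspace M \<Longrightarrow> f q = m"
proof (cases "topspace M = {}")
  case False
  have cont: "continuous_map M euclideanreal f" by (rule SF_continuous[OF f])
  have "compactin euclideanreal (f ` topspace M)"
    using image_compactin[OF _ cont] compact unfolding compact_space_def by blast
  then have "compact (f ` topspace M)" by simp
  from compact_attains_sup[OF this] False obtain p where p: "p \<in> topspace M" "\<And>q. q \<in> topspace M \<Longrightarrow> f q \<le> f p"
    by blast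
  let ?S = "{q \<in> topspace M. f q \<in> {f p}}"
  have "openin M ?S"
  proof (subst openin_subopen, intro ballI)
    fix q assume q: "q \<in> ?S"
    then have qM: "q \<in> topspace M" and fq: "f q = f p" by simp_all
    obtain U E where E: "frame U E" "q \<in> U" using frame_exists[OF qM] by blast
    obtain W where W: "openin M W" "q \<in> W" "\<And>r. r \<in> W \<Longrightarrow> f r = f p"
      by (rule subharmonic_locally_constant_at_max[OF f E fq p(2) sub[OF E(1)]]) blast+
    then have "W \<subseteq> ?S" using openin_subset by fastforce
    then show "\<exists>W. openin M W \<and> q \<in> W \<and> W \<subseteq> ?S" using W(1,2) by blast
  qed
  moreover have "closedin M ?S"
    by (rule closedin_continuous_map_preimage[OF cont]) simp
  ultimately have "?S = {} \<or> ?S = topspace M"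
    using connected unfolding connected_space_clopen_in by blast
  then have "?S = topspace M" using p(1) by blast
  then show ?thesis using that[of "f p"] by blast
qed (use that in blast)

text \<open>The globally defined function \<open>|\<phi>|\<^sup>2\<close>. A frame is chosen at each point separately, which is
  harmless because the value does not depend on it.\<close>

definition form_sqnorm :: "('a, 'n) bform \<Rightarrow> 'a \<Rightarrow> real" where
  "form_sqnorm \<phi> q = sqnorm \<phi> (SOME E. \<exists>U. frame U E \<and> q \<in> U) q"

lemma form_sqnorm_frame:
  assumes "sform \<phi>" "frame U E" "q \<in> U"
  shows "form_sqnorm \<phi> q = sqnorm \<phi> E q"
proof -
  define E' where "E' = (SOME E. \<exists>U. frame U E \<and> q \<in> U)"
  have "\<exists>E U. frame U E \<and> q \<in> U" using assms by blast
  from someI_ex[OF this] obtain U' where U': "frame U' E'" "q \<in> U'" unfolding E'_def by blast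
  show ?thesis
    unfolding form_sqnorm_def E'_def[symmetric]
    by (rule sqnorm_frame_independent[OF assms(1,2) U'(1) assms(3) U'(2)])
qed

lemma SF_form_sqnorm:
  assumes "sform \<phi>"
  shows "SF (form_sqnorm \<phi>)"
proof (rule SF_cong_local)
  fix p assume "p \<in> topspace M"
  then obtain U E where E: "frame U E" "p \<in> U" using frame_exists by blast
  show "\<exists>U h. openin M U \<and> p \<in> U \<and> SF h \<and> (\<forall>q\<in>U. form_sqnorm \<phi> q = h q)"
    using frame_open[OF E(1)] E(2) SF_sqnorm[OF assms E(1)] form_sqnorm_frame[OF assms E(1)] by blast
qed

lemma sec_curv_frame:
  assumes "frame U E" "q \<in> U" "k \<noteq> j"
  shows "sec_curv A g D (E k) (E j) q = g q (curvature A D (E k) (E j) (E j) q) (E k q)"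
  unfolding sec_curv_def frame_orthonormal[OF assms(1,2)] using assms(3) by simp

lemma lin_indep_frame:
  assumes E: "frame U E" and q: "q \<in> U" and ne: "k \<noteq> j"
  shows "lin_indep2 (E k q) (E j q)"
  unfolding lin_indep2_def
proof (intro allI impI)
  fix a b assume *: "\<forall>c. a *\<^sub>R E k q c + b *\<^sub>R E j q c = 0"
  have qM: "q \<in> topspace M" by (rule frame_topspace[OF E q])
  note Et = frame_tangent[OF E q]
  have "g q (\<lambda>c. a *\<^sub>R E k q c + (\<lambda>c. b *\<^sub>R E j q c + 0) c) (E i q) = a * (if k = i then 1 else 0) + b * (if j = i then 1 else 0)" for i
    by (simp only: form_lin_left[OF g_form qM Et tangent_lin[OF Et tangent_0] Et]
        form_lin_left[OF g_form qM Et tangent_0 Et] form_zero_left[OF g_form qM Et] frame_orthonormal[OF E q])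
  moreover have "(\<lambda>c. a *\<^sub>R E k q c + (\<lambda>c. b *\<^sub>R E j q c + 0) c) = (\<lambda>c. 0)"
    by (rule ext) (use spec[OF *] in \<open>simp only: add_0_right\<close>)
  ultimately have "a * (if k = i then 1 else 0) + b * (if j = i then 1 else 0) = 0" for i
    using form_zero_left[OF g_form qM Et] by metis
  from this[of k] this[of j] show "a = 0 \<and> b = 0" using ne by simp
qed

text \<open>The eigenbasis of the coefficient matrix of \<open>\<phi>\<close> at \<open>q\<close>
  gives a rotation with constant coefficients, so the rotated fields are again a frame on all of
  \<open>U\<close>.\<close>

lemma diagonalizing_rotation:
  assumes \<phi>: "sform \<phi>" and E: "frame U E" and q: "q \<in> U"
  obtains b where "\<And>i j. b i \<bullet> b j = (if i = j then 1 else 0)"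
    "\<And>i j. i \<noteq> j \<Longrightarrow> \<phi> q (rotate_frame b E i q) (rotate_frame b E j q) = 0"
proof -
  let ?B = "\<lambda>u v :: real^'n. \<Sum>i\<in>UNIV. \<Sum>j\<in>UNIV. (u $ i) * (v $ j) * \<phi> q (E i q) (E j q)"
  have B: "bilinear ?B"
    unfolding bilinear_def
    by (auto intro!: linearI simp: distrib_left distrib_right sum.distrib sum_distrib_left mult_ac)
  have sym: "?B u v = ?B v u" for u v
  proof -
    have "?B u v = (\<Sum>j\<in>UNIV. \<Sum>i\<in>UNIV. (u $ i) * (v $ j) * \<phi> q (E i q) (E j q))" by (rule sum.swap)
    also have "\<dots> = ?B v u"
      using form_sym[OF \<phi> frame_topspace[OF E q] frame_tangent[OF E q] frame_tangent[OF E q]]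
      by (intro sum.cong refl) (simp add: mult_ac)
    finally show ?thesis .
  qed
  obtain b :: "'n \<Rightarrow> real^'n" where b: "\<And>i j. b i \<bullet> b j = (if i = j then 1 else 0)"
    "\<And>i j. i \<noteq> j \<Longrightarrow> ?B (b i) (b j) = 0"
    using symmetric_bilinear_eigenbasis[of ?B, OF B sym] by blast
  show ?thesis
    by (rule that[OF b(1)]) (unfold form_rotate[OF \<phi> E q], rule b(2))
qed

end

section \<open>Harmonic forms under nonnegative curvature\<close>

context harmonic_tensor
begin

text \<open>Every frame can be rotated at a given point so that the Bochner formula applies there; neither the
  Laplacian nor \<open>|\<phi>|\<^sup>2\<close> notices the rotation.\<close>

lemma bochner_at_point:
  assumes E: "frame U E" and q: "q \<in> U"
  obtains E' where "frame U E'" "\<And>i j. i \<noteq> j \<Longrightarrow> \<phi> q (E' i q) (E' j q) = 0"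
    "frame_laplacian E (form_sqnorm \<phi>) q = bochner_energy E' q"
proof -
  obtain b where b: "\<And>i j. b i \<bullet> b j = (if i = j then 1 else 0)"
    and diag: "\<And>i j. i \<noteq> j \<Longrightarrow> \<phi> q (rotate_frame b E i q) (rotate_frame b E j q) = 0"
    using diagonalizing_rotation[OF \<phi> E q] by blast
  have E': "frame U (rotate_frame b E)" by (rule frame_rotate[OF E b])
  have "frame_laplacian E (form_sqnorm \<phi>) q = frame_laplacian (rotate_frame b E) (form_sqnorm \<phi>) q"
    by (rule frame_laplacian_rotate[OF E b q SF_form_sqnorm[OF \<phi>], symmetric])
  also have "\<dots> = frame_laplacian (rotate_frame b E) (sqnorm \<phi> (rotate_frame b E)) q"
    by (rule frame_laplacian_cong[OF E' q form_sqnorm_frame[OF \<phi> E']])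
  finally have L: "frame_laplacian E (form_sqnorm \<phi>) q
      = frame_laplacian (rotate_frame b E) (sqnorm \<phi> (rotate_frame b E)) q" .
  show ?thesis
    by (rule that[OF E']) (rule diag, assumption, unfold L, rule bochner_formula[OF E' q], rule diag)
qed

lemma bochner_curvature_term_nonneg:
  assumes E: "frame U E" and q: "q \<in> U" and sec: "sec_nonneg_at M A g D q"
  shows "g q (curvature A D (E k) (E j) (E j) q) (E k q) * (\<phi> q (E j q) (E j q) - \<phi> q (E k q) (E k q))\<^sup>2 \<ge> 0"
proof (cases "k = j")
  case False
  have "sec_curv A g D (E k) (E j) q \<ge> 0"
    using sec frame_VF[OF E] lin_indep_frame[OF E q False] unfolding sec_nonneg_at_def by blast
  then show ?thesis unfolding sec_curv_frame[OF E q False] by simp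
qed simp

lemma sqnorm_subharmonic:
  assumes E: "frame U E" and q: "q \<in> U" and sec: "sec_nonneg_at M A g D q"
  shows "frame_laplacian E (form_sqnorm \<phi>) q \<ge> 0"
proof -
  obtain E' where E': "frame U E'" and
    L: "frame_laplacian E (form_sqnorm \<phi>) q = bochner_energy E' q"
    by (rule bochner_at_point[OF E q]) blast
  show ?thesis
    unfolding L bochner_energy_def
    by (intro add_nonneg_nonneg mult_nonneg_nonneg sum_nonneg bochner_curvature_term_nonneg[OF E' q sec]) simp_all
qed

lemma triple_sum_squares_zero:
  fixes x :: "'n \<Rightarrow> 'n \<Rightarrow> 'n \<Rightarrow> real"
  assumes "(\<Sum>k\<in>UNIV. \<Sum>i\<in>UNIV. \<Sum>j\<in>UNIV. (x k i j)\<^sup>2) = 0"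
  shows "x k i j = 0"
proof -
  have "(\<Sum>i\<in>UNIV. \<Sum>j\<in>UNIV. (x k i j)\<^sup>2) = 0"
    using assms by (subst (asm) sum_nonneg_eq_0_iff) (auto intro!: sum_nonneg)
  then have "(\<Sum>j\<in>UNIV. (x k i j)\<^sup>2) = 0"
    by (subst (asm) sum_nonneg_eq_0_iff) (auto intro!: sum_nonneg)
  then show ?thesis by (subst (asm) sum_nonneg_eq_0_iff) auto
qed

text \<open>Both sums in the Bochner formula are nonnegative, so they vanish separately. Where all
  sectional curvatures are positive this leaves no room for two different eigenvalues.\<close>

lemma equality_case:
  assumes E: "frame U E" and q: "q \<in> U" and sec: "sec_nonneg_at M A g D q"
    and L0: "frame_laplacian E (form_sqnorm \<phi>) q = 0"
  shows "VF X \<Longrightarrow> VF Y \<Longrightarrow> VF Z \<Longrightarrow> nab \<phi> X Y Z q = 0"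
    and "sec_pos_at M A g D q \<Longrightarrow> \<exists>l. \<forall>u\<in>T q. \<forall>v\<in>T q. \<phi> q u v = l * g q u v"
proof -
  obtain E' where E': "frame U E'" and diag: "\<And>i j. i \<noteq> j \<Longrightarrow> \<phi> q (E' i q) (E' j q) = 0" and
    L: "frame_laplacian E (form_sqnorm \<phi>) q = bochner_energy E' q"
    by (rule bochner_at_point[OF E q]) blast
  let ?N = "\<Sum>k\<in>UNIV. \<Sum>i\<in>UNIV. \<Sum>j\<in>UNIV. (nab \<phi> (E' k) (E' i) (E' j) q)\<^sup>2"
  let ?t = "\<lambda>k j. g q (curvature A D (E' k) (E' j) (E' j) q) (E' k q) * (\<phi> q (E' j q) (E' j q) - \<phi> q (E' k q) (E' k q))\<^sup>2"
  have t: "?t k j \<ge> 0" for k j by (rule bochner_curvature_term_nonneg[OF E' q sec])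
  have "?N \<ge> 0" by (intro sum_nonneg) simp
  moreover have "(\<Sum>k\<in>UNIV. \<Sum>j\<in>UNIV. ?t k j) \<ge> 0" by (intro sum_nonneg t)
  moreover have "2 * ?N + (\<Sum>k\<in>UNIV. \<Sum>j\<in>UNIV. ?t k j) = 0" using L L0 by (simp only: bochner_energy_def)
  ultimately have N0: "?N = 0" and t0: "(\<Sum>k\<in>UNIV. \<Sum>j\<in>UNIV. ?t k j) = 0" by linarith+
  have V: "VF (E' i)" for i by (rule frame_VF[OF E'])
  have n0: "nab \<phi> (E' k) (E' i) (E' j) q = 0" for k i j by (rule triple_sum_squares_zero[OF N0])
  show "nab \<phi> X Y Z q = 0" if "VF X" "VF Y" "VF Z"
    unfolding nabla_frame_expand[OF \<phi> E' q that] nabla_frame_expand2[OF E' q V that(2,3)]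
      nabla_frame_expand3[OF E' q V V that(3)] by (simp add: n0)
  have tz: "?t k j = 0" for k j
  proof -
    have "(\<Sum>j\<in>UNIV. ?t k j) = 0" using t0 by (subst (asm) sum_nonneg_eq_0_iff) (auto intro!: sum_nonneg t)
    then show ?thesis by (subst (asm) sum_nonneg_eq_0_iff) (auto intro: t)
  qed
  show "\<exists>l. \<forall>u\<in>T q. \<forall>v\<in>T q. \<phi> q u v = l * g q u v" if pos: "sec_pos_at M A g D q"
  proof -
    have same: "\<phi> q (E' j q) (E' j q) = \<phi> q (E' k q) (E' k q)" for k j
    proof (cases "k = j")
      case False
      have "sec_curv A g D (E' k) (E' j) q > 0"
        using pos V lin_indep_frame[OF E' q False] unfolding sec_pos_at_def by blast
      then show ?thesis using tz[of k j] unfolding sec_curv_frame[OF E' q False] by simp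
    qed simp
    define l where "l = \<phi> q (E' undefined q) (E' undefined q)"
    note Et = frame_tangent[OF E' q] and qM = frame_topspace[OF E' q]
    have e: "\<phi> q (E' i q) (E' j q) = l * g q (E' i q) (E' j q)" for i j
      unfolding frame_orthonormal[OF E' q] l_def using diag[of i j] same[of i undefined] by auto
    have r: "\<phi> q v (E' j q) = l * g q v (E' j q)" if "v \<in> T q" for v j
    proof -
      have "\<phi> q v (E' j q) = (\<Sum>k\<in>UNIV. g q v (E' k q) * \<phi> q (E' k q) (E' j q))"
        by (rule form_frame_expand[OF \<phi> E' q that Et])
      also have "\<dots> = l * (\<Sum>k\<in>UNIV. g q v (E' k q) * g q (E' k q) (E' j q))"
        by (simp add: e sum_distrib_left mult_ac)
      also have "(\<Sum>k\<in>UNIV. g q v (E' k q) * g q (E' k q) (E' j q)) = g q v (E' j q)"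
        by (rule form_frame_expand[OF g_form E' q that Et, symmetric])
      finally show ?thesis .
    qed
    have "\<phi> q u v = l * g q u v" if "u \<in> T q" "v \<in> T q" for u v
    proof -
      have e': "\<phi> q (E' k q) v = l * g q (E' k q) v" for k
        unfolding form_sym[OF \<phi> qM Et that(2)] form_sym[OF g_form qM Et that(2)] by (rule r[OF that(2)])
      have "\<phi> q u v = (\<Sum>k\<in>UNIV. g q u (E' k q) * \<phi> q (E' k q) v)"
        by (rule form_frame_expand[OF \<phi> E' q that])
      also have "\<dots> = l * (\<Sum>k\<in>UNIV. g q u (E' k q) * g q (E' k q) v)"
        by (simp add: e' sum_distrib_left mult_ac)
      also have "(\<Sum>k\<in>UNIV. g q u (E' k q) * g q (E' k q) v) = g q u v"
        by (rule form_frame_expand[OF g_form E' q that, symmetric])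
      finally show ?thesis .
    qed
    then show ?thesis by blast
  qed
qed

lemma sqnorm_constant:
  assumes "compact_space M" "connected_space M" "\<forall>p\<in>topspace M. sec_nonneg_at M A g D p"
  obtains m where "\<And>q. q \<in> topspace M \<Longrightarrow> form_sqnorm \<phi> q = m"
proof (rule subharmonic_constant[OF assms(1,2) SF_form_sqnorm[OF \<phi>]])
  show "frame_laplacian E (form_sqnorm \<phi>) q \<ge> 0" if "frame U E" "q \<in> U" for U E q
    using sqnorm_subharmonic[OF that] assms(3) frame_topspace[OF that] by blast
qed (use that in blast)

theorem parallel:
  assumes "compact_space M" "connected_space M" "\<forall>p\<in>topspace M. sec_nonneg_at M A g D p"
  shows "parallel_form M A D \<phi>"
    and "p \<in> topspace M \<Longrightarrow> sec_pos_at M A g D p \<Longrightarrow> \<exists>l. \<forall>u\<in>T p. \<forall>v\<in>T p. \<phi> p u v = l * g p u v"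
proof -
  obtain m where m: "\<And>q. q \<in> topspace M \<Longrightarrow> form_sqnorm \<phi> q = m"
    using sqnorm_constant[OF assms] by blast
  have "(VF X \<and> VF Y \<and> VF Z \<longrightarrow> nab \<phi> X Y Z q = 0) \<and>
     (sec_pos_at M A g D q \<longrightarrow> (\<exists>l. \<forall>u\<in>T q. \<forall>v\<in>T q. \<phi> q u v = l * g q u v))" if q: "q \<in> topspace M" for q X Y Z
  proof -
    obtain U E where E: "frame U E" "q \<in> U" using frame_exists[OF q] by blast
    have sec: "sec_nonneg_at M A g D q" using assms(3) q by blast
    note e = equality_case[OF E sec frame_laplacian_const[OF E m]]
    show ?thesis using e by blast
  qed
  then show "parallel_form M A D \<phi>"
    and "p \<in> topspace M \<Longrightarrow> sec_pos_at M A g D p \<Longrightarrow> \<exists>l. \<forall>u\<in>T p. \<forall>v\<in>T p. \<phi> p u v = l * g p u v"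
    unfolding parallel_form_def by blast+
qed

end

text \<open>Since \<open>\<nabla>g = 0\<close>, the covariant derivative of the new form is that of \<open>\<phi>\<close>.\<close>

lemma (in harmonic_tensor) harmonic_minus_metric:
  "harmonic_tensor M A g D (\<lambda>p u v. \<phi> p u v - l * g p u v)"
proof -
  let ?\<psi> = "\<lambda>p u v. \<phi> p u v - l * g p u v"
  have \<psi>: "sform ?\<psi>"
    unfolding smooth_sym_form_def o_def
  proof (intro conjI ballI allI)
    fix p u v assume p: "p \<in> topspace M" and u: "u \<in> T p" and v: "v \<in> T p"
    show "?\<psi> p u v = ?\<psi> p v u"
      using form_sym[OF \<phi> p u v] form_sym[OF g_form p u v] by simp
    show "?\<psi> p (\<lambda>c. a *\<^sub>R u c + v c) w = a * ?\<psi> p u w + ?\<psi> p v w" if "w \<in> T p" for w a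
      using form_lin_left[OF \<phi> p u v that] form_lin_left[OF g_form p u v that] by (simp add: algebra_simps)
  next
    fix c i j assume c: "c \<in> A"
    let ?co = "\<lambda>\<phi> y. \<phi> (cinv c y) (coord_vec A c i (cinv c y)) (coord_vec A c j (cinv c y))"
    have s: "smooth_on (cimg c) (?co \<phi>)" if "sform \<phi>" for \<phi>
      using that c unfolding smooth_sym_form_def o_def by blast
    have "smooth_on (cimg c) (\<lambda>y. ?co \<phi> y + (- l) * ?co g y)"
      by (intro smooth_on_add smooth_on_mult smooth_on_const open_cimg c s \<phi> g_form)
    then show "smooth_on (cimg c) (\<lambda>y. ?\<psi> (cinv c y) (coord_vec A c i (cinv c y)) (coord_vec A c j (cinv c y)))"
      by simp
  qed
  have nab: "nab ?\<psi> X Y Z p = nab \<phi> X Y Z p" if "VF X" "VF Y" "VF Z" "p \<in> topspace M" for X Y Z p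
  proof -
    have "dir_deriv A p (X p) (\<lambda>q. \<phi> q (Y q) (Z q) - l * g q (Y q) (Z q))
      = dir_deriv A p (X p) (\<lambda>q. \<phi> q (Y q) (Z q)) - l * dir_deriv A p (X p) (\<lambda>q. g q (Y q) (Z q))"
      using dir_deriv_diff[OF SF_form[OF \<phi> that(2,3)] SF_mult[OF SF_const SF_form[OF g_form that(2,3)]] that(4) VF_tangent[OF that(1,4)], of l]
        dir_deriv_cmult[OF SF_form[OF g_form that(2,3)] that(4) VF_tangent[OF that(1,4)], of l] by simp
    then have "nab ?\<psi> X Y Z p = nab \<phi> X Y Z p - l * nab g X Y Z p"
      unfolding nabla_def by (simp add: algebra_simps)
    then show ?thesis by (simp add: nabla_metric[OF that])
  qed
  have "harmonic_form M A g D ?\<psi>"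
    unfolding harmonic_form_def
  proof (intro conjI allI impI ballI)
    fix X Y Z p assume "VF X \<and> VF Y \<and> VF Z" "p \<in> topspace M"
    then show "d_nabla A D ?\<psi> X Y Z p = 0"
      unfolding d_nabla_def using codazzi[of X Y Z p] nab[of X Y Z p] nab[of Y X Z p] by simp
  next
    fix U E Y p assume *: "frame U E \<and> VF Y" and p: "p \<in> U"
    then have E: "frame U E" and Y: "VF Y" by simp_all
    have V: "VF (E i)" for i by (rule frame_VF[OF E])
    show "delta_nabla A D ?\<psi> E Y p = 0"
      unfolding delta_nabla_def nab[OF V V Y frame_topspace[OF E p]] divergence_free[OF E Y p] by simp
  qed
  with \<psi> show ?thesis by unfold_locales
qed

theorem corollary3p1:
  fixes M :: "'a topology" and A :: "('a, 'n::finite) chart set"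
    and g :: "('a, 'n) bform" and D :: "('a, 'n) connection"
  assumes "smooth_manifold M A"
    and "compact_space M"
    and "connected_space M"
    and "riemannian_metric M A g"
    and "levi_civita_connection M A g D"
    and "\<forall>p\<in>topspace M. sec_nonneg_at M A g D p"
  shows "(\<forall>\<phi>. smooth_sym_form M A \<phi> \<and> harmonic_form M A g D \<phi> \<longrightarrow> parallel_form M A D \<phi>) \<and>
         ((\<exists>p\<in>topspace M. sec_pos_at M A g D p) \<longrightarrow>
           (\<forall>\<phi>. smooth_sym_form M A \<phi> \<and> harmonic_form M A g D \<phi> \<longrightarrow> trivial_form M A g \<phi>))"
proof -
  have tensor: "harmonic_tensor M A g D \<phi>" if "smooth_sym_form M A \<phi> \<and> harmonic_form M A g D \<phi>" for \<phi>
    using that assms(1,4,5) by unfold_locales blast+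
  have "parallel_form M A D \<phi>" if \<phi>: "smooth_sym_form M A \<phi> \<and> harmonic_form M A g D \<phi>" for \<phi>
  proof -
    interpret harmonic_tensor M A g D \<phi> by (rule tensor[OF \<phi>])
    show ?thesis by (rule parallel(1)[OF assms(2,3,6)])
  qed
  moreover have "trivial_form M A g \<phi>"
    if \<phi>: "smooth_sym_form M A \<phi> \<and> harmonic_form M A g D \<phi>" and "\<exists>p\<in>topspace M. sec_pos_at M A g D p" for \<phi>
  proof -
    interpret harmonic_tensor M A g D \<phi> by (rule tensor[OF \<phi>])
    from that(2) obtain p where p: "p \<in> topspace M" "sec_pos_at M A g D p" by blast
    obtain l where l: "\<And>u v. u \<in> T p \<Longrightarrow> v \<in> T p \<Longrightarrow> \<phi> p u v = l * g p u v"
      using parallel(2)[OF assms(2,3,6) p] by blast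
    define \<psi> where "\<psi> = (\<lambda>p u v. \<phi> p u v - l * g p u v)"
    interpret diff: harmonic_tensor M A g D \<psi> unfolding \<psi>_def by (rule harmonic_minus_metric)
    obtain m where m: "\<And>q. q \<in> topspace M \<Longrightarrow> form_sqnorm \<psi> q = m"
      using diff.sqnorm_constant[OF assms(2,3,6)] by blast
    have "m = 0"
    proof -
      obtain U E where E: "frame U E" "p \<in> U" using frame_exists[OF p(1)] by blast
      have "sqnorm \<psi> E p = 0"
        unfolding sqnorm_def by (simp add: \<psi>_def l frame_tangent[OF E])
      then show ?thesis using m[OF p(1)] form_sqnorm_frame[OF diff.\<phi> E] by simp
    qed
    have "\<phi> q u v = l * g q u v" if q: "q \<in> topspace M" and uv: "u \<in> T q" "v \<in> T q" for q u v
    proof -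
      obtain U E where E: "frame U E" "q \<in> U" using frame_exists[OF q] by blast
      have "sqnorm \<psi> E q = 0" using m[OF q] form_sqnorm_frame[OF diff.\<phi> E] \<open>m = 0\<close> by simp
      from sqnorm_zero_imp_form_zero[OF diff.\<phi> E this uv] show ?thesis by (simp add: \<psi>_def)
    qed
    then show "trivial_form M A g \<phi>" unfolding trivial_form_def by blast
  qed
  ultimately show ?thesis by blast
qed

end
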